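(* Let $0<q<1$ and $0<s\le 1$, and let $\mathcal{A}(S^2_{q,s})$, the Hilbert space $\mathcal{H}=\ell^2(\mathbb{N})\oplus\ell^2(\mathbb{N})$, the representation $\pi=\pi_+\oplus\pi_-$, and the operators $F$, $\gamma$, $K$ be as in the context. Then the (even) Fredholm module $(\mathcal{A}(S^2_{q,s}),F,\mathcal{H})$ can be regarded as a $2$-summable modular Fredholm module with respect to the von Neumann algebra $\mathcal{N}=\mathcal{B}(\mathcal{H})$ and the weight $$\Phi(S)=\mathrm{Tr}\big(K^{1/2}SK^{1/2}\big),\qquad 0\le S\in\mathcal{B}(\mathcal{H}).$$ The modular automorphism $\sigma(T)=K^{-1}TK$ leaves $\mathcal{A}(S^2_{q,s})$ invariant, and its restriction is given by $$\sigma(A)=A,\qquad\sigma(B)=q^{-2}B,\qquad\sigma(B^* )=q^2B^*.$$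
   Context: $\mathcal{A}(S^2_{q,s})$ (Podleś sphere) is the universal unital $*$-algebra generated by $A=A^*$, $B$, $B^*$ with relations $B^*B+(A-1)(A+s^2)=0$, $BB^*+(q^2A-1)(q^2A+s^2)=0$, $AB=q^{-2}BA$. Representations on $\ell^2(\mathbb{N})$ with orthonormal basis $\{e_k\}_{k\in\mathbb{N}}$, $\mathbb{N}=\{0,1,2,\dots\}$: $\pi_+(B)e_k=\sqrt{1-q^{2k}}\sqrt{s^2+q^{2k}}\,e_{k-1}$, $\pi_+(A)e_k=q^{2k}e_k$; $\pi_-(B)e_k=s\sqrt{1-q^{2k}}\sqrt{1+s^2q^{2k}}\,e_{k-1}$, $\pi_-(A)e_k=-s^2q^{2k}e_k$. On $\mathcal{H}=\ell^2(\mathbb{N})\oplus\ell^2(\mathbb{N})$ let $\pi(a)=\pi_+(a)\oplus\pi_-(a)$, $\gamma=\begin{pmatrix}1&0\\0&-1\end{pmatrix}$, $F=\begin{pmatrix}0&1\\1&0\end{pmatrix}$, and $K$ the unbounded positive diagonal operator $Ke_{k,\pm}=q^{-2k}e_{k,\pm}$, where $e_{k,+}$, $e_{k,-}$ are the basis vectors of the first and second summand. The algebra is identified with its image under $\pi$. Modular Fredholm modules. Let $\mathcal{N}$ be a von Neumann algebra on $\mathcal{H}$ and $\Phi$ a faithful normal semifinite weight on $\mathcal{N}$ with modular group $\sigma^\Phi$; $\mathrm{dom}(\Phi)$ is the linear span of positive elements of finite weight. $(\mathcal{A},\mathcal{H},F)$ is an $n$-summable unital modular Fredholm module with respect to $(\mathcal{N},\Phi)$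 if: (o) $\mathcal{A}$ is a separable unital $*$-subalgebra of $\mathcal{N}$; (i) $\mathcal{A}$ is globally invariant under $\sigma^\Phi$ and consists of analytic vectors for it; (ii) $F=F^*$ lies in the fixed point algebra $\mathcal{M}=\mathcal{N}^{\sigma^\Phi}$ and $F^2=1$; (iii) $[F,a]^n\in\mathrm{dom}(\Phi)$ for all $a\in\mathcal{A}$. It is even if there is $\gamma=\gamma^*\in\mathcal{M}$ with $\gamma^2=1$, $\gamma a=a\gamma$ for all $a\in\mathcal{A}$ and $\gamma F+F\gamma=0$. *)

theory Defs
  imports "HOL-Analysis.Analysis"
begin

section \<open>Complex Hilbert spaces\<close>

class scaleC =
  fixes scaleC :: "complex \<Rightarrow> 'a \<Rightarrow> 'a"  (infixr "*\<^sub>C" 75)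

text \<open>The inner product is antilinear in the first argument; the norm and the topology are those
  of the underlying real Hilbert space.\<close>

class chilbert = real_inner + banach + scaleC +
  fixes cinner :: "'a \<Rightarrow> 'a \<Rightarrow> complex"
  assumes scaleC_of_real: "of_real r *\<^sub>C x = r *\<^sub>R x"
    and scaleC_add_right: "c *\<^sub>C (x + y) = c *\<^sub>C x + c *\<^sub>C y"
    and scaleC_add_left: "(c + d) *\<^sub>C x = c *\<^sub>C x + d *\<^sub>C x"
    and scaleC_scaleC: "c *\<^sub>C d *\<^sub>C x = (c * d) *\<^sub>C x"
    and cinner_commute: "cinner x y = cnj (cinner y x)"
    and cinner_add_right: "cinner x (y + z) = cinner x y + cinner x z"
    and cinner_scaleC_right: "cinner x (c *\<^sub>C y) = c * cinner x y"
    and inner_eq_Re_cinner: "inner x y = Re (cinner x y)"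

lemma cinner_scaleC_left: "cinner (c *\<^sub>C x) y = cnj c * cinner (x::'a::chilbert) y"
  by (subst cinner_commute, subst cinner_scaleC_right, subst (2) cinner_commute) simp

lemma cinner_self: "cinner x x = of_real ((norm (x::'a::chilbert))\<^sup>2)"
proof -
  have "Im (cinner x x) = 0"
    using arg_cong[OF cinner_commute[of x x], of Im] by simp
  moreover have "Re (cinner x x) = (norm x)\<^sup>2"
    by (simp flip: inner_eq_Re_cinner add: power2_norm_eq_inner)
  ultimately show ?thesis by (simp add: complex_eq_iff)
qed

lemma norm_scaleC: "norm (c *\<^sub>C x) = cmod c * norm (x::'a::chilbert)"
proof -
  have "complex_of_real ((norm (c *\<^sub>C x))\<^sup>2) = (c * cnj c) * of_real ((norm x)\<^sup>2)"
    by (simp only: cinner_self[symmetric] cinner_scaleC_right cinner_scaleC_left) simp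
  also have "\<dots> = of_real ((cmod c * norm x)\<^sup>2)"
    by (simp add: complex_norm_square[symmetric] power_mult_distrib)
  finally have "(norm (c *\<^sub>C x))\<^sup>2 = (cmod c * norm x)\<^sup>2"
    by (simp only: of_real_eq_iff)
  then show ?thesis by (simp add: power2_eq_iff_nonneg)
qed

lemma bounded_linear_scaleC: "bounded_linear (\<lambda>x::'a::chilbert. c *\<^sub>C x)"
proof (rule bounded_linear_intro[where K = "cmod c"])
  show "c *\<^sub>C (r *\<^sub>R x) = r *\<^sub>R (c *\<^sub>C x)" for r and x :: 'a
    by (simp flip: scaleC_of_real add: scaleC_scaleC mult.commute)
qed (simp_all add: scaleC_add_right norm_scaleC mult.commute)

instantiation prod :: (chilbert, chilbert) chilbert
begin

definition scaleC_prod :: "complex \<Rightarrow> 'a \<times> 'b \<Rightarrow> 'a \<times> 'b" where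
  "c *\<^sub>C x = (c *\<^sub>C fst x, c *\<^sub>C snd x)"

definition cinner_prod :: "'a \<times> 'b \<Rightarrow> 'a \<times> 'b \<Rightarrow> complex" where
  "cinner x y = cinner (fst x) (fst y) + cinner (snd x) (snd y)"

instance
proof
  show "cinner x y = cnj (cinner y x)" for x y :: "'a \<times> 'b"
    unfolding cinner_prod_def complex_cnj_add by (simp flip: cinner_commute)
qed (simp_all add: scaleC_prod_def cinner_prod_def scaleC_of_real scaleC_add_right
      scaleC_add_left scaleC_scaleC cinner_add_right cinner_scaleC_right inner_eq_Re_cinner
      inner_prod_def scaleR_prod_def algebra_simps)

end


section \<open>The Hilbert space of square-summable sequences\<close>

definition square_summable :: "(nat \<Rightarrow> complex) \<Rightarrow> bool" where
  "square_summable f \<longleftrightarrow> summable (\<lambda>n. (cmod (f n))\<^sup>2)"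

lemma square_summable_add:
  assumes "square_summable f" "square_summable g"
  shows "square_summable (\<lambda>n. f n + g n)"
  unfolding square_summable_def
proof (rule summable_comparison_test')
  show "summable (\<lambda>n. 2 * (cmod (f n))\<^sup>2 + 2 * (cmod (g n))\<^sup>2)"
    using assms by (intro summable_add summable_mult) (auto simp: square_summable_def)
  fix n
  have "(cmod (f n + g n))\<^sup>2 \<le> (cmod (f n) + cmod (g n))\<^sup>2"
    by (intro power_mono norm_triangle_ineq norm_ge_zero)
  also have "\<dots> \<le> 2 * (cmod (f n))\<^sup>2 + 2 * (cmod (g n))\<^sup>2"
    using zero_le_power2[of "cmod (f n) - cmod (g n)"]
    by (simp add: power2_eq_square algebra_simps)
  finally show "norm ((cmod (f n + g n))\<^sup>2) \<le> 2 * (cmod (f n))\<^sup>2 + 2 * (cmod (g n))\<^sup>2"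
    by simp
qed

lemma square_summable_mult:
  "square_summable f \<Longrightarrow> square_summable (\<lambda>n. c * f n)"
  unfolding square_summable_def
  by (simp add: norm_mult power_mult_distrib summable_mult)

lemma square_summable_finite:
  "finite {n. f n \<noteq> 0} \<Longrightarrow> square_summable f"
  unfolding square_summable_def by (rule summable_finite[of "{n. f n \<noteq> 0}"]) auto

typedef ell2 = "{f :: nat \<Rightarrow> complex. square_summable f}"
  morphisms coord Abs_ell2
  by (rule exI[of _ "\<lambda>_. 0"]) (simp add: square_summable_def)

setup_lifting type_definition_ell2

lemma square_summable_coord: "square_summable (coord x)"
  using coord by simp

lemma ell2_eqI: "(\<And>n. coord x n = coord y n) \<Longrightarrow> x = y"
  by (simp add: coord_inject[symmetric] fun_eq_iff)

lemma summable_cinner_coord: "summable (\<lambda>n. cnj (coord x n) * coord y n)"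
proof (rule summable_comparison_test')
  show "summable (\<lambda>n. (cmod (coord x n))\<^sup>2 + (cmod (coord y n))\<^sup>2)"
    using square_summable_coord by (intro summable_add) (auto simp: square_summable_def)
  fix n
  show "norm (cnj (coord x n) * coord y n) \<le> (cmod (coord x n))\<^sup>2 + (cmod (coord y n))\<^sup>2"
    using zero_le_power2[of "cmod (coord x n) - cmod (coord y n)"]
      mult_nonneg_nonneg[OF norm_ge_zero norm_ge_zero, of "coord x n" "coord y n"]
    unfolding power2_diff norm_mult complex_mod_cnj by linarith
qed

instantiation ell2 :: "{real_vector, scaleC}"
begin

lift_definition zero_ell2 :: ell2 is "\<lambda>_. 0"
  by (simp add: square_summable_def)
lift_definition plus_ell2 :: "ell2 \<Rightarrow> ell2 \<Rightarrow> ell2" is "\<lambda>f g n. f n + g n"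
  by (rule square_summable_add)
lift_definition uminus_ell2 :: "ell2 \<Rightarrow> ell2" is "\<lambda>f n. - f n"
  by (simp add: square_summable_def)
lift_definition minus_ell2 :: "ell2 \<Rightarrow> ell2 \<Rightarrow> ell2" is "\<lambda>f g n. f n - g n"
  using square_summable_add[OF _ square_summable_mult[of _ "-1"]] by force
lift_definition scaleR_ell2 :: "real \<Rightarrow> ell2 \<Rightarrow> ell2" is "\<lambda>r f n. of_real r * f n"
  by (rule square_summable_mult)
lift_definition scaleC_ell2 :: "complex \<Rightarrow> ell2 \<Rightarrow> ell2" is "\<lambda>c f n. c * f n"
  by (rule square_summable_mult)

instance
  by standard (transfer; simp add: algebra_simps)+

end

lemmas coord_simps [simp] =
  zero_ell2.rep_eq plus_ell2.rep_eq uminus_ell2.rep_eq minus_ell2.rep_eq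
  scaleR_ell2.rep_eq scaleC_ell2.rep_eq

definition ell2_cinner :: "ell2 \<Rightarrow> ell2 \<Rightarrow> complex" where
  "ell2_cinner x y = (\<Sum>n. cnj (coord x n) * coord y n)"

lemma ell2_cinner_commute: "ell2_cinner x y = cnj (ell2_cinner y x)"
proof -
  have "(\<lambda>n. cnj (cnj (coord y n) * coord x n)) sums cnj (ell2_cinner y x)"
    unfolding ell2_cinner_def sums_cnj by (rule summable_sums[OF summable_cinner_coord])
  then show ?thesis
    unfolding ell2_cinner_def by (simp add: sums_iff mult.commute)
qed

lemma ell2_cinner_add_right: "ell2_cinner x (y + z) = ell2_cinner x y + ell2_cinner x z"
  unfolding ell2_cinner_def
  by (simp add: distrib_left suminf_add[OF summable_cinner_coord summable_cinner_coord])

lemma ell2_cinner_scaleC_right: "ell2_cinner x (c *\<^sub>C y) = c * ell2_cinner x y"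
  unfolding ell2_cinner_def
  by (simp add: suminf_mult[OF summable_cinner_coord, symmetric] mult.left_commute)

lemma ell2_scaleR_scaleC: "r *\<^sub>R (x::ell2) = of_real r *\<^sub>C x"
  by (rule ell2_eqI) simp

lemma ell2_cinner_self: "ell2_cinner x x = of_real (\<Sum>n. (cmod (coord x n))\<^sup>2)"
proof -
  have "summable (\<lambda>n. (cmod (coord x n))\<^sup>2)"
    using square_summable_coord by (simp add: square_summable_def)
  then show ?thesis
    unfolding ell2_cinner_def
    by (simp add: suminf_of_real complex_norm_square mult.commute del: of_real_power flip: of_real_power)
qed

instantiation ell2 :: real_inner
begin

definition inner_ell2 :: "ell2 \<Rightarrow> ell2 \<Rightarrow> real" where
  "inner x y = Re (ell2_cinner x y)"

definition norm_ell2 :: "ell2 \<Rightarrow> real" where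
  "norm x = sqrt (inner x x)" for x :: ell2

definition dist_ell2 :: "ell2 \<Rightarrow> ell2 \<Rightarrow> real" where
  "dist x y = norm (x - y)" for x y :: ell2

definition sgn_ell2 :: "ell2 \<Rightarrow> ell2" where
  "sgn x = x /\<^sub>R norm x" for x :: ell2

definition uniformity_ell2 :: "(ell2 \<times> ell2) filter" where
  "uniformity_ell2 = (INF e\<in>{0 <..}. principal {(x, y). dist x y < e})"

definition open_ell2 :: "ell2 set \<Rightarrow> bool" where
  "open_ell2 U \<longleftrightarrow> (\<forall>x\<in>U. eventually (\<lambda>(x', y). x' = x \<longrightarrow> y \<in> U) uniformity)"

instance
proof
  fix x y z :: ell2 and r :: real
  have s: "summable (\<lambda>n. (cmod (coord x n))\<^sup>2)"
    using square_summable_coord by (simp add: square_summable_def)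
  show "inner x y = inner y x"
    unfolding inner_ell2_def by (subst ell2_cinner_commute) simp
  show "inner (x + y) z = inner x z + inner y z"
    unfolding inner_ell2_def
    by (subst (1 2 3) ell2_cinner_commute) (simp add: ell2_cinner_add_right)
  show "inner (r *\<^sub>R x) y = r * inner x y"
    unfolding inner_ell2_def
    by (subst (1 2) ell2_cinner_commute) (simp add: ell2_scaleR_scaleC ell2_cinner_scaleC_right)
  show "0 \<le> inner x x"
    unfolding inner_ell2_def by (simp add: ell2_cinner_self suminf_nonneg[OF s])
  show "inner x x = 0 \<longleftrightarrow> x = 0"
    unfolding inner_ell2_def
    by (auto simp: ell2_cinner_self suminf_eq_zero_iff[OF s] intro!: ell2_eqI)
qed (rule norm_ell2_def dist_ell2_def sgn_ell2_def uniformity_ell2_def open_ell2_def)+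

end

lemma norm_ell2_power2: "(norm (x::ell2))\<^sup>2 = (\<Sum>n. (cmod (coord x n))\<^sup>2)"
  by (simp add: power2_norm_eq_inner inner_ell2_def ell2_cinner_self)

lemma sum_coord_le_norm: "(\<Sum>n<k. (cmod (coord x n))\<^sup>2) \<le> (norm x)\<^sup>2"
  unfolding norm_ell2_power2
  by (rule sum_le_suminf) (use square_summable_coord[of x] in \<open>auto simp: square_summable_def\<close>)

lemma cmod_coord_le_norm: "cmod (coord x n) \<le> norm x"
proof -
  have "(cmod (coord x n))\<^sup>2 \<le> (\<Sum>k<Suc n. (cmod (coord x k))\<^sup>2)"
    by (simp add: sum_nonneg)
  also have "\<dots> \<le> (norm x)\<^sup>2"
    by (rule sum_coord_le_norm)
  finally show ?thesis
    by (simp add: power2_le_iff_abs_le)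
qed

instance ell2 :: banach
proof
  fix X :: "nat \<Rightarrow> ell2"
  assume X: "Cauchy X"
  have "Cauchy (\<lambda>m. coord (X m) n)" for n
  proof (rule metric_CauchyI)
    fix e :: real
    assume "0 < e"
    from metric_CauchyD[OF X this] obtain M where
      M: "\<And>m k. m \<ge> M \<Longrightarrow> k \<ge> M \<Longrightarrow> dist (X m) (X k) < e" by blast
    have "dist (coord (X m) n) (coord (X k) n) < e" if "m \<ge> M" "k \<ge> M" for m k
      using M[OF that] cmod_coord_le_norm[of "X m - X k" n] by (simp add: dist_norm)
    then show "\<exists>M. \<forall>m\<ge>M. \<forall>k\<ge>M. dist (coord (X m) n) (coord (X k) n) < e" by blast
  qed
  then have "\<exists>l. (\<lambda>m. coord (X m) n) \<longlonglongrightarrow> l" for n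
    by (simp add: Cauchy_convergent_iff convergent_def)
  then obtain l where l: "\<And>n. (\<lambda>m. coord (X m) n) \<longlonglongrightarrow> l n" by metis
  have bound: "\<exists>M. \<forall>m\<ge>M. \<forall>k. (\<Sum>n<k. (cmod (coord (X m) n - l n))\<^sup>2) \<le> e\<^sup>2"
    if "0 < e" for e :: real
  proof -
    from metric_CauchyD[OF X that] obtain M where
      M: "\<And>m k. m \<ge> M \<Longrightarrow> k \<ge> M \<Longrightarrow> dist (X m) (X k) < e" by blast
    have "(\<Sum>n<k. (cmod (coord (X m) n - l n))\<^sup>2) \<le> e\<^sup>2" if "m \<ge> M" for m k
    proof (rule LIMSEQ_le_const2)
      show "(\<lambda>j. \<Sum>n<k. (cmod (coord (X m) n - coord (X j) n))\<^sup>2)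
          \<longlonglongrightarrow> (\<Sum>n<k. (cmod (coord (X m) n - l n))\<^sup>2)"
        by (intro tendsto_intros l)
      have "(\<Sum>n<k. (cmod (coord (X m) n - coord (X j) n))\<^sup>2) \<le> e\<^sup>2" if "j \<ge> M" for j
      proof -
        have "(norm (X m - X j))\<^sup>2 \<le> e\<^sup>2"
          using M[OF \<open>m \<ge> M\<close> that] by (intro power_mono) (auto simp: dist_norm)
        then show ?thesis
          using sum_coord_le_norm[of "X m - X j" k] by simp
      qed
      then show "\<exists>N. \<forall>j\<ge>N. (\<Sum>n<k. (cmod (coord (X m) n - coord (X j) n))\<^sup>2) \<le> e\<^sup>2"
        by blast
    qed
    then show ?thesis by blast
  qed
  have sq: "square_summable (\<lambda>n. coord (X m) n - l n)"
    if "\<forall>k. (\<Sum>n<k. (cmod (coord (X m) n - l n))\<^sup>2) \<le> e\<^sup>2" for m and e :: real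
    unfolding square_summable_def
    by (rule summableI_nonneg_bounded[where x = "e\<^sup>2"]) (use that in auto)
  obtain M where "\<forall>k. (\<Sum>n<k. (cmod (coord (X M) n - l n))\<^sup>2) \<le> 1\<^sup>2"
    using bound[of 1] by auto
  from sq[OF this] have
    "square_summable (\<lambda>n. coord (X M) n + (-1) * (coord (X M) n - l n))"
    by (intro square_summable_add square_summable_mult square_summable_coord)
  then have "square_summable l" by simp
  then have L: "coord (Abs_ell2 l) = l" by (simp add: Abs_ell2_inverse)
  have "X \<longlonglongrightarrow> Abs_ell2 l"
  proof (rule metric_LIMSEQ_I)
    fix e :: real
    assume "0 < e"
    then have "0 < e / 2" by simp
    from bound[OF this] obtain M where
      M: "\<And>m k. m \<ge> M \<Longrightarrow> (\<Sum>n<k. (cmod (coord (X m) n - l n))\<^sup>2) \<le> (e / 2)\<^sup>2" by blast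
    have "dist (X m) (Abs_ell2 l) < e" if "m \<ge> M" for m
    proof -
      have "(norm (X m - Abs_ell2 l))\<^sup>2 \<le> (e / 2)\<^sup>2"
        unfolding norm_ell2_power2
        by (rule suminf_le_const)
          (use M[OF that] square_summable_coord[of "X m - Abs_ell2 l"] in
            \<open>auto simp: L square_summable_def\<close>)
      then have "norm (X m - Abs_ell2 l) \<le> e / 2"
        using \<open>0 < e\<close> by (simp add: power2_le_iff_abs_le)
      then show ?thesis
        using \<open>0 < e\<close> by (simp add: dist_norm)
    qed
    then show "\<exists>M. \<forall>m\<ge>M. dist (X m) (Abs_ell2 l) < e" by blast
  qed
  then show "convergent X" by (auto simp: convergent_def)
qed

instantiation ell2 :: chilbert
begin

definition cinner_ell2 :: "ell2 \<Rightarrow> ell2 \<Rightarrow> complex" where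
  "cinner_ell2 = ell2_cinner"

instance
  by standard
    (auto simp: cinner_ell2_def inner_ell2_def ell2_cinner_add_right ell2_cinner_scaleC_right
      ell2_scaleR_scaleC algebra_simps intro: ell2_eqI ell2_cinner_commute)

end

definition ket :: "nat \<Rightarrow> ell2" where
  "ket k = Abs_ell2 (\<lambda>n. if n = k then 1 else 0)"

lemma coord_ket [simp]: "coord (ket k) n = (if n = k then 1 else 0)"
proof -
  have "square_summable (\<lambda>n. if n = k then 1 else 0)"
    by (rule square_summable_finite) simp
  then show ?thesis by (simp add: ket_def Abs_ell2_inverse)
qed


section \<open>Bounded operators\<close>

text \<open>Bounded real-linear maps are provided, with the operator norm, by the library type of
  bounded linear functions; the bounded operators are the complex-linear ones among them.\<close>

type_synonym 'h op = "'h \<Rightarrow>\<^sub>L 'h"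

definition BH :: "'h::chilbert op set" where
  "BH = {T. \<forall>c x. blinfun_apply T (c *\<^sub>C x) = c *\<^sub>C blinfun_apply T x}"

instantiation blinfun :: (real_normed_vector, chilbert) scaleC
begin

definition scaleC_blinfun :: "complex \<Rightarrow> ('a \<Rightarrow>\<^sub>L 'b) \<Rightarrow> 'a \<Rightarrow>\<^sub>L 'b" where
  "c *\<^sub>C T = Blinfun (\<lambda>x. c *\<^sub>C blinfun_apply T x)"

instance ..

end

lemma scaleC_blinfun_apply [simp]: "blinfun_apply (c *\<^sub>C T) x = c *\<^sub>C T x"
  unfolding scaleC_blinfun_def
  by (subst bounded_linear_Blinfun_apply)
    (rule bounded_linear_compose[OF bounded_linear_scaleC blinfun.bounded_linear_right] refl)+

definition adj :: "'h::chilbert op \<Rightarrow> 'h op" where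
  "adj T = (THE S. S \<in> BH \<and> (\<forall>x y. cinner (S x) y = cinner x (T y)))"

definition positive_op :: "'h::chilbert op \<Rightarrow> bool" where
  "positive_op T \<longleftrightarrow> T \<in> BH \<and> (\<forall>x. cinner x (T x) \<in> \<real> \<and> 0 \<le> Re (cinner x (T x)))"

definition le_op :: "'h::chilbert op \<Rightarrow> 'h op \<Rightarrow> bool" where
  "le_op S T \<longleftrightarrow> positive_op (T - S)"

definition op_power :: "'h::real_normed_vector op \<Rightarrow> nat \<Rightarrow> 'h op" where
  "op_power T n = ((\<lambda>S. T o\<^sub>L S) ^^ n) id_blinfun"

definition commutator :: "'h::real_normed_vector op \<Rightarrow> 'h op \<Rightarrow> 'h op" where
  "commutator S T = (S o\<^sub>L T) - (T o\<^sub>L S)"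

definition unital_star_subalgebra :: "'h::chilbert op set \<Rightarrow> 'h op set \<Rightarrow> bool" where
  "unital_star_subalgebra A N \<longleftrightarrow> A \<subseteq> N \<and> id_blinfun \<in> A \<and>
     (\<forall>x\<in>A. \<forall>y\<in>A. x + y \<in> A \<and> x o\<^sub>L y \<in> A) \<and>
     (\<forall>c. \<forall>x\<in>A. c *\<^sub>C x \<in> A) \<and> (\<forall>x\<in>A. adj x \<in> A)"

definition norm_separable :: "'h::real_normed_vector op set \<Rightarrow> bool" where
  "norm_separable A \<longleftrightarrow> (\<exists>C. countable C \<and> C \<subseteq> A \<and> A \<subseteq> closure C)"

definition algebra_automorphism :: "'h::chilbert op set \<Rightarrow> ('h op \<Rightarrow> 'h op) \<Rightarrow> bool" where
  "algebra_automorphism A \<alpha> \<longleftrightarrow> bij_betw \<alpha> A A \<and> \<alpha> id_blinfun = id_blinfun \<and>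
     (\<forall>x\<in>A. \<forall>y\<in>A. \<alpha> (x + y) = \<alpha> x + \<alpha> y \<and> \<alpha> (x o\<^sub>L y) = \<alpha> x o\<^sub>L \<alpha> y) \<and>
     (\<forall>c. \<forall>x\<in>A. \<alpha> (c *\<^sub>C x) = c *\<^sub>C \<alpha> x)"

definition star_automorphism :: "'h::chilbert op set \<Rightarrow> ('h op \<Rightarrow> 'h op) \<Rightarrow> bool" where
  "star_automorphism A \<alpha> \<longleftrightarrow> algebra_automorphism A \<alpha> \<and> (\<forall>x\<in>A. \<alpha> (adj x) = adj (\<alpha> x))"


section \<open>Von Neumann algebras and weights\<close>

definition commutant :: "'h::chilbert op set \<Rightarrow> 'h op set" where
  "commutant M = {T \<in> BH. \<forall>S\<in>M. T o\<^sub>L S = S o\<^sub>L T}"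

definition von_neumann_algebra :: "'h::chilbert op set \<Rightarrow> bool" where
  "von_neumann_algebra N \<longleftrightarrow>
     unital_star_subalgebra N BH \<and> commutant (commutant N) = N"

definition pos_part :: "'h::chilbert op set \<Rightarrow> 'h op set" where
  "pos_part N = {x \<in> N. positive_op x}"

text \<open>A weight is given by its values on the positive part; values elsewhere are irrelevant.
  In \<^typ>\<open>ennreal\<close> one has \<open>0 * \<infinity> = 0\<close>, so homogeneity includes that 0 has weight 0.\<close>

definition weight :: "'h::chilbert op set \<Rightarrow> ('h op \<Rightarrow> ennreal) \<Rightarrow> bool" where
  "weight N \<Phi> \<longleftrightarrow> (\<forall>x\<in>pos_part N. \<forall>y\<in>pos_part N. \<Phi> (x + y) = \<Phi> x + \<Phi> y) \<and>
     (\<forall>x\<in>pos_part N. \<forall>r\<ge>0. \<Phi> (r *\<^sub>R x) = ennreal r * \<Phi> x)"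

definition faithful_weight :: "'h::chilbert op set \<Rightarrow> ('h op \<Rightarrow> ennreal) \<Rightarrow> bool" where
  "faithful_weight N \<Phi> \<longleftrightarrow> (\<forall>x\<in>pos_part N. \<Phi> x = 0 \<longrightarrow> x = 0)"

definition op_lub :: "'h::chilbert op set \<Rightarrow> 'h op set \<Rightarrow> 'h op \<Rightarrow> bool" where
  "op_lub N D x \<longleftrightarrow> (\<forall>d\<in>D. le_op d x) \<and> (\<forall>y\<in>N. (\<forall>d\<in>D. le_op d y) \<longrightarrow> le_op x y)"

text \<open>Compatibility with suprema of bounded increasing nets, i.e. of upward directed sets that
  have a least upper bound.\<close>

definition normal_weight :: "'h::chilbert op set \<Rightarrow> ('h op \<Rightarrow> ennreal) \<Rightarrow> bool" where
  "normal_weight N \<Phi> \<longleftrightarrow> (\<forall>D x. D \<subseteq> pos_part N \<and> D \<noteq> {} \<and>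
     (\<forall>a\<in>D. \<forall>b\<in>D. \<exists>c\<in>D. le_op a c \<and> le_op b c) \<and> x \<in> pos_part N \<and> op_lub N D x \<longrightarrow>
     \<Phi> x = (SUP d\<in>D. \<Phi> d))"

definition finite_part :: "'h::chilbert op set \<Rightarrow> ('h op \<Rightarrow> ennreal) \<Rightarrow> 'h op set" where
  "finite_part N \<Phi> = {x \<in> pos_part N. \<Phi> x < \<infinity>}"

definition weight_dom :: "'h::chilbert op set \<Rightarrow> ('h op \<Rightarrow> ennreal) \<Rightarrow> 'h op set" where
  "weight_dom N \<Phi> = {(\<Sum>x\<in>X. c x *\<^sub>C x) | X c. finite X \<and> X \<subseteq> finite_part N \<Phi>}"

definition weight_ext :: "'h::chilbert op set \<Rightarrow> ('h op \<Rightarrow> ennreal) \<Rightarrow> 'h op \<Rightarrow> complex" where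
  "weight_ext N \<Phi> T = (THE v. \<exists>X c. finite X \<and> X \<subseteq> finite_part N \<Phi> \<and>
     T = (\<Sum>x\<in>X. c x *\<^sub>C x) \<and> v = (\<Sum>x\<in>X. c x * of_real (enn2real (\<Phi> x))))"

text \<open>The domain is a *-subalgebra, so its closures in the strong and in the ultraweak operator
  topology coincide.\<close>

definition semifinite_weight :: "'h::chilbert op set \<Rightarrow> ('h op \<Rightarrow> ennreal) \<Rightarrow> bool" where
  "semifinite_weight N \<Phi> \<longleftrightarrow> (\<forall>T\<in>N. \<forall>Z. finite Z \<longrightarrow>
     (\<forall>e>0. \<exists>S\<in>weight_dom N \<Phi>. \<forall>z\<in>Z. norm (T z - S z) < e))"

definition fns_weight :: "'h::chilbert op set \<Rightarrow> ('h op \<Rightarrow> ennreal) \<Rightarrow> bool" where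
  "fns_weight N \<Phi> \<longleftrightarrow>
     weight N \<Phi> \<and> faithful_weight N \<Phi> \<and> normal_weight N \<Phi> \<and> semifinite_weight N \<Phi>"

definition sq_integrable :: "'h::chilbert op set \<Rightarrow> ('h op \<Rightarrow> ennreal) \<Rightarrow> 'h op set" where
  "sq_integrable N \<Phi> = {x \<in> N. \<Phi> (adj x o\<^sub>L x) < \<infinity>}"

text \<open>The modular group is the unique one-parameter group of automorphisms that leaves the weight
  invariant and satisfies the Kubo--Martin--Schwinger condition. Automorphisms are isometric,
  so for the orbits the weak and the ultraweak continuity agree.\<close>

definition KMS_function ::
  "'h::chilbert op set \<Rightarrow> ('h op \<Rightarrow> ennreal) \<Rightarrow> (real \<Rightarrow> 'h op \<Rightarrow> 'h op) \<Rightarrow> 'h op \<Rightarrow> 'h op \<Rightarrow>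
   (complex \<Rightarrow> complex) \<Rightarrow> bool" where
  "KMS_function N \<Phi> \<sigma> x y f \<longleftrightarrow>
     continuous_on {z. 0 \<le> Im z \<and> Im z \<le> 1} f \<and>
     bounded (f ` {z. 0 \<le> Im z \<and> Im z \<le> 1}) \<and>
     f holomorphic_on {z. 0 < Im z \<and> Im z < 1} \<and>
     (\<forall>t. f (of_real t) = weight_ext N \<Phi> (\<sigma> t x o\<^sub>L y) \<and>
          f (of_real t + \<i>) = weight_ext N \<Phi> (y o\<^sub>L \<sigma> t x))"

definition modular_group ::
  "'h::chilbert op set \<Rightarrow> ('h op \<Rightarrow> ennreal) \<Rightarrow> (real \<Rightarrow> 'h op \<Rightarrow> 'h op) \<Rightarrow> bool" where
  "modular_group N \<Phi> \<sigma> \<longleftrightarrow>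
     (\<forall>t. star_automorphism N (\<sigma> t)) \<and>
     (\<forall>x\<in>N. \<sigma> 0 x = x) \<and> (\<forall>t u. \<forall>x\<in>N. \<sigma> (t + u) x = \<sigma> t (\<sigma> u x)) \<and>
     (\<forall>x\<in>N. \<forall>\<xi> \<eta>. continuous_on UNIV (\<lambda>t. cinner \<xi> (\<sigma> t x \<eta>))) \<and>
     (\<forall>t. \<forall>x\<in>pos_part N. \<Phi> (\<sigma> t x) = \<Phi> x) \<and>
     (\<forall>x y. {x, y, adj x, adj y} \<subseteq> sq_integrable N \<Phi> \<longrightarrow> (\<exists>f. KMS_function N \<Phi> \<sigma> x y f))"

definition fixed_point_algebra ::
  "'h op set \<Rightarrow> (real \<Rightarrow> 'h op \<Rightarrow> 'h op) \<Rightarrow> 'h::chilbert op set" where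
  "fixed_point_algebra N \<sigma> = {x \<in> N. \<forall>t. \<sigma> t x = x}"

definition op_entire :: "(complex \<Rightarrow> 'h::chilbert op) \<Rightarrow> bool" where
  "op_entire f \<longleftrightarrow> (\<forall>z. \<exists>D. ((\<lambda>h. inverse h *\<^sub>C (f (z + h) - f z)) \<longlongrightarrow> D) (at 0))"

definition entire_extension ::
  "'h::chilbert op set \<Rightarrow> (real \<Rightarrow> 'h op \<Rightarrow> 'h op) \<Rightarrow> 'h op \<Rightarrow> (complex \<Rightarrow> 'h op) \<Rightarrow> bool" where
  "entire_extension N \<sigma> a f \<longleftrightarrow> range f \<subseteq> N \<and> op_entire f \<and> (\<forall>t. f (of_real t) = \<sigma> t a)"

definition analytic_vector ::
  "'h::chilbert op set \<Rightarrow> (real \<Rightarrow> 'h op \<Rightarrow> 'h op) \<Rightarrow> 'h op \<Rightarrow> bool" where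
  "analytic_vector N \<sigma> a \<longleftrightarrow> a \<in> N \<and> (\<exists>f. entire_extension N \<sigma> a f)"


section \<open>Modular Fredholm modules\<close>

definition modular_Fredholm_module ::
  "nat \<Rightarrow> 'h::chilbert op set \<Rightarrow> ('h op \<Rightarrow> ennreal) \<Rightarrow> (real \<Rightarrow> 'h op \<Rightarrow> 'h op) \<Rightarrow>
   'h op set \<Rightarrow> 'h op \<Rightarrow> bool" where
  "modular_Fredholm_module n N \<Phi> \<sigma> A F \<longleftrightarrow>
     von_neumann_algebra N \<and> fns_weight N \<Phi> \<and> modular_group N \<Phi> \<sigma> \<and>
     unital_star_subalgebra A N \<and> norm_separable A \<and>
     (\<forall>t. \<sigma> t ` A = A) \<and> (\<forall>a\<in>A. analytic_vector N \<sigma> a) \<and>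
     F \<in> fixed_point_algebra N \<sigma> \<and> adj F = F \<and> F o\<^sub>L F = id_blinfun \<and>
     (\<forall>a\<in>A. op_power (commutator F a) n \<in> weight_dom N \<Phi>)"

definition even_grading ::
  "'h::chilbert op set \<Rightarrow> (real \<Rightarrow> 'h op \<Rightarrow> 'h op) \<Rightarrow> 'h op set \<Rightarrow> 'h op \<Rightarrow> 'h op \<Rightarrow> bool" where
  "even_grading N \<sigma> A F \<gamma> \<longleftrightarrow>
     \<gamma> \<in> fixed_point_algebra N \<sigma> \<and> adj \<gamma> = \<gamma> \<and> \<gamma> o\<^sub>L \<gamma> = id_blinfun \<and>
     (\<forall>a\<in>A. \<gamma> o\<^sub>L a = a o\<^sub>L \<gamma>) \<and> (\<gamma> o\<^sub>L F) + (F o\<^sub>L \<gamma>) = 0"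


section \<open>The Podles sphere\<close>

text \<open>The universal unital *-algebra: formal *-polynomial expressions in the generators modulo the
  congruence generated by the axioms of unital complex *-algebras and the defining relations.\<close>

datatype expr =
  GenA | GenB | One | Zero | Add expr expr | Mul expr expr | Scale complex expr | Star expr

inductive podles_eq :: "real \<Rightarrow> real \<Rightarrow> expr \<Rightarrow> expr \<Rightarrow> bool" for q s :: real where
  refl: "podles_eq q s x x"
| sym: "podles_eq q s x y \<Longrightarrow> podles_eq q s y x"
| trans: "podles_eq q s x y \<Longrightarrow> podles_eq q s y z \<Longrightarrow> podles_eq q s x z"
| cong_add: "podles_eq q s x x' \<Longrightarrow> podles_eq q s y y' \<Longrightarrow> podles_eq q s (Add x y) (Add x' y')"
| cong_mul: "podles_eq q s x x' \<Longrightarrow> podles_eq q s y y' \<Longrightarrow> podles_eq q s (Mul x y) (Mul x' y')"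
| cong_scale: "podles_eq q s x x' \<Longrightarrow> podles_eq q s (Scale c x) (Scale c x')"
| cong_star: "podles_eq q s x x' \<Longrightarrow> podles_eq q s (Star x) (Star x')"
| add_assoc: "podles_eq q s (Add (Add x y) z) (Add x (Add y z))"
| add_commute: "podles_eq q s (Add x y) (Add y x)"
| add_zero: "podles_eq q s (Add x Zero) x"
| add_neg: "podles_eq q s (Add x (Scale (-1) x)) Zero"
| scale_one: "podles_eq q s (Scale 1 x) x"
| scale_scale: "podles_eq q s (Scale c (Scale d x)) (Scale (c * d) x)"
| scale_add_right: "podles_eq q s (Scale c (Add x y)) (Add (Scale c x) (Scale c y))"
| scale_add_left: "podles_eq q s (Scale (c + d) x) (Add (Scale c x) (Scale d x))"
| mul_assoc: "podles_eq q s (Mul (Mul x y) z) (Mul x (Mul y z))"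
| mul_one_left: "podles_eq q s (Mul One x) x"
| mul_one_right: "podles_eq q s (Mul x One) x"
| mul_add_left: "podles_eq q s (Mul (Add x y) z) (Add (Mul x z) (Mul y z))"
| mul_add_right: "podles_eq q s (Mul x (Add y z)) (Add (Mul x y) (Mul x z))"
| mul_scale_left: "podles_eq q s (Mul (Scale c x) y) (Scale c (Mul x y))"
| mul_scale_right: "podles_eq q s (Mul x (Scale c y)) (Scale c (Mul x y))"
| star_star: "podles_eq q s (Star (Star x)) x"
| star_add: "podles_eq q s (Star (Add x y)) (Add (Star x) (Star y))"
| star_mul: "podles_eq q s (Star (Mul x y)) (Mul (Star y) (Star x))"
| star_scale: "podles_eq q s (Star (Scale c x)) (Scale (cnj c) (Star x))"
| A_selfadjoint: "podles_eq q s (Star GenA) GenA"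
| relation_BsB: "podles_eq q s
    (Add (Mul (Star GenB) GenB)
      (Mul (Add GenA (Scale (-1) One)) (Add GenA (Scale (of_real (s\<^sup>2)) One)))) Zero"
| relation_BBs: "podles_eq q s
    (Add (Mul GenB (Star GenB))
      (Mul (Add (Scale (of_real (q\<^sup>2)) GenA) (Scale (-1) One))
        (Add (Scale (of_real (q\<^sup>2)) GenA) (Scale (of_real (s\<^sup>2)) One)))) Zero"
| relation_AB: "podles_eq q s (Mul GenA GenB) (Scale (of_real (inverse (q\<^sup>2))) (Mul GenB GenA))"

definition podles_class :: "real \<Rightarrow> real \<Rightarrow> expr \<Rightarrow> expr set" where
  "podles_class q s t = {u. podles_eq q s t u}"

definition podles_algebra :: "real \<Rightarrow> real \<Rightarrow> expr set set" where
  "podles_algebra q s = range (podles_class q s)"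


section \<open>The representation and the operators on the direct sum\<close>

text \<open>The product type carries the Hilbert space direct sum norm.\<close>

type_synonym hsum = "ell2 \<times> ell2"

definition op_on_basis :: "(nat \<Rightarrow> ell2) \<Rightarrow> ell2 op" where
  "op_on_basis v = (THE T. T \<in> BH \<and> (\<forall>k. T (ket k) = v k))"

definition direct_sum_op :: "ell2 op \<Rightarrow> ell2 op \<Rightarrow> hsum op" where
  "direct_sum_op S T = Blinfun (\<lambda>x. (S (fst x), T (snd x)))"

lemma direct_sum_op_apply [simp]: "direct_sum_op S T x = (S (fst x), T (snd x))"
  unfolding direct_sum_op_def
  by (subst bounded_linear_Blinfun_apply) (auto intro!: bounded_linear_intros)

definition plus_A :: "real \<Rightarrow> ell2 op" where
  "plus_A q = op_on_basis (\<lambda>k. (q ^ (2 * k)) *\<^sub>R ket k)"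

definition minus_A :: "real \<Rightarrow> real \<Rightarrow> ell2 op" where
  "minus_A q s = op_on_basis (\<lambda>k. (- (s\<^sup>2 * q ^ (2 * k))) *\<^sub>R ket k)"

text \<open>For \<open>k = 0\<close> the coefficients below vanish, so the value of \<open>ket (k - 1)\<close> is irrelevant.\<close>

definition plus_B :: "real \<Rightarrow> real \<Rightarrow> ell2 op" where
  "plus_B q s =
     op_on_basis (\<lambda>k. (sqrt (1 - q ^ (2 * k)) * sqrt (s\<^sup>2 + q ^ (2 * k))) *\<^sub>R ket (k - 1))"

definition minus_B :: "real \<Rightarrow> real \<Rightarrow> ell2 op" where
  "minus_B q s =
     op_on_basis (\<lambda>k. (s * sqrt (1 - q ^ (2 * k)) * sqrt (1 + s\<^sup>2 * q ^ (2 * k))) *\<^sub>R ket (k - 1))"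

primrec podles_eval :: "real \<Rightarrow> real \<Rightarrow> expr \<Rightarrow> hsum op" where
  "podles_eval q s GenA = direct_sum_op (plus_A q) (minus_A q s)"
| "podles_eval q s GenB = direct_sum_op (plus_B q s) (minus_B q s)"
| "podles_eval q s One = id_blinfun"
| "podles_eval q s Zero = 0"
| "podles_eval q s (Add x y) = podles_eval q s x + podles_eval q s y"
| "podles_eval q s (Mul x y) = podles_eval q s x o\<^sub>L podles_eval q s y"
| "podles_eval q s (Scale c x) = c *\<^sub>C podles_eval q s x"
| "podles_eval q s (Star x) = adj (podles_eval q s x)"

text \<open>The homomorphism induced on the quotient, and the concrete algebra with which the universal
  one is identified; both are meaningful because \<open>podles_eval\<close> respects \<open>podles_eq\<close> for
  \<open>0 < q < 1\<close> and \<open>0 < s\<close>.\<close>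

definition podles_rep :: "real \<Rightarrow> real \<Rightarrow> expr set \<Rightarrow> hsum op" where
  "podles_rep q s X = the_elem (podles_eval q s ` X)"

definition podles_image :: "real \<Rightarrow> real \<Rightarrow> hsum op set" where
  "podles_image q s = podles_rep q s ` podles_algebra q s"

definition F_op :: "hsum op" where
  "F_op = Blinfun (\<lambda>x. (snd x, fst x))"

definition gamma_op :: "hsum op" where
  "gamma_op = Blinfun (\<lambda>x. (fst x, - snd x))"

lemma F_op_apply [simp]: "F_op x = (snd x, fst x)"
  unfolding F_op_def by (subst bounded_linear_Blinfun_apply) (auto intro!: bounded_linear_intros)

lemma gamma_op_apply [simp]: "gamma_op x = (fst x, - snd x)"
  unfolding gamma_op_def
  by (subst bounded_linear_Blinfun_apply) (auto intro!: bounded_linear_intros bounded_linear_minus)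

text \<open>Real powers of the unbounded operator \<open>K\<close>, with their maximal domains; outside of the domain
  the value is irrelevant.\<close>

definition diag_dom :: "(nat \<Rightarrow> real) \<Rightarrow> ell2 set" where
  "diag_dom d = {x. square_summable (\<lambda>k. of_real (d k) * coord x k)}"

definition diag_op :: "(nat \<Rightarrow> real) \<Rightarrow> ell2 \<Rightarrow> ell2" where
  "diag_op d x = Abs_ell2 (\<lambda>k. of_real (d k) * coord x k)"

definition K_coeff :: "real \<Rightarrow> real \<Rightarrow> nat \<Rightarrow> real" where
  "K_coeff q r k = (q powr (-2 * real k)) powr r"

definition Kpow_dom :: "real \<Rightarrow> real \<Rightarrow> hsum set" where
  "Kpow_dom q r = diag_dom (K_coeff q r) \<times> diag_dom (K_coeff q r)"

definition Kpow :: "real \<Rightarrow> real \<Rightarrow> hsum \<Rightarrow> hsum" where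
  "Kpow q r x = (diag_op (K_coeff q r) (fst x), diag_op (K_coeff q r) (snd x))"

definition ket_plus :: "nat \<Rightarrow> hsum" where "ket_plus k = (ket k, 0)"
definition ket_minus :: "nat \<Rightarrow> hsum" where "ket_minus k = (0, ket k)"

text \<open>The operator \<open>K^(1/2) S K^(1/2)\<close> is unbounded in general; its trace is that of the form
  \<open>\<langle>K^(1/2) x, S K^(1/2) x\<rangle>\<close>, computed in the standard basis, which lies in the domain of \<open>K^(1/2)\<close>.\<close>

definition K_form :: "real \<Rightarrow> hsum op \<Rightarrow> hsum \<Rightarrow> ennreal" where
  "K_form q S x = ennreal (Re (cinner (Kpow q (1/2) x) (S (Kpow q (1/2) x))))"

definition Phi :: "real \<Rightarrow> hsum op \<Rightarrow> ennreal" where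
  "Phi q S = (\<Sum>k. K_form q S (ket_plus k)) + (\<Sum>k. K_form q S (ket_minus k))"

text \<open>The product of \<open>K^(-1)\<close>, \<open>T\<close> and \<open>K\<close> has the domain \<open>{x \<in> dom K. T (K x) \<in> dom K^(-1)}\<close>, which is
  \<open>dom K\<close> for \<open>0 < q < 1\<close>; where possible, it is extended to a bounded operator.\<close>

definition K_conjugate :: "real \<Rightarrow> hsum op \<Rightarrow> hsum op \<Rightarrow> bool" where
  "K_conjugate q T R \<longleftrightarrow> R \<in> BH \<and> (\<forall>x\<in>Kpow_dom q 1. T (Kpow q 1 x) \<in> Kpow_dom q (-1) \<and>
     R x = Kpow q (-1) (T (Kpow q 1 x)))"

definition modular_aut :: "real \<Rightarrow> hsum op \<Rightarrow> hsum op" where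
  "modular_aut q T = (THE R. K_conjugate q T R)"

end

theory Submission
  imports Defs "HOL-Complex_Analysis.Complex_Analysis"
begin

text \<open>Let \<open>e i\<close> be the basis of eigenvectors of \<open>K\<close> and \<open>d i\<close> the eigenvalues. Then
  \<open>\<Phi> S = (\<Sum>i. d i * \<langle>e i, S (e i)\<rangle>)\<close>, and the modular group is conjugation by \<open>K\<close> to the power \<open>it\<close>.
  Normality rests on the fact that a bounded increasing net of positive operators converges weakly.
  The KMS functions are double series that converge absolutely and uniformly on the strip, because
  \<open>d i powr (1 - r) * d j powr r \<le> d i + d j\<close> for \<open>0 \<le> r \<le> 1\<close>.

  By the defining relations every element of the Podles algebra is a finite sum of terms
  \<open>p(A) B^m\<close>, with powers of the adjoint of \<open>B\<close> for negative \<open>m\<close>. The matrix coefficients of the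
  first summand of the representation determine the values of \<open>p\<close> at all large even powers of \<open>q\<close>;
  hence the representation is faithful. Each such term is multiplied by a character under the
  modular group, which gives the entire extensions and the modular automorphism \<open>\<sigma>\<close>.

  For the generators the two summands of the representation differ by \<open>O(q^(2k))\<close> on the \<open>k\<close>-th
  basis vector, so the commutator with \<open>F\<close> has the form \<open>E K^(-1)\<close> with \<open>E\<close> bounded. By the Leibniz
  rule and \<open>K^(-1) b = \<sigma>(b) K^(-1)\<close> this passes to the whole algebra, and the trace of
  \<open>K^(1/2) K^(-1) E* E K^(-1) K^(1/2)\<close> is finite.\<close>


section \<open>Operators on complex Hilbert spaces\<close>

text \<open>The unbounded \<open>K\<close> is kept out of the arguments. The weight and its modular
  group need only an eigenbasis, positive eigenvalues and the unitaries K^(it); conjugation by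
  \<open>K\<close> is rewritten with the bounded inverse \<open>Kinv\<close>, whose range is the
  domain of \<open>K\<close>, as an intertwining relation. The orientation is fixed by the KMS
  boundary values: continued to the time \<open>\<i>\<close>, the modular group sends T to K^(-1) T
  K. As \<open>B\<close> lowers the index by one and \<open>K\<close> has the eigenvalues q^(-2k),
  this multiplies \<open>B\<close> by q^(-2).

  The exponent 2 comes from the growth of the weight: the factor q^(2k) gained by one commutator
  only compensates the weight q^(-2k), while a second commutator leaves a geometric series. The gain
  itself results from rationalizing a difference of square roots; the sum of the roots is bounded
  below by \<open>s\<close>, which is where \<open>0 < s\<close> enters. The domain of the weight is
  a span of positive elements, whereas the square of a commutator need not be positive; polarization
  bridges this gap.\<close>

lemma cinner_add_left: "cinner (x + y) (z::'a::chilbert) = cinner x z + cinner y z"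
  by (subst (1 2 3) cinner_commute) (simp add: cinner_add_right)

lemma inner_scaleC_right: "inner x (c *\<^sub>C y) = inner (cnj c *\<^sub>C x) (y::'a::chilbert)"
  by (simp add: inner_eq_Re_cinner cinner_scaleC_left cinner_scaleC_right)

text \<open>A phase \<open>c\<close> makes the inner product real and nonnegative, so that the real
  Cauchy-Schwarz inequality applies.\<close>

lemma cmod_cinner_le: "cmod (cinner x y) \<le> norm x * norm (y::'a::chilbert)"
proof (cases "cinner x y = 0")
  case False
  define c where "c = cnj (cinner x y) / of_real (cmod (cinner x y))"
  have "cmod c = 1" using False by (simp add: c_def norm_divide)
  have "c * cinner x y = of_real (cmod (cinner x y))"
    using False by (simp add: c_def complex_norm_square[symmetric] power2_eq_square mult.commute)
  then have "cmod (cinner x y) = inner x (c *\<^sub>C y)"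
    by (simp add: inner_eq_Re_cinner cinner_scaleC_right)
  also have "\<dots> \<le> norm x * norm (c *\<^sub>C y)" by (rule norm_cauchy_schwarz)
  finally show ?thesis by (simp add: norm_scaleC \<open>cmod c = 1\<close>)
qed simp

lemma scaleC_scaleR: "r *\<^sub>R x = complex_of_real r *\<^sub>C (x::'a::chilbert)"
  by (simp add: scaleC_of_real)

lemma bounded_bilinear_cinner: "bounded_bilinear (cinner :: 'a::chilbert \<Rightarrow> 'a \<Rightarrow> complex)"
proof
  show "\<exists>K. \<forall>x y::'a. norm (cinner x y) \<le> norm x * norm y * K"
    using cmod_cinner_le by (intro exI[of _ 1]) auto
qed (auto simp: cinner_add_left cinner_add_right scaleC_scaleR cinner_scaleC_left
    cinner_scaleC_right scaleR_conv_of_real)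

interpretation cinner: bounded_bilinear "cinner :: 'a::chilbert \<Rightarrow> 'a \<Rightarrow> complex"
  by (rule bounded_bilinear_cinner)

lemma bounded_bilinear_scaleC: "bounded_bilinear (scaleC :: complex \<Rightarrow> 'a::chilbert \<Rightarrow> 'a)"
proof
  show "\<exists>K. \<forall>a (b::'a). norm (a *\<^sub>C b) \<le> norm a * norm b * K"
    by (intro exI[of _ 1]) (auto simp: norm_scaleC)
qed (auto simp: scaleC_add_left scaleC_add_right scaleC_scaleR scaleC_scaleC scaleR_conv_of_real
    mult.commute)

interpretation scaleC: bounded_bilinear "scaleC :: complex \<Rightarrow> 'a::chilbert \<Rightarrow> 'a"
  by (rule bounded_bilinear_scaleC)

lemma scaleC_one [simp]: "1 *\<^sub>C x = (x::'a::chilbert)"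
  using scaleC_of_real[of 1 x] by simp

text \<open>One estimate, used for \<open>c\<close> and for its inverse, gives the equality.\<close>

lemma norm_scaleC_op: "norm (c *\<^sub>C (T::'a::chilbert op)) = cmod c * norm T"
proof -
  have le: "norm (c *\<^sub>C T) \<le> cmod c * norm T" for c and T :: "'a op"
    by (rule norm_blinfun_bound)
      (auto simp: norm_scaleC mult.assoc intro!: mult_left_mono norm_blinfun)
  show ?thesis
  proof (cases "c = 0")
    case False
    have "norm T = norm (inverse c *\<^sub>C c *\<^sub>C T)"
      using False by (intro arg_cong[of _ _ norm] blinfun_eqI) (simp add: scaleC_scaleC)
    also have "\<dots> \<le> inverse (cmod c) * norm (c *\<^sub>C T)"
      using le[of "inverse c" "c *\<^sub>C T"] by (simp add: norm_inverse)
    finally show ?thesis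
      using le[of c T] False by (simp add: field_simps)
  next
    case True
    have "0 *\<^sub>C T = 0" by (rule blinfun_eqI) (simp add: scaleC.zero_left)
    then show ?thesis using True by simp
  qed
qed

lemma bounded_bilinear_scaleC_op: "bounded_bilinear (scaleC :: complex \<Rightarrow> 'a::chilbert op \<Rightarrow> 'a op)"
proof
  show "\<exists>K. \<forall>a (b::'a op). norm (a *\<^sub>C b) \<le> norm a * norm b * K"
    by (intro exI[of _ 1]) (auto simp: norm_scaleC_op)
qed (auto intro!: blinfun_eqI simp: blinfun.bilinear_simps scaleC_add_left scaleC_add_right
    scaleC_scaleR scaleC_scaleC scaleR_conv_of_real mult.commute)

interpretation scaleC_op: bounded_bilinear "scaleC :: complex \<Rightarrow> 'a::chilbert op \<Rightarrow> 'a op"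
  by (rule bounded_bilinear_scaleC_op)

lemma cinner_eqI:
  assumes "\<And>z. cinner z x = cinner z y"
  shows "x = (y::'a::chilbert)"
proof -
  have "cinner (x - y) (x - y) = 0"
    using assms[of "x - y"] by (simp add: cinner.diff_right)
  then show ?thesis by (simp add: cinner_self)
qed

text \<open>Identities between complex inner products thus reduce to identities between real ones,
  at \<open>x\<close> and at \<open>\<i> *\<^sub>C x\<close>. Riesz representation and polarization
  are therefore needed only over the reals.\<close>

lemma cinner_eq_inner:
  "cinner x y = Complex (inner x y) (inner (\<i> *\<^sub>C x) (y::'a::chilbert))"
  by (simp add: complex_eq_iff inner_eq_Re_cinner cinner_scaleC_left)

section \<open>Riesz representation and operators defined by bounded forms\<close>

text \<open>The representing vector is the minimizer of the functional \<open>J\<close>. A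
  minimizing sequence is Cauchy by the parallelogram law, and at the minimum the first variation
  vanishes in every direction \<open>x\<close>, which is the claim.\<close>

lemma riesz_representation:
  fixes f :: "'a::{real_inner, banach} \<Rightarrow> real"
  assumes "bounded_linear f"
  shows "\<exists>u. \<forall>x. f x = inner u x"
proof -
  interpret f: bounded_linear f by fact
  obtain M where M: "\<And>x. \<bar>f x\<bar> \<le> norm x * M"
    using f.bounded by auto
  define J where "J x = (norm x)\<^sup>2 - 2 * f x" for x
  have lower: "- (M\<^sup>2) \<le> J x" for x
  proof -
    have "2 * f x \<le> 2 * (norm x * M)" using M[of x] by linarith
    also have "\<dots> \<le> (norm x)\<^sup>2 + M\<^sup>2"
      using zero_le_power2[of "norm x - M"] by (simp add: power2_diff)
    finally show ?thesis by (simp add: J_def)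
  qed
  define m where "m = Inf (range J)"
  have bdd: "bdd_below (range J)" using lower by (auto intro!: bdd_belowI2)
  have m_le: "m \<le> J x" for x
    unfolding m_def using bdd by (rule cInf_lower[rotated]) simp
  \<comment> \<open>Parallelogram law: the linear terms cancel, so it holds for \<open>J\<close> as
    for the squared norm.\<close>
  have par: "(norm (x - y))\<^sup>2 = 2 * J x + 2 * J y - 4 * J ((1/2) *\<^sub>R (x + y))" for x y
    by (simp add: J_def f.add f.scaleR power2_norm_eq_inner inner_simps inner_commute field_simps)
  have "\<exists>x. J x < m + 1 / Suc n" for n
    using cInf_lessD[of "range J" "m + 1 / Suc n"] by (auto simp: m_def)
  then obtain X where X: "\<And>n. J (X n) < m + 1 / Suc n" by metis
  have XX: "(norm (X i - X j))\<^sup>2 < 4 / Suc n" if "n \<le> i" "n \<le> j" for i j n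
  proof -
    have "1 / real (Suc i) \<le> 1 / Suc n" "1 / real (Suc j) \<le> 1 / Suc n"
      using that by (auto simp: divide_simps)
    then show ?thesis
      using X[of i] X[of j] m_le[of "(1/2) *\<^sub>R (X i + X j)"] par[of "X i" "X j"] by argo
  qed
  have "Cauchy X"
  proof (rule metric_CauchyI)
    fix e :: real assume "0 < e"
    then have "0 < e\<^sup>2 / 4" by simp
    then obtain n where n: "1 / Suc n < e\<^sup>2 / 4"
      using nat_approx_posE by metis
    have "dist (X i) (X j) < e" if "i \<ge> n" "j \<ge> n" for i j
    proof -
      have "(norm (X i - X j))\<^sup>2 < e\<^sup>2" using XX[OF that] n by argo
      then show ?thesis
        using \<open>0 < e\<close> by (simp add: dist_norm power_less_imp_less_base)
    qed
    then show "\<exists>M. \<forall>i\<ge>M. \<forall>j\<ge>M. dist (X i) (X j) < e" by blast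
  qed
  then obtain u where u: "X \<longlonglongrightarrow> u" by (auto simp: Cauchy_convergent_iff convergent_def)
  have "(\<lambda>n. J (X n)) \<longlonglongrightarrow> J u"
    unfolding J_def by (intro tendsto_intros f.tendsto u)
  moreover have "(\<lambda>n. m + 1 / Suc n) \<longlonglongrightarrow> m + 0"
    by (intro tendsto_intros lim_1_over_n LIMSEQ_Suc)
  ultimately have "J u \<le> m + 0"
    by (rule LIMSEQ_le) (use X less_imp_le in blast)
  then have min: "J u \<le> J x" for x using m_le[of x] by simp
  have "f x = inner u x" for x
  proof (rule ccontr)
    assume ne: "f x \<noteq> inner u x"
    then have "x \<noteq> 0" by (auto simp: f.zero)
    define c where "c = inner u x - f x"
    \<comment> \<open>The minimizer of the quadratic polynomial in \<open>t\<close> given by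
      \<open>J (u + t *\<^sub>R x)\<close>.\<close>
    define t where "t = - c / (norm x)\<^sup>2"
    have "J (u + t *\<^sub>R x) = J u + 2 * t * c + t\<^sup>2 * (norm x)\<^sup>2"
      by (simp add: J_def c_def f.add f.scaleR power2_norm_eq_inner inner_simps inner_commute
          algebra_simps power2_eq_square[of t])
    also have "\<dots> = J u - c\<^sup>2 / (norm x)\<^sup>2"
      using \<open>x \<noteq> 0\<close> by (simp add: t_def field_simps power2_eq_square)
    also have "\<dots> < J u" using ne \<open>x \<noteq> 0\<close> by (simp add: c_def)
    finally show False using min[of "u + t *\<^sub>R x"] by simp
  qed
  then show ?thesis by blast
qed

text \<open>Riesz representation in the first argument gives \<open>S y\<close>; linearity follows
  from the uniqueness of the representing vector, boundedness from testing with
  \<open>x = S y\<close>.\<close>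

lemma op_of_bounded_form:
  fixes L :: "'a::{real_inner, banach} \<Rightarrow> 'b::real_normed_vector \<Rightarrow> real"
  assumes "bounded_bilinear L"
  shows "\<exists>S. \<forall>x y. inner (blinfun_apply S y) x = L x y"
proof -
  interpret L: bounded_bilinear L by fact
  have "\<exists>u. \<forall>x. L x y = inner u x" for y
    by (rule riesz_representation) (rule L.bounded_linear_left)
  then obtain S where S: "\<And>x y. L x y = inner (S y) x" by metis
  obtain K where K0: "0 \<le> K" and K: "\<And>x y. \<bar>L x y\<bar> \<le> norm x * norm y * K"
    using L.nonneg_bounded by auto
  have "bounded_linear S"
  proof (rule bounded_linear_intro)
    show "S (y + z) = S y + S z" for y z
      by (rule vector_eq_rdot[THEN iffD1]) (metis S L.add_right inner_add_left)
    show "S (r *\<^sub>R y) = r *\<^sub>R S y" for r y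
      by (rule vector_eq_rdot[THEN iffD1]) (metis S L.scaleR_right inner_scaleR_left real_scaleR_def)
    fix y
    have "norm (S y) * norm (S y) = L (S y) y"
      by (simp add: S power2_norm_eq_inner[symmetric] power2_eq_square)
    also have "\<dots> \<le> norm (S y) * (norm y * K)"
      using K[of "S y" y] by (simp add: mult.assoc)
    finally have "norm (S y) * norm (S y) \<le> norm (S y) * (norm y * K)" .
    then show "norm (S y) \<le> norm y * K"
      using K0 by (cases "S y = 0") auto
  qed
  then show ?thesis
    by (intro exI[of _ "Blinfun S"]) (simp add: S bounded_linear_Blinfun_apply)
qed


section \<open>Complex-linear operators and their adjoints\<close>

lemma BH_scaleC: "T \<in> BH \<Longrightarrow> blinfun_apply T (c *\<^sub>C x) = c *\<^sub>C T x"
  by (simp add: BH_def)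

lemma BH_add [intro, simp]: "S \<in> BH \<Longrightarrow> T \<in> BH \<Longrightarrow> S + T \<in> BH"
  by (simp add: BH_def blinfun.bilinear_simps scaleC_add_right)

lemma BH_diff [intro, simp]: "S \<in> BH \<Longrightarrow> T \<in> BH \<Longrightarrow> S - T \<in> BH"
  by (simp add: BH_def blinfun.bilinear_simps scaleC.diff_right)

lemma BH_zero [intro, simp]: "0 \<in> BH"
  by (simp add: BH_def scaleC.zero_right)

lemma BH_minus [intro, simp]: "T \<in> BH \<Longrightarrow> - T \<in> BH"
  using BH_diff[of 0 T] by simp

lemma BH_scale [intro, simp]: "T \<in> BH \<Longrightarrow> c *\<^sub>C T \<in> BH"
  by (simp add: BH_def scaleC_scaleC mult.commute)

lemma BH_id [intro, simp]: "id_blinfun \<in> BH"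
  by (simp add: BH_def)

lemma BH_compose [intro, simp]: "S \<in> BH \<Longrightarrow> T \<in> BH \<Longrightarrow> S o\<^sub>L T \<in> BH"
  by (simp add: BH_def)

lemma op_scaleC_scaleC: "c *\<^sub>C d *\<^sub>C (T::'a::chilbert op) = (c * d) *\<^sub>C T"
  by (rule blinfun_eqI) (simp add: scaleC_scaleC)

lemma op_scaleC_one [simp]: "1 *\<^sub>C (T::'a::chilbert op) = T"
  by (rule blinfun_eqI) simp

lemma scaleC_compose_left: "(c *\<^sub>C S) o\<^sub>L T = c *\<^sub>C (S o\<^sub>L (T::'a::chilbert op))"
  by (rule blinfun_eqI) simp

lemma scaleC_compose_right:
  "S \<in> BH \<Longrightarrow> S o\<^sub>L (c *\<^sub>C T) = c *\<^sub>C (S o\<^sub>L (T::'a::chilbert op))"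
  by (rule blinfun_eqI) (simp add: BH_scaleC)

lemmas compose_algebra =
  bounded_bilinear.add_left[OF bounded_bilinear_blinfun_compose]
  bounded_bilinear.add_right[OF bounded_bilinear_blinfun_compose]
  bounded_bilinear.diff_left[OF bounded_bilinear_blinfun_compose]
  bounded_bilinear.diff_right[OF bounded_bilinear_blinfun_compose]
  bounded_bilinear.minus_left[OF bounded_bilinear_blinfun_compose]
  bounded_bilinear.minus_right[OF bounded_bilinear_blinfun_compose]

text \<open>The second assumption says that \<open>L\<close> is the real part of a sesquilinear
  form, and makes the operator commute with complex scalars. Adjoints and the limits of bounded
  increasing nets are both constructed from here.\<close>

lemma BH_of_form:
  assumes "bounded_bilinear L"
    and "\<And>c x y. L (c *\<^sub>C x) y = L x (cnj c *\<^sub>C y)"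
  shows "\<exists>S\<in>BH. \<forall>x y. inner x (blinfun_apply S y) = L x (y::'a::chilbert)"
proof -
  obtain S where S: "\<And>x y. inner (blinfun_apply S y) x = L x y"
    using op_of_bounded_form[OF assms(1)] by blast
  have "S (c *\<^sub>C y) = c *\<^sub>C S y" for c y
  proof (rule vector_eq_rdot[THEN iffD1], intro allI)
    fix z
    have "inner (S (c *\<^sub>C y)) z = inner (S y) (cnj c *\<^sub>C z)"
      using assms(2)[of "cnj c" z y] by (simp add: S)
    then show "inner (S (c *\<^sub>C y)) z = inner (c *\<^sub>C S y) z"
      by (simp add: inner_scaleC_right)
  qed
  then show ?thesis using S by (intro bexI[of _ S]) (auto simp: BH_def inner_commute)
qed

lemma ex_adj:
  assumes "T \<in> BH"
  shows "\<exists>S\<in>BH. \<forall>x y. cinner (blinfun_apply S x) y = cinner x (T (y::'a::chilbert))"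
proof -
  have "bounded_bilinear (\<lambda>x y. inner (T x) (y::'a))"
    using bounded_bilinear.comp1[OF bounded_bilinear_inner blinfun.bounded_linear_right[of T]] .
  moreover have "inner (T (c *\<^sub>C x)) y = inner (T x) (cnj c *\<^sub>C y)" for c x y
    by (simp add: BH_scaleC[OF assms] inner_scaleC_right)
  ultimately obtain S where S: "S \<in> BH" "\<And>x y. inner x (S y) = inner (T x) y"
    using BH_of_form[of "\<lambda>x y. inner (T x) y"] by blast
  have "cinner (S x) y = cinner x (T y)" for x y
    using S(2)[of y x] S(2)[of y "\<i> *\<^sub>C x"] BH_scaleC[OF S(1), of \<i> x]
    by (simp add: cinner_eq_inner inner_commute)
  then show ?thesis using S(1) by blast
qed

lemma adj_unique:
  fixes T :: "'a::chilbert op"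
  assumes "S \<in> BH" "\<And>x y. cinner (blinfun_apply S x) y = cinner x (T y)"
  shows "adj T = S"
  unfolding adj_def
proof (rule the_equality)
  fix S' assume "S' \<in> BH \<and> (\<forall>x y. cinner (blinfun_apply S' x) y = cinner x (T y))"
  then show "S' = S"
    using assms(2) by (intro blinfun_eqI cinner_eqI) (metis cinner_commute)
qed (use assms in blast)

lemma adj_BH [intro, simp]: "T \<in> BH \<Longrightarrow> adj T \<in> BH"
  and cinner_adj_left: "T \<in> BH \<Longrightarrow> cinner (adj T x) y = cinner x (blinfun_apply T y)"
  using ex_adj[of T] adj_unique[of _ T] by metis+

lemma cinner_adj_right: "T \<in> BH \<Longrightarrow> cinner x (adj T y) = cinner (blinfun_apply T x) y"
  by (subst (1 2) cinner_commute) (simp add: cinner_adj_left)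

lemma adj_adj [simp]: "T \<in> BH \<Longrightarrow> adj (adj T) = T"
  by (rule adj_unique) (simp_all add: cinner_adj_right)

lemma adj_add: "S \<in> BH \<Longrightarrow> T \<in> BH \<Longrightarrow> adj (S + T) = adj S + adj T"
  by (rule adj_unique)
    (auto simp: blinfun.bilinear_simps cinner_adj_left cinner_add_left cinner_add_right)

lemma adj_scaleC: "T \<in> BH \<Longrightarrow> adj (c *\<^sub>C T) = cnj c *\<^sub>C adj T"
  by (rule adj_unique) (auto simp: cinner_adj_left cinner_scaleC_left cinner_scaleC_right)

lemma adj_compose: "S \<in> BH \<Longrightarrow> T \<in> BH \<Longrightarrow> adj (S o\<^sub>L T) = adj T o\<^sub>L adj S"
  by (rule adj_unique) (auto simp: cinner_adj_left)

lemma adj_id [simp]: "adj id_blinfun = id_blinfun"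
  by (rule adj_unique) auto

lemma adj_zero [simp]: "adj 0 = 0"
  by (rule adj_unique) (auto simp: cinner.zero_left cinner.zero_right)

lemma adj_minus: "T \<in> BH \<Longrightarrow> adj (- T) = - adj T"
  by (rule adj_unique)
    (auto simp: blinfun.bilinear_simps cinner_adj_left cinner.minus_left cinner.minus_right)

lemma adj_diff: "S \<in> BH \<Longrightarrow> T \<in> BH \<Longrightarrow> adj (S - T) = adj S - adj T"
  using adj_add[of S "- T"] by (auto simp: adj_minus)

lemma norm_adj_le:
  assumes "T \<in> BH"
  shows "norm (adj T) \<le> norm T"
proof (rule norm_blinfun_bound)
  fix x
  have "(norm (adj T x))\<^sup>2 = cmod (cinner x (T (adj T x)))"
    by (simp flip: cinner_adj_left[OF assms] add: cinner_self norm_power)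
  also have "\<dots> \<le> norm x * norm (T (adj T x))"
    by (rule cmod_cinner_le)
  also have "\<dots> \<le> norm x * (norm T * norm (adj T x))"
    by (intro mult_left_mono norm_blinfun norm_ge_zero)
  finally have "norm (adj T x) * norm (adj T x) \<le> (norm T * norm x) * norm (adj T x)"
    by (simp add: power2_eq_square mult_ac)
  then show "norm (adj T x) \<le> norm T * norm x"
    by (cases "adj T x = 0") auto
qed simp

lemma unital_star_subalgebra_BH: "unital_star_subalgebra BH BH"
  by (auto simp: unital_star_subalgebra_def)

text \<open>The commutant need not be computed: every bounded operator commutes with whatever
  commutes with all of them.\<close>

lemma von_neumann_algebra_BH: "von_neumann_algebra BH"
  using unital_star_subalgebra_BH by (auto simp: von_neumann_algebra_def commutant_def)


section \<open>Positive operators\<close>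

lemma positive_op_BH: "positive_op T \<Longrightarrow> T \<in> BH"
  by (simp add: positive_op_def)

lemma positive_op_inner_nonneg: "positive_op T \<Longrightarrow> 0 \<le> inner x (blinfun_apply T x)"
  by (simp add: positive_op_def inner_eq_Re_cinner)

lemma positive_opI:
  fixes T :: "'a::chilbert op"
  assumes "T \<in> BH" "\<And>x y. inner x (T y) = inner (T x) y" "\<And>x. 0 \<le> inner x (T x)"
  shows "positive_op T"
  unfolding positive_op_def
proof (intro conjI allI)
  fix x
  have "Im (cinner x (T x)) = Im (cinner (T x) x)"
    using assms(2)[of "\<i> *\<^sub>C x" x] BH_scaleC[OF assms(1), of \<i> x]
    by (simp add: cinner_eq_inner)
  then have "Im (cinner x (T x)) = 0"
    by (subst (asm) (2) cinner_commute) simp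
  then show "cinner x (T x) \<in> \<real>" by (simp add: complex_is_Real_iff)
qed (use assms in \<open>auto simp flip: inner_eq_Re_cinner\<close>)

text \<open>Polarization: the quadratic form has vanishing imaginary part at
  \<open>x + \<i> *\<^sub>C y\<close>, and this compares the two mixed terms.\<close>

lemma positive_op_symmetric:
  assumes "positive_op T"
  shows "inner x (blinfun_apply T y) = inner (T x) y"
proof -
  have BH: "T \<in> BH" by (rule positive_op_BH[OF assms])
  have real: "Im (cinner z (T z)) = 0" for z
    using assms by (simp add: positive_op_def complex_is_Real_iff)
  have "Im (cinner x (T (\<i> *\<^sub>C y))) + Im (cinner (\<i> *\<^sub>C y) (T x)) = 0"
    using real[of "x + \<i> *\<^sub>C y"] real[of x] real[of "\<i> *\<^sub>C y"]
    by (simp add: blinfun.bilinear_simps cinner_add_left cinner_add_right)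
  then have "Re (cinner x (T y)) = Re (cinner y (T x))"
    by (simp add: BH_scaleC[OF BH] cinner_scaleC_left cinner_scaleC_right)
  then show ?thesis by (simp add: inner_eq_Re_cinner[symmetric] inner_commute)
qed

lemma positive_op_adj_compose: "T \<in> BH \<Longrightarrow> positive_op (adj T o\<^sub>L T)"
  by (auto simp: positive_op_def cinner_adj_right cinner_self)

text \<open>The form at \<open>x + t *\<^sub>R y\<close> is a nonnegative quadratic polynomial in
  \<open>t\<close>, so its discriminant is not positive.\<close>

lemma positive_op_cauchy_schwarz:
  assumes "positive_op T"
  shows "(inner x (blinfun_apply T y))\<^sup>2 \<le> inner x (T x) * inner y (T y)"
proof -
  define a b c where "a = inner x (T x)" and "b = inner x (T y)" and "c = inner y (T y)"
  have quad: "0 \<le> a + 2 * t * b + t\<^sup>2 * c" for t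
  proof -
    have "0 \<le> inner (x + t *\<^sub>R y) (T (x + t *\<^sub>R y))"
      by (rule positive_op_inner_nonneg[OF assms])
    also have "\<dots> = a + 2 * t * b + t\<^sup>2 * c"
      by (simp add: a_def b_def c_def blinfun.bilinear_simps inner_simps power2_eq_square
          positive_op_symmetric[OF assms, of x y] inner_commute[of "T x" y] algebra_simps)
    finally show ?thesis .
  qed
  have "0 \<le> c" unfolding c_def by (rule positive_op_inner_nonneg[OF assms])
  show ?thesis
  proof (cases "c = 0")
    case True
    \<comment> \<open>Without the quadratic term an affine function would be nonnegative everywhere;
      the chosen \<open>t\<close> gives it the value -1.\<close>
    have "b = 0"
    proof (rule ccontr)
      assume "b \<noteq> 0"
      then show False using quad[of "- (a + 1) / (2 * b)"] True by (simp add: field_simps)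
    qed
    then show ?thesis using True by (simp add: b_def c_def)
  next
    case False
    then show ?thesis
      using quad[of "- b / c"] \<open>0 \<le> c\<close>
      by (simp add: a_def[symmetric] b_def[symmetric] c_def[symmetric] field_simps power2_eq_square)
  qed
qed

lemma positive_op_eq_zero:
  assumes "positive_op T" "inner x (blinfun_apply T x) = 0"
  shows "T x = 0"
  using positive_op_cauchy_schwarz[OF assms(1), of "T x" x] assms(2) by simp

lemma le_op_inner: "le_op S T \<Longrightarrow> inner x (blinfun_apply S x) \<le> inner x (T x)"
  using positive_op_inner_nonneg[of "T - S" x]
  by (simp add: le_op_def blinfun.bilinear_simps inner_diff_right)

lemma le_op_refl: "le_op T T"
  by (auto simp: le_op_def positive_op_def cinner.zero_right)

lemma positive_op_add: "positive_op S \<Longrightarrow> positive_op T \<Longrightarrow> positive_op (S + T)"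
  by (auto simp: positive_op_def blinfun.bilinear_simps cinner_add_right)

lemma le_op_trans: "le_op R S \<Longrightarrow> le_op S T \<Longrightarrow> le_op R T"
  unfolding le_op_def using positive_op_add[of "T - S" "S - R"] by simp


text \<open>The bound depends on \<open>S\<close> only. Along a net bounded by \<open>S\<close> it
  therefore survives in the limit and makes the limit form bounded.\<close>

lemma positive_op_inner_le:
  assumes "positive_op (T :: 'h::chilbert op)" "le_op T S"
  shows "\<bar>inner x (T y)\<bar> \<le> norm S * norm x * norm y"
proof (rule abs_le_square_iff[THEN iffD2, of _ "norm S * norm x * norm y", simplified])
  have le: "inner z (T z) \<le> norm S * (norm z)\<^sup>2" for z
  proof -
    have "inner z (T z) \<le> inner z (S z)" by (rule le_op_inner[OF assms(2)])
    also have "\<dots> \<le> norm z * norm (S z)" by (rule norm_cauchy_schwarz)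
    also have "\<dots> \<le> norm z * (norm S * norm z)"
      by (intro mult_left_mono norm_blinfun norm_ge_zero)
    finally show ?thesis by (simp add: power2_eq_square mult_ac)
  qed
  have "(inner x (T y))\<^sup>2 \<le> inner x (T x) * inner y (T y)"
    by (rule positive_op_cauchy_schwarz[OF assms(1)])
  also have "\<dots> \<le> (norm S * (norm x)\<^sup>2) * (norm S * (norm y)\<^sup>2)"
    by (intro mult_mono le positive_op_inner_nonneg[OF assms(1)]) simp
  also have "\<dots> = (norm S * norm x * norm y)\<^sup>2" by (simp add: power2_eq_square mult_ac)
  finally show "(inner x (T y))\<^sup>2 \<le> (norm S * norm x * norm y)\<^sup>2" .
qed

text \<open>The limits of the quadratic forms along \<open>D\<close> define, by polarization, a bounded form and hence an
  operator, which is an upper bound of \<open>D\<close> and therefore dominates the least upper bound.\<close>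

lemma op_lub_tendsto:
  fixes D :: "'h::chilbert op set"
  assumes D: "D \<subseteq> pos_part BH" "D \<noteq> {}"
    and directed: "\<And>a b. a \<in> D \<Longrightarrow> b \<in> D \<Longrightarrow> \<exists>c\<in>D. le_op a c \<and> le_op b c"
    and lub: "op_lub BH D x" and x: "x \<in> BH"
  obtains \<F> where "\<F> \<noteq> bot" "\<forall>\<^sub>F a in \<F>. a \<in> D"
    "\<And>\<xi>. ((\<lambda>a. inner \<xi> (blinfun_apply a \<xi>)) \<longlongrightarrow> inner \<xi> (x \<xi>)) \<F>"
proof -
  have pos: "positive_op a" if "a \<in> D" for a using D(1) that by (auto simp: pos_part_def)
  have ax: "le_op a x" if "a \<in> D" for a using lub that by (auto simp: op_lub_def)
  \<comment> \<open>The filter generated by the tails of \<open>D\<close>, with which the net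
    becomes an ordinary filter limit. Directedness makes the tails a filter base.\<close>
  define \<F> where "\<F> = (INF a\<in>D. principal {c \<in> D. le_op a c})"
  have ev: "eventually P \<F> \<longleftrightarrow> (\<exists>a\<in>D. \<forall>c\<in>D. le_op a c \<longrightarrow> P c)" for P
    unfolding \<F>_def
  proof (subst eventually_INF_base)
    fix a b assume "a \<in> D" "b \<in> D"
    then obtain c where "c \<in> D" "le_op a c" "le_op b c" using directed by blast
    then show "\<exists>c\<in>D. principal {c' \<in> D. le_op c c'} \<le>
        inf (principal {c \<in> D. le_op a c}) (principal {c \<in> D. le_op b c})"
      by (auto intro!: bexI[of _ c] elim: le_op_trans)
  qed (use D in \<open>auto simp: eventually_principal\<close>)
  have ntriv: "\<F> \<noteq> bot"
    using le_op_refl by (fastforce simp: trivial_limit_def ev)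
  have evD: "\<forall>\<^sub>F a in \<F>. a \<in> D" using D(2) by (auto simp: ev)
  define Q where "Q \<xi> = (SUP a\<in>D. inner \<xi> (blinfun_apply a \<xi>))" for \<xi>
  have bdd: "bdd_above ((\<lambda>a. inner \<xi> (blinfun_apply a \<xi>)) ` D)" for \<xi>
    using le_op_inner[OF ax] by (intro bdd_aboveI2)
  have Q_ge: "inner \<xi> (a \<xi>) \<le> Q \<xi>" if "a \<in> D" for a \<xi>
    unfolding Q_def using that bdd by (intro cSUP_upper)
  have Q: "((\<lambda>a. inner \<xi> (blinfun_apply a \<xi>)) \<longlongrightarrow> Q \<xi>) \<F>" for \<xi>
  proof (rule order_tendstoI)
    fix l assume "l < Q \<xi>"
    then obtain a where "a \<in> D" "l < inner \<xi> (a \<xi>)"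
      unfolding Q_def using less_cSUP_iff[OF D(2) bdd] by blast
    then show "\<forall>\<^sub>F a in \<F>. l < inner \<xi> (blinfun_apply a \<xi>)"
      using le_op_inner unfolding ev by (meson less_le_trans)
  next
    fix u assume "Q \<xi> < u"
    then show "\<forall>\<^sub>F a in \<F>. inner \<xi> (blinfun_apply a \<xi>) < u"
      by (intro eventually_mono[OF evD]) (meson Q_ge le_less_trans)
  qed
  define L where "L \<xi> \<eta> = (Q (\<xi> + \<eta>) - Q (\<xi> - \<eta>)) / 4" for \<xi> \<eta>
  have L: "((\<lambda>a. inner \<xi> (blinfun_apply a \<eta>)) \<longlongrightarrow> L \<xi> \<eta>) \<F>" for \<xi> \<eta>
  proof (rule tendsto_cong[THEN iffD1])
    show "((\<lambda>a. (inner (\<xi> + \<eta>) (blinfun_apply a (\<xi> + \<eta>)) - inner (\<xi> - \<eta>) (blinfun_apply a (\<xi> - \<eta>))) / 4)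
        \<longlongrightarrow> L \<xi> \<eta>) \<F>"
      unfolding L_def by (intro tendsto_intros Q) auto
    show "\<forall>\<^sub>F a in \<F>. (inner (\<xi> + \<eta>) (blinfun_apply a (\<xi> + \<eta>)) -
        inner (\<xi> - \<eta>) (blinfun_apply a (\<xi> - \<eta>))) / 4 = inner \<xi> (blinfun_apply a \<eta>)"
    proof (rule eventually_mono[OF evD])
      fix a assume "a \<in> D"
      show "(inner (\<xi> + \<eta>) (blinfun_apply a (\<xi> + \<eta>)) -
        inner (\<xi> - \<eta>) (blinfun_apply a (\<xi> - \<eta>))) / 4 = inner \<xi> (blinfun_apply a \<eta>)"
        using positive_op_symmetric[OF pos[OF \<open>a \<in> D\<close>], of \<xi> \<eta>]
        by (simp add: blinfun.bilinear_simps inner_simps inner_commute[of \<eta>])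
    qed
  qed
  have L_eq: "L \<xi> \<eta> = l" if "((\<lambda>a. inner \<xi> (blinfun_apply a \<eta>)) \<longlongrightarrow> l) \<F>" for \<xi> \<eta> l
    by (rule tendsto_unique[OF ntriv L that])
  have bil: "bounded_bilinear L"
  proof
    show "L (\<xi> + \<xi>') \<eta> = L \<xi> \<eta> + L \<xi>' \<eta>" for \<xi> \<xi>' \<eta>
      by (rule L_eq) (simp add: inner_add_left tendsto_add L)
    show "L \<xi> (\<eta> + \<eta>') = L \<xi> \<eta> + L \<xi> \<eta>'" for \<xi> \<eta> \<eta>'
      by (rule L_eq) (simp add: inner_add_right blinfun.add_right tendsto_add L)
    show "L (r *\<^sub>R \<xi>) \<eta> = r *\<^sub>R L \<xi> \<eta>" for r \<xi> \<eta>
      by (rule L_eq) (simp add: tendsto_mult_left L)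
    show "L \<xi> (r *\<^sub>R \<eta>) = r *\<^sub>R L \<xi> \<eta>" for r \<xi> \<eta>
      by (rule L_eq) (simp add: blinfun.scaleR_right tendsto_mult_left L)
    have "norm (L \<xi> \<eta>) \<le> norm \<xi> * norm \<eta> * norm x" for \<xi> \<eta>
    proof (rule tendsto_upperbound[OF tendsto_norm[OF L] _ ntriv], rule eventually_mono[OF evD])
      fix a assume "a \<in> D"
      then show "norm (inner \<xi> (blinfun_apply a \<eta>)) \<le> norm \<xi> * norm \<eta> * norm x"
        using positive_op_inner_le[OF pos ax, of a \<xi> \<eta>] by (simp add: mult_ac)
    qed
    then show "\<exists>K. \<forall>\<xi> \<eta>. norm (L \<xi> \<eta>) \<le> norm \<xi> * norm \<eta> * K" by blast
  qed
  moreover have "L (c *\<^sub>C \<xi>) \<eta> = L \<xi> (cnj c *\<^sub>C \<eta>)" for c \<xi> \<eta>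
  proof (rule L_eq, rule tendsto_cong[THEN iffD1, OF _ L[of \<xi> "cnj c *\<^sub>C \<eta>"]],
      rule eventually_mono[OF evD])
    fix a assume "a \<in> D"
    then have "a \<in> BH" by (intro positive_op_BH pos)
    then show "inner \<xi> (blinfun_apply a (cnj c *\<^sub>C \<eta>)) = inner (c *\<^sub>C \<xi>) (blinfun_apply a \<eta>)"
      by (simp add: BH_scaleC inner_scaleC_right)
  qed
  ultimately obtain y where y: "y \<in> BH" "\<And>\<xi> \<eta>. inner \<xi> (y \<eta>) = L \<xi> \<eta>"
    using BH_of_form[of L] by blast
  have LQ: "L \<xi> \<xi> = Q \<xi>" for \<xi> by (rule L_eq[OF Q])
  have L_sym: "L \<xi> \<eta> = L \<eta> \<xi>" for \<xi> \<eta>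
  proof (rule L_eq, rule tendsto_cong[THEN iffD1, OF _ L[of \<eta> \<xi>]], rule eventually_mono[OF evD])
    fix a assume "a \<in> D"
    then show "inner \<eta> (blinfun_apply a \<xi>) = inner \<xi> (blinfun_apply a \<eta>)"
      using positive_op_symmetric[OF pos, of a \<xi> \<eta>] by (simp add: inner_commute)
  qed
  have "le_op a y" if "a \<in> D" for a
    unfolding le_op_def
  proof (rule positive_opI)
    show "y - a \<in> BH" using y(1) positive_op_BH[OF pos[OF that]] by blast
    show "inner \<xi> ((y - a) \<eta>) = inner ((y - a) \<xi>) \<eta>" for \<xi> \<eta>
      using positive_op_symmetric[OF pos[OF that], of \<xi> \<eta>] L_sym[of \<xi> \<eta>] y(2)[of \<eta> \<xi>]
      by (simp add: blinfun.diff_left inner_diff_right inner_diff_left y(2) inner_commute)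
    show "0 \<le> inner \<xi> ((y - a) \<xi>)" for \<xi>
      using Q_ge[OF that, of \<xi>] by (simp add: blinfun.diff_left inner_diff_right y(2) LQ)
  qed
  then have "le_op x y" using lub y(1) by (auto simp: op_lub_def)
  have "Q \<xi> = inner \<xi> (x \<xi>)" for \<xi>
  proof (rule antisym)
    show "Q \<xi> \<le> inner \<xi> (x \<xi>)"
      unfolding Q_def using D(2) le_op_inner[OF ax] by (intro cSUP_least)
    show "inner \<xi> (x \<xi>) \<le> Q \<xi>"
      using le_op_inner[OF \<open>le_op x y\<close>, of \<xi>] by (simp add: y(2) LQ)
  qed
  then show thesis using that[OF ntriv evD] Q by simp
qed


section \<open>Sums of nonnegative numbers\<close>

lemma infsum_ennreal_SUP:
  fixes f :: "'a \<Rightarrow> ennreal"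
  shows "infsum f A = (SUP F\<in>{F. finite F \<and> F \<subseteq> A}. sum f F)"
  by (rule nonneg_infsum_complete) simp

lemma infsum_ennreal_summable:
  fixes f :: "'a \<Rightarrow> real"
  assumes "f summable_on A" "\<And>x. x \<in> A \<Longrightarrow> 0 \<le> f x"
  shows "(\<Sum>\<^sub>\<infinity>x\<in>A. ennreal (f x)) = ennreal (infsum f A)"
proof -
  have "ennreal (infsum f A) = (SUP F\<in>{F. finite F \<and> F \<subseteq> A}. ennreal (sum f F))"
    by (rule infsum_nonneg_is_SUPREMUM_ennreal[OF assms])
  also have "\<dots> = (SUP F\<in>{F. finite F \<and> F \<subseteq> A}. \<Sum>x\<in>F. ennreal (f x))"
    using assms(2) by (intro SUP_cong refl sum_ennreal[symmetric]) auto
  also have "\<dots> = (\<Sum>\<^sub>\<infinity>x\<in>A. ennreal (f x))"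
    by (rule infsum_ennreal_SUP[symmetric])
  finally show ?thesis ..
qed

lemma summable_on_of_infsum_ennreal:
  fixes f :: "'a \<Rightarrow> real"
  assumes "(\<Sum>\<^sub>\<infinity>x\<in>A. ennreal (f x)) < \<infinity>" "\<And>x. x \<in> A \<Longrightarrow> 0 \<le> f x"
  shows "f summable_on A"
proof (rule nonneg_bdd_above_summable_on)
  show "bdd_above (sum f ` {F. F \<subseteq> A \<and> finite F})"
  proof (rule bdd_aboveI2)
    fix F assume F: "F \<in> {F. F \<subseteq> A \<and> finite F}"
    then have "ennreal (sum f F) = (\<Sum>x\<in>F. ennreal (f x))"
      using assms(2) by (intro sum_ennreal[symmetric]) auto
    also have "\<dots> \<le> (\<Sum>\<^sub>\<infinity>x\<in>A. ennreal (f x))"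
      unfolding infsum_ennreal_SUP using F by (intro SUP_upper) auto
    also have "\<dots> = ennreal (enn2real (\<Sum>\<^sub>\<infinity>x\<in>A. ennreal (f x)))"
      using assms(1) by simp
    finally show "sum f F \<le> enn2real (\<Sum>\<^sub>\<infinity>x\<in>A. ennreal (f x))"
      by (simp add: ennreal_le_iff)
  qed
qed (rule assms(2))

lemma has_sum_sum:
  fixes f :: "'i \<Rightarrow> 'a \<Rightarrow> 'b::topological_comm_monoid_add"
  assumes "\<And>i. i \<in> I \<Longrightarrow> (f i has_sum s i) A"
  shows "((\<lambda>x. \<Sum>i\<in>I. f i x) has_sum (\<Sum>i\<in>I. s i)) A"
  using assms
proof (induction I rule: infinite_finite_induct)
  case (insert i I)
  then have "((\<lambda>x. f i x + (\<Sum>i\<in>I. f i x)) has_sum s i + (\<Sum>i\<in>I. s i)) A"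
    by (intro has_sum_add) simp_all
  then show ?case using insert.hyps by simp
qed simp_all

lemma infsum_cmult_ennreal: "(\<Sum>\<^sub>\<infinity>x\<in>A. c * f x) = c * infsum f A" for c :: ennreal
  unfolding infsum_ennreal_SUP
  by (simp add: sum_distrib_left[symmetric] SUP_mult_left_ennreal)

text \<open>The Weierstrass M-test along the filter of finite index sets: the remainder outside
  \<open>I\<close> is dominated by that of \<open>M\<close>, independently of
  \<open>z\<close>.\<close>

lemma uniform_limit_infsum:
  fixes f :: "'a \<Rightarrow> 'b \<Rightarrow> 'c::banach"
  assumes M: "M summable_on A" and le: "\<And>i z. i \<in> A \<Longrightarrow> z \<in> S \<Longrightarrow> norm (f i z) \<le> M i"
  shows "uniform_limit S (\<lambda>I z. \<Sum>i\<in>I. f i z) (\<lambda>z. \<Sum>\<^sub>\<infinity>i\<in>A. f i z) (finite_subsets_at_top A)"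
proof (rule uniform_limitI)
  fix e :: real assume "0 < e"
  have "(sum M \<longlongrightarrow> infsum M A) (finite_subsets_at_top A)"
    using M by (simp add: has_sum_def[symmetric])
  then have ev: "\<forall>\<^sub>F I in finite_subsets_at_top A. dist (sum M I) (infsum M A) < e"
    using \<open>0 < e\<close> by (rule tendstoD)
  then have ev_sub: "\<forall>\<^sub>F I in finite_subsets_at_top A.
      dist (sum M I) (infsum M A) < e \<and> finite I \<and> I \<subseteq> A"
    by (rule eventually_conj) (auto intro: eventually_finite_subsets_at_top_weakI)
  show "\<forall>\<^sub>F I in finite_subsets_at_top A. \<forall>z\<in>S. dist (\<Sum>i\<in>I. f i z) (\<Sum>\<^sub>\<infinity>i\<in>A. f i z) < e"
  proof (rule eventually_mono[OF ev_sub], intro ballI)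
    fix I z
    assume I: "dist (sum M I) (infsum M A) < e \<and> finite I \<and> I \<subseteq> A" and z: "z \<in> S"
    have abs: "(\<lambda>i. f i z) abs_summable_on A"
      using le z by (intro summable_on_comparison_test[OF M]) simp_all
    then have sm: "(\<lambda>i. f i z) summable_on A" by (rule abs_summable_summable)
    have "(\<Sum>\<^sub>\<infinity>i\<in>A. f i z) - (\<Sum>i\<in>I. f i z) = (\<Sum>\<^sub>\<infinity>i\<in>A - I. f i z)"
      using I sm by (simp add: infsum_Diff)
    also have "norm \<dots> \<le> infsum M (A - I)"
    proof (rule norm_infsum_le)
      show "((\<lambda>i. f i z) has_sum (\<Sum>\<^sub>\<infinity>i\<in>A - I. f i z)) (A - I)"
        using summable_on_subset_banach[OF sm, of "A - I"] by simp
      show "(M has_sum infsum M (A - I)) (A - I)"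
        using summable_on_subset_banach[OF M, of "A - I"] by simp
      show "norm (f i z) \<le> M i" if "i \<in> A - I" for i
        using le[OF _ z] that by simp
    qed
    also have "\<dots> = infsum M A - sum M I"
      using I M by (simp add: infsum_Diff)
    also have "\<dots> < e" using I by (auto simp: dist_real_def abs_less_iff)
    finally show "dist (\<Sum>i\<in>I. f i z) (\<Sum>\<^sub>\<infinity>i\<in>A. f i z) < e"
      by (simp add: dist_norm norm_minus_commute)
  qed
qed

section \<open>The domain of a weight\<close>

lemma finite_part_subset_weight_dom: "finite_part N \<Phi> \<subseteq> weight_dom N \<Phi>"
proof
  fix x assume "x \<in> finite_part N \<Phi>"
  then show "x \<in> weight_dom N \<Phi>"
    unfolding weight_dom_def by (intro CollectI exI[of _ "{x}"] exI[of _ "\<lambda>_. 1"]) simp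
qed

text \<open>Both combinations are extended to the union of their index sets with zero coefficients,
  since an element may occur in both.\<close>

lemma weight_dom_add:
  assumes "S \<in> weight_dom N \<Phi>" "T \<in> weight_dom N \<Phi>"
  shows "S + T \<in> weight_dom N \<Phi>"
proof -
  obtain X c where X: "finite X" "X \<subseteq> finite_part N \<Phi>" "S = (\<Sum>x\<in>X. c x *\<^sub>C x)"
    using assms(1) by (auto simp: weight_dom_def)
  obtain Y c' where Y: "finite Y" "Y \<subseteq> finite_part N \<Phi>" "T = (\<Sum>x\<in>Y. c' x *\<^sub>C x)"
    using assms(2) by (auto simp: weight_dom_def)
  have "S = (\<Sum>x\<in>X \<union> Y. (if x \<in> X then c x else 0) *\<^sub>C x)"
    unfolding X(3) using X(1) Y(1)
    by (intro sum.mono_neutral_cong_left) (auto simp: scaleC_op.zero_left)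
  moreover have "T = (\<Sum>x\<in>X \<union> Y. (if x \<in> Y then c' x else 0) *\<^sub>C x)"
    unfolding Y(3) using X(1) Y(1)
    by (intro sum.mono_neutral_cong_left) (auto simp: scaleC_op.zero_left)
  ultimately have "S + T = (\<Sum>x\<in>X \<union> Y. ((if x \<in> X then c x else 0) + (if x \<in> Y then c' x else 0)) *\<^sub>C x)"
    by (simp add: scaleC_op.add_left sum.distrib)
  then show ?thesis
    unfolding weight_dom_def using X(1,2) Y(1,2)
    by (intro CollectI exI[of _ "X \<union> Y"] exI conjI) auto
qed

lemma weight_dom_scaleC:
  assumes "S \<in> weight_dom N \<Phi>"
  shows "a *\<^sub>C S \<in> weight_dom N \<Phi>"
proof -
  obtain X c where X: "finite X" "X \<subseteq> finite_part N \<Phi>" "S = (\<Sum>x\<in>X. c x *\<^sub>C x)"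
    using assms(1) by (auto simp: weight_dom_def)
  then have "a *\<^sub>C S = (\<Sum>x\<in>X. (a * c x) *\<^sub>C x)"
    by (simp add: scaleC_op.sum_right op_scaleC_scaleC)
  then show ?thesis
    unfolding weight_dom_def using X(1,2) by (intro CollectI exI[of _ X] exI conjI)
qed


section \<open>Diagonal weights\<close>

text \<open>The bounded data attached to a positive operator with pure point spectrum: eigenvectors
  \<open>e\<close>, whose completeness is the Parseval identity, eigenvalues \<open>d\<close>, and
  its imaginary powers \<open>U\<close>. Nothing is assumed on the distribution of the
  eigenvalues.\<close>

locale diagonal_weight =
  fixes e :: "'i \<Rightarrow> 'h::chilbert" and d :: "'i \<Rightarrow> real" and U :: "real \<Rightarrow> 'h op"
  assumes orthonormal: "cinner (e i) (e j) = (if i = j then 1 else 0)"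
    and parseval: "((\<lambda>i. cinner x (e i) * cinner (e i) y) has_sum cinner x y) UNIV"
    and d_pos: "0 < d i"
    and U_BH [simp]: "U t \<in> BH"
    and U_basis: "U t (e i) = cis (t * ln (d i)) *\<^sub>C e i"
begin

lemma has_sum_norm: "((\<lambda>i. (cmod (cinner (e i) x))\<^sup>2) has_sum (norm x)\<^sup>2) UNIV"
proof -
  have "cinner x (e i) * cinner (e i) x = of_real ((cmod (cinner (e i) x))\<^sup>2)" for i
    by (subst cinner_commute) (simp add: complex_norm_square mult.commute del: of_real_power)
  then show ?thesis
    using has_sum_Re[OF parseval[of x x]] by (simp add: cinner_self del: of_real_power)
qed

lemma basis_eqI:
  assumes "\<And>i. cinner (e i) x = cinner (e i) y"
  shows "x = y"
proof -
  have "((\<lambda>_. 0) has_sum (norm (x - y))\<^sup>2) (UNIV :: 'i set)"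
    using has_sum_norm[of "x - y"] assms by (simp add: cinner.diff_right)
  then have "(norm (x - y))\<^sup>2 = 0" using has_sum_unique has_sum_0_simp by blast
  then show ?thesis by simp
qed

definition proj :: "'i set \<Rightarrow> 'h op" where
  "proj I = Blinfun (\<lambda>x. \<Sum>i\<in>I. cinner (e i) x *\<^sub>C e i)"

lemma proj_apply: "proj I x = (\<Sum>i\<in>I. cinner (e i) x *\<^sub>C e i)"
  unfolding proj_def
  by (subst bounded_linear_Blinfun_apply)
    (auto intro!: bounded_linear_sum bounded_linear_compose[OF scaleC.bounded_linear_left]
      cinner.bounded_linear_right)

lemma proj_BH [simp]: "proj I \<in> BH"
  by (simp add: BH_def proj_apply cinner_scaleC_right scaleC.sum_right scaleC_scaleC)

lemma cinner_basis_proj: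
  "finite I \<Longrightarrow> cinner (e j) (proj I x) = (if j \<in> I then cinner (e j) x else 0)"
  by (simp add: proj_apply cinner.sum_right cinner_scaleC_right orthonormal if_distrib
      cong: if_cong)

lemma proj_basis: "finite I \<Longrightarrow> proj I (e j) = (if j \<in> I then e j else 0)"
  by (rule basis_eqI) (auto simp: cinner_basis_proj orthonormal cinner.zero_right)

lemma adj_proj: "adj (proj I) = proj I"
proof (rule adj_unique)
  fix x y
  show "cinner (proj I x) y = cinner x (proj I y)"
    unfolding proj_apply cinner.sum_left cinner.sum_right cinner_scaleC_left cinner_scaleC_right
    by (simp flip: cinner_commute add: mult.commute)
qed simp

lemma norm_proj_le: "norm (proj I x) \<le> norm x" if "finite I"
proof -
  have "(norm (proj I x))\<^sup>2 \<le> (norm x)\<^sup>2"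
    using has_sum_norm[of "proj I x"] has_sum_norm[of x]
    by (rule has_sum_mono) (simp add: cinner_basis_proj that)
  then show ?thesis by (simp add: power2_le_iff_abs_le)
qed

text \<open>The squared distance of \<open>x\<close> from its projection is the remainder of the
  Parseval series for the squared norm.\<close>

lemma proj_tendsto: "((\<lambda>I. proj I x) \<longlongrightarrow> x) (finite_subsets_at_top UNIV)"
proof -
  let ?F = "finite_subsets_at_top (UNIV :: 'i set)"
  have "((\<lambda>I. (norm x)\<^sup>2 - (\<Sum>i\<in>I. (cmod (cinner (e i) x))\<^sup>2)) \<longlongrightarrow> (norm x)\<^sup>2 - (norm x)\<^sup>2) ?F"
    using has_sum_norm[of x] by (intro tendsto_intros) (simp add: has_sum_def)
  moreover have "(norm x)\<^sup>2 - (\<Sum>i\<in>I. (cmod (cinner (e i) x))\<^sup>2) = (norm (proj I x - x))\<^sup>2"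
    if "finite I" for I
  proof -
    have "cinner (proj I x) (proj I x) = cinner x (proj I (proj I x))"
      by (subst (1) adj_proj[symmetric]) (rule cinner_adj_left[OF proj_BH])
    also have "proj I (proj I x) = proj I x"
      by (rule basis_eqI) (simp add: cinner_basis_proj that)
    finally have 1: "inner (proj I x) (proj I x) = inner x (proj I x)"
      by (simp add: inner_eq_Re_cinner)
    have "inner x (proj I x) = (\<Sum>i\<in>I. Re (cinner (e i) x * cinner x (e i)))"
      by (simp add: inner_eq_Re_cinner proj_apply cinner.sum_right cinner_scaleC_right)
    also have "\<dots> = (\<Sum>i\<in>I. (cmod (cinner (e i) x))\<^sup>2)"
      by (subst (2) cinner_commute) (simp add: complex_norm_square[symmetric] del: Re_sum)
    finally show ?thesis
      using 1 by (simp add: power2_norm_eq_inner inner_diff_left inner_diff_right inner_commute)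
  qed
  ultimately have "((\<lambda>I. (norm (proj I x - x))\<^sup>2) \<longlongrightarrow> 0) ?F"
    by (subst tendsto_cong[where g = "\<lambda>I. (norm x)\<^sup>2 - (\<Sum>i\<in>I. (cmod (cinner (e i) x))\<^sup>2)"])
      (auto intro!: eventually_finite_subsets_at_top_weakI)
  then have "((\<lambda>I. norm (proj I x - x)) \<longlongrightarrow> 0) ?F"
    using tendsto_real_sqrt by fastforce
  then show ?thesis by (simp add: tendsto_norm_zero_iff LIM_zero_iff)
qed

lemma op_eqI:
  assumes "S \<in> BH" "T \<in> BH" "\<And>i. blinfun_apply S (e i) = T (e i)"
  shows "S = T"
proof (rule blinfun_eqI)
  fix x
  have "S (proj I x) = T (proj I x)" for I
    unfolding proj_apply blinfun.sum_right by (simp add: BH_scaleC assms)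
  moreover have "((\<lambda>I. S (proj I x)) \<longlongrightarrow> S x) (finite_subsets_at_top UNIV)"
    and "((\<lambda>I. T (proj I x)) \<longlongrightarrow> T x) (finite_subsets_at_top UNIV)"
    by (intro tendsto_intros proj_tendsto)+
  ultimately show "S x = T x"
    using tendsto_unique[of "finite_subsets_at_top UNIV"] by auto
qed

lemma entries_eqI:
  assumes "S \<in> BH" "T \<in> BH" "\<And>i j. cinner (e i) (blinfun_apply S (e j)) = cinner (e i) (T (e j))"
  shows "S = T"
  using assms by (intro op_eqI basis_eqI)


subsection \<open>The weight\<close>

definition W :: "'h op \<Rightarrow> ennreal" where
  "W S = (\<Sum>\<^sub>\<infinity>i. ennreal (d i * inner (e i) (S (e i))))"

lemma W_term_nonneg: "positive_op S \<Longrightarrow> 0 \<le> d i * inner (e i) (blinfun_apply S (e i))"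
  using d_pos[of i] positive_op_inner_nonneg[of S] by (simp add: less_imp_le)

lemma weight_W: "weight BH W"
  unfolding weight_def
proof (intro conjI ballI allI impI)
  fix x y :: "'h op" assume x: "x \<in> pos_part BH" and y: "y \<in> pos_part BH"
  have "W (x + y) = (\<Sum>\<^sub>\<infinity>i. ennreal (d i * inner (e i) (x (e i))) + ennreal (d i * inner (e i) (y (e i))))"
    unfolding W_def using x y
    by (intro infsum_cong) (simp add: W_term_nonneg pos_part_def blinfun.add_left
      inner_add_right distrib_left flip: ennreal_plus)
  also have "\<dots> = W x + W y"
    unfolding W_def by (rule infsum_add) (simp_all add: nonneg_summable_on_complete)
  finally show "W (x + y) = W x + W y" .
next
  fix x :: "'h op" and r :: real assume x: "x \<in> pos_part BH" and r: "0 \<le> r"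
  have "W (r *\<^sub>R x) = (\<Sum>\<^sub>\<infinity>i. ennreal r * ennreal (d i * inner (e i) (x (e i))))"
    unfolding W_def using x r
    by (intro infsum_cong) (simp add: blinfun.scaleR_left mult.left_commute W_term_nonneg
      pos_part_def flip: ennreal_mult)
  also have "\<dots> = ennreal r * W x" unfolding W_def by (rule infsum_cmult_ennreal)
  finally show "W (r *\<^sub>R x) = ennreal r * W x" .
qed

lemma W_ge: "ennreal (d i * inner (e i) (blinfun_apply x (e i))) \<le> W x"
  unfolding W_def infsum_ennreal_SUP by (rule SUP_upper2[of "{i}"]) auto

lemma faithful_W: "faithful_weight BH W"
  unfolding faithful_weight_def
proof (intro ballI impI)
  fix x :: "'h op" assume x: "x \<in> pos_part BH" and 0: "W x = 0"
  have pos: "positive_op x" using x by (simp add: pos_part_def)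
  have "x (e i) = 0" for i
  proof (rule positive_op_eq_zero[OF pos])
    have "ennreal (d i * inner (e i) (x (e i))) \<le> 0" using W_ge[of i x] 0 by simp
    then have "d i * inner (e i) (x (e i)) = 0"
      using W_term_nonneg[OF pos, of i] by (simp add: ennreal_eq_0_iff)
    then show "inner (e i) (x (e i)) = 0" using d_pos[of i] by simp
  qed
  then show "x = 0" using pos by (intro op_eqI) (auto simp: positive_op_BH)
qed

lemma W_mono: "le_op S T \<Longrightarrow> W S \<le> W T"
  unfolding W_def using d_pos
  by (intro infsum_mono) (auto intro!: ennreal_leI mult_left_mono le_op_inner
      nonneg_summable_on_complete simp: less_imp_le)

text \<open>Each finite partial sum of \<open>W x\<close> is a limit of the same partial sums of
  \<open>W a\<close>, all of which lie below the supremum. \<open>W x\<close> is the supremum of its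
  finite partial sums, so no limits have to be interchanged.\<close>

lemma normal_W: "normal_weight BH W"
  unfolding normal_weight_def
proof (intro allI impI, elim conjE)
  fix D and x :: "'h op"
  assume D: "D \<subseteq> pos_part BH" "D \<noteq> {}"
    and dir: "\<forall>a\<in>D. \<forall>b\<in>D. \<exists>c\<in>D. le_op a c \<and> le_op b c"
    and x: "x \<in> pos_part BH" and lub: "op_lub BH D x"
  obtain \<F> where F: "\<F> \<noteq> bot" "\<forall>\<^sub>F a in \<F>. a \<in> D"
    "\<And>\<xi>. ((\<lambda>a. inner \<xi> (blinfun_apply a \<xi>)) \<longlongrightarrow> inner \<xi> (x \<xi>)) \<F>"
    using op_lub_tendsto[OF D _ lub] dir x by (auto simp: pos_part_def)
  show "W x = (SUP a\<in>D. W a)"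
  proof (rule antisym)
    show "W x \<le> (SUP a\<in>D. W a)"
      unfolding W_def[of x] infsum_ennreal_SUP
    proof (rule SUP_least)
      fix I :: "'i set" assume I: "I \<in> {F. finite F \<and> F \<subseteq> UNIV}"
      have "((\<lambda>a. \<Sum>i\<in>I. ennreal (d i * inner (e i) (blinfun_apply a (e i)))) \<longlongrightarrow>
          (\<Sum>i\<in>I. ennreal (d i * inner (e i) (x (e i))))) \<F>"
        by (intro tendsto_sum tendsto_ennrealI tendsto_mult tendsto_const F(3))
      moreover have "\<forall>\<^sub>F a in \<F>. (\<Sum>i\<in>I. ennreal (d i * inner (e i) (blinfun_apply a (e i))))
          \<le> (SUP a\<in>D. W a)"
      proof (rule eventually_mono[OF F(2)])
        fix a assume "a \<in> D"
        have "(\<Sum>i\<in>I. ennreal (d i * inner (e i) (blinfun_apply a (e i)))) \<le> W a"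
          unfolding W_def infsum_ennreal_SUP using I by (intro SUP_upper) auto
        then show "(\<Sum>i\<in>I. ennreal (d i * inner (e i) (blinfun_apply a (e i)))) \<le> (SUP a\<in>D. W a)"
          using \<open>a \<in> D\<close> by (meson SUP_upper order_trans)
      qed
      ultimately show "(\<Sum>i\<in>I. ennreal (d i * inner (e i) (x (e i)))) \<le> (SUP a\<in>D. W a)"
        using tendsto_upperbound F(1) by blast
    qed
    show "(SUP a\<in>D. W a) \<le> W x"
      using lub by (intro SUP_least W_mono) (simp add: op_lub_def)
  qed
qed


subsection \<open>Square-integrable operators\<close>

lemma inner_adj_compose: "T \<in> BH \<Longrightarrow> inner x ((adj T o\<^sub>L T) x) = (norm (T x))\<^sup>2"
  by (simp add: inner_eq_Re_cinner cinner_adj_right cinner_self)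

text \<open>A Hilbert-Schmidt condition with weights \<open>d\<close>: the diagonal entries of
  \<open>adj T o\<^sub>L T\<close> are the squared norms of the columns of \<open>T\<close>.\<close>

lemma sq_integrable_iff:
  "T \<in> sq_integrable BH W \<longleftrightarrow> T \<in> BH \<and> (\<lambda>i. d i * (norm (T (e i)))\<^sup>2) summable_on UNIV"
proof (cases "T \<in> BH")
  case True
  have W: "W (adj T o\<^sub>L T) = (\<Sum>\<^sub>\<infinity>i. ennreal (d i * (norm (T (e i)))\<^sup>2))"
    by (simp only: W_def inner_adj_compose[OF True])
  have nonneg: "0 \<le> d i * (norm (T (e i)))\<^sup>2" for i
    using d_pos[of i] by simp
  show ?thesis
    using summable_on_of_infsum_ennreal[of "\<lambda>i. d i * (norm (T (e i)))\<^sup>2" UNIV]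
      infsum_ennreal_summable[of "\<lambda>i. d i * (norm (T (e i)))\<^sup>2" UNIV] nonneg True
    by (auto simp: sq_integrable_def W)
qed (simp add: sq_integrable_def)

lemma sq_integrable_add_scaleC:
  assumes "S \<in> sq_integrable BH W" "T \<in> sq_integrable BH W"
  shows "S + c *\<^sub>C T \<in> sq_integrable BH W"
  unfolding sq_integrable_iff
proof
  show "S + c *\<^sub>C T \<in> BH" using assms by (auto simp: sq_integrable_iff)
  have "(\<lambda>i. 2 * (d i * (norm (S (e i)))\<^sup>2) + (2 * (cmod c)\<^sup>2) * (d i * (norm (T (e i)))\<^sup>2)) summable_on UNIV"
    using assms by (intro summable_on_add summable_on_cmult_right) (auto simp: sq_integrable_iff)
  then show "(\<lambda>i. d i * (norm ((S + c *\<^sub>C T) (e i)))\<^sup>2) summable_on UNIV"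
  proof (rule summable_on_comparison_test)
    fix i
    have "(norm ((S + c *\<^sub>C T) (e i)))\<^sup>2 \<le> (norm (S (e i)) + cmod c * norm (T (e i)))\<^sup>2"
      by (intro power_mono) (auto simp: blinfun.add_left simp flip: norm_scaleC intro: norm_triangle_ineq)
    also have "\<dots> \<le> 2 * (norm (S (e i)))\<^sup>2 + 2 * (cmod c)\<^sup>2 * (norm (T (e i)))\<^sup>2"
      using zero_le_power2[of "norm (S (e i)) - cmod c * norm (T (e i))"]
      by (simp add: power2_eq_square algebra_simps)
    finally have "d i * (norm ((S + c *\<^sub>C T) (e i)))\<^sup>2 \<le>
        d i * (2 * (norm (S (e i)))\<^sup>2 + 2 * (cmod c)\<^sup>2 * (norm (T (e i)))\<^sup>2)"
      using d_pos[of i] by simp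
    then show "d i * (norm ((S + c *\<^sub>C T) (e i)))\<^sup>2 \<le>
       2 * (d i * (norm (S (e i)))\<^sup>2) + (2 * (cmod c)\<^sup>2) * (d i * (norm (T (e i)))\<^sup>2)"
      by (simp add: algebra_simps)
    show "0 \<le> d i * (norm ((S + c *\<^sub>C T) (e i)))\<^sup>2" using d_pos[of i] by simp
  qed
qed

text \<open>Polarization: with \<open>c\<close> running through the fourth roots of unity, the sum
  of the \<open>c *\<^sub>C P c\<close> is four times the product. Every \<open>P c\<close> is
  positive and of finite weight.\<close>

lemma adj_compose_weight_dom:
  assumes S: "S \<in> sq_integrable BH W" and T: "T \<in> sq_integrable BH W"
  shows "adj S o\<^sub>L T \<in> weight_dom BH W"
proof -
  have ST: "S \<in> BH" "T \<in> BH" using S T by (auto simp: sq_integrable_def)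
  define P where "P c = adj (T + c *\<^sub>C S) o\<^sub>L (T + c *\<^sub>C S)" for c
  have P: "P c \<in> weight_dom BH W" for c
  proof -
    have "T + c *\<^sub>C S \<in> sq_integrable BH W" by (rule sq_integrable_add_scaleC[OF T S])
    then have "P c \<in> finite_part BH W"
      unfolding P_def by (auto simp: finite_part_def pos_part_def sq_integrable_def
          positive_op_adj_compose)
    then show ?thesis using finite_part_subset_weight_dom by blast
  qed
  have P_eq: "P c = (adj T o\<^sub>L T) + (cnj c * c) *\<^sub>C (adj S o\<^sub>L S) + c *\<^sub>C (adj T o\<^sub>L S)
      + cnj c *\<^sub>C (adj S o\<^sub>L T)" for c
    using ST by (simp add: P_def adj_add adj_scaleC BH_scale compose_algebra scaleC_compose_left
        scaleC_compose_right op_scaleC_scaleC algebra_simps)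
  have four: "4 *\<^sub>C v = v + (v + (v + v))" for v :: 'h
  proof -
    have "4 *\<^sub>C v = (1 + (1 + (1 + 1))) *\<^sub>C v" by simp
    then show ?thesis by (simp only: scaleC_add_left scaleC_one)
  qed
  have "P 1 + \<i> *\<^sub>C P \<i> + (- 1) *\<^sub>C P (- 1) + (- \<i>) *\<^sub>C P (- \<i>) = 4 *\<^sub>C (adj S o\<^sub>L T)"
    unfolding P_eq
    by (rule blinfun_eqI) (simp add: blinfun.bilinear_simps scaleC_add_right scaleC_scaleC
        scaleC.minus_left scaleC.minus_right four algebra_simps)
  moreover have "P 1 + \<i> *\<^sub>C P \<i> + (- 1) *\<^sub>C P (- 1) + (- \<i>) *\<^sub>C P (- \<i>) \<in> weight_dom BH W"
    by (intro weight_dom_add weight_dom_scaleC P)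
  ultimately have "(1/4) *\<^sub>C 4 *\<^sub>C (adj S o\<^sub>L T) \<in> weight_dom BH W"
    by (metis weight_dom_scaleC)
  then show ?thesis by (simp add: op_scaleC_scaleC)
qed

text \<open>Every decomposition of \<open>T\<close> into elements of finite weight yields the sum of
  the weighted diagonal entries. This shows at once that the description defining
  \<open>weight_ext\<close> has a unique solution and what the solution is.\<close>

lemma has_sum_weight_ext:
  assumes "T \<in> weight_dom BH W"
  shows "((\<lambda>i. of_real (d i) * cinner (e i) (T (e i))) has_sum weight_ext BH W T) UNIV"
proof -
  let ?Q = "\<lambda>v X c. finite X \<and> X \<subseteq> finite_part BH W \<and>
     T = (\<Sum>x\<in>X. c x *\<^sub>C x) \<and> v = (\<Sum>x\<in>X. c x * of_real (enn2real (W x)))"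
  have sum: "((\<lambda>i. of_real (d i) * cinner (e i) (T (e i))) has_sum v) UNIV" if Q: "?Q v X c" for v X c
  proof -
    have 1: "((\<lambda>i. of_real (d i) * cinner (e i) (x (e i))) has_sum of_real (enn2real (W x))) UNIV"
      if "x \<in> X" for x
    proof -
      have x: "positive_op x" "W x < \<infinity>" using Q that by (auto simp: finite_part_def pos_part_def)
      have sm: "(\<lambda>i. d i * inner (e i) (x (e i))) summable_on UNIV"
        using x(2) unfolding W_def
        by (rule summable_on_of_infsum_ennreal) (rule W_term_nonneg[OF x(1)])
      have "0 \<le> (\<Sum>\<^sub>\<infinity>i. d i * inner (e i) (x (e i)))"
        by (intro infsum_nonneg W_term_nonneg[OF x(1)])
      then have "enn2real (W x) = (\<Sum>\<^sub>\<infinity>i. d i * inner (e i) (x (e i)))"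
        unfolding W_def infsum_ennreal_summable[OF sm W_term_nonneg[OF x(1)]] by simp
      then have "((\<lambda>i. d i * inner (e i) (x (e i))) has_sum enn2real (W x)) UNIV"
        using sm by simp
      then have "((\<lambda>i. complex_of_real (d i * inner (e i) (x (e i)))) has_sum of_real (enn2real (W x))) UNIV"
        by (rule has_sum_of_real)
      moreover have "cinner (e i) (x (e i)) = of_real (inner (e i) (x (e i)))" for i
        using x(1) by (simp add: positive_op_def complex_is_Real_iff complex_eq_iff inner_eq_Re_cinner)
      ultimately show ?thesis by simp
    qed
    have Teq: "T = (\<Sum>x\<in>X. c x *\<^sub>C x)" and v: "v = (\<Sum>x\<in>X. c x * of_real (enn2real (W x)))"
      using Q by blast+
    have "((\<lambda>i. \<Sum>x\<in>X. c x * (of_real (d i) * cinner (e i) (x (e i)))) has_sum v) UNIV"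
      unfolding v by (intro has_sum_sum has_sum_cmult_right 1)
    moreover have "of_real (d i) * cinner (e i) (T (e i)) =
        (\<Sum>x\<in>X. c x * (of_real (d i) * cinner (e i) (x (e i))))" for i
      by (simp add: Teq blinfun.sum_left cinner.sum_right cinner_scaleC_right sum_distrib_left
          mult.left_commute)
    ultimately show ?thesis by simp
  qed
  obtain X c where "?Q (\<Sum>x\<in>X. c x * of_real (enn2real (W x))) X c"
    using assms by (auto simp: weight_dom_def)
  then have "\<exists>!v. \<exists>X c. ?Q v X c"
    using has_sum_unique[OF sum sum] by blast
  then have "\<exists>X c. ?Q (weight_ext BH W T) X c"
    unfolding weight_ext_def by (rule theI')
  then show ?thesis using sum by blast
qed

text \<open>The compressions of \<open>T\<close> to finitely many basis vectors converge strongly to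
  \<open>T\<close>. They lie in the domain as products of two operators with finitely many nonzero
  columns, the first one under an adjoint.\<close>

lemma semifinite_W: "semifinite_weight BH W"
  unfolding semifinite_weight_def
proof (intro ballI allI impI)
  fix T :: "'h op" and Z :: "'h set" and \<epsilon> :: real
  assume T: "T \<in> BH" and Z: "finite Z" and "0 < \<epsilon>"
  let ?F = "finite_subsets_at_top (UNIV :: 'i set)"
  have lim: "((\<lambda>I. proj I (T (proj I z))) \<longlongrightarrow> T z) ?F" for z
  proof -
    have "((\<lambda>I. T (proj I z) - T z) \<longlongrightarrow> T z - T z) ?F"
      by (intro tendsto_intros proj_tendsto)
    then have "((\<lambda>I. norm (T (proj I z) - T z)) \<longlongrightarrow> 0) ?F"
      using tendsto_norm by fastforce
    then have "((\<lambda>I. proj I (T (proj I z) - T z)) \<longlongrightarrow> 0) ?F"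
      by (rule Lim_null_comparison[rotated])
        (auto intro!: eventually_finite_subsets_at_top_weakI norm_proj_le)
    from tendsto_add[OF this proj_tendsto[of "T z"]] show ?thesis
      by (simp add: blinfun.diff_right)
  qed
  have "\<forall>\<^sub>F I in ?F. \<forall>z\<in>Z. dist (proj I (T (proj I z))) (T z) < \<epsilon>"
    using Z tendstoD[OF lim \<open>0 < \<epsilon>\<close>] by (simp add: eventually_ball_finite_distrib)
  then have "\<forall>\<^sub>F I in ?F. (\<forall>z\<in>Z. dist (proj I (T (proj I z))) (T z) < \<epsilon>) \<and> finite I"
    by (rule eventually_conj) (auto intro: eventually_finite_subsets_at_top_weakI)
  then obtain I where I: "finite I" "\<And>z. z \<in> Z \<Longrightarrow> dist (proj I (T (proj I z))) (T z) < \<epsilon>"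
    using eventually_happens'[of ?F] by force
  have sq: "S o\<^sub>L proj I \<in> sq_integrable BH W" if "S \<in> BH" for S
    unfolding sq_integrable_iff
  proof
    have "(\<lambda>i. d i * (norm (S (proj I (e i))))\<^sup>2) summable_on I" using I(1) by simp
    then show "(\<lambda>i. d i * (norm ((S o\<^sub>L proj I) (e i)))\<^sup>2) summable_on UNIV"
      by (rule summable_on_cong_neutral[THEN iffD1, rotated -1]) (auto simp: proj_basis I(1))
  qed (use that in auto)
  have "id_blinfun o\<^sub>L proj I = proj I" by (rule blinfun_eqI) simp
  then have "adj (proj I) o\<^sub>L (T o\<^sub>L proj I) \<in> weight_dom BH W"
    using sq[OF BH_id] sq[OF T] by (intro adj_compose_weight_dom) simp_all
  then show "\<exists>S\<in>weight_dom BH W. \<forall>z\<in>Z. norm (T z - S z) < \<epsilon>"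
    using I(2) by (intro bexI) (auto simp: adj_proj dist_norm norm_minus_commute)
qed

lemma fns_weight_W: "fns_weight BH W"
  by (simp add: fns_weight_def weight_W faithful_W normal_W semifinite_W)

end


section \<open>Operator-valued entire functions\<close>

lemma op_entire_add:
  assumes "op_entire f" "op_entire g"
  shows "op_entire (\<lambda>z. f z + (g z :: 'h::chilbert op))"
  unfolding op_entire_def
proof
  fix z
  obtain D E where "((\<lambda>h. inverse h *\<^sub>C (f (z + h) - f z)) \<longlongrightarrow> D) (at 0)"
    "((\<lambda>h. inverse h *\<^sub>C (g (z + h) - g z)) \<longlongrightarrow> E) (at 0)"
    using assms unfolding op_entire_def by meson
  from tendsto_add[OF this]
  show "\<exists>D. ((\<lambda>h. inverse h *\<^sub>C (f (z + h) + g (z + h) - (f z + g z))) \<longlongrightarrow> D) (at 0)"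
    by (intro exI[of _ "D + E"]) (simp add: scaleC_op.add_right scaleC_op.diff_right algebra_simps)
qed

lemma op_entire_exp: "op_entire (\<lambda>z. exp (c * z) *\<^sub>C (T :: 'h::chilbert op))"
  unfolding op_entire_def
proof
  fix z
  have "((\<lambda>z. exp (c * z)) has_field_derivative c * exp (c * z)) (at z)"
    by (auto intro!: derivative_eq_intros)
  then have "((\<lambda>h. (exp (c * (z + h)) - exp (c * z)) / h) \<longlongrightarrow> c * exp (c * z)) (at 0)"
    by (simp add: DERIV_def)
  from scaleC_op.tendsto[OF this tendsto_const[of T]]
  show "\<exists>D. ((\<lambda>h. inverse h *\<^sub>C (exp (c * (z + h)) *\<^sub>C T - exp (c * z) *\<^sub>C T)) \<longlongrightarrow> D) (at 0)"
    by (intro exI) (simp add: scaleC_op.diff_left[symmetric] op_scaleC_scaleC divide_inverse mult.commute)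
qed

text \<open>Holomorphy is local, so it suffices to pass to the limit on closed balls inside
  \<open>S\<close>.\<close>

lemma holomorphic_on_uniform_limit:
  fixes f :: "'i \<Rightarrow> complex \<Rightarrow> complex"
  assumes "open S" "F \<noteq> bot" "uniform_limit S f g F" "\<forall>\<^sub>F i in F. f i holomorphic_on S"
  shows "g holomorphic_on S"
proof -
  have "\<exists>g'. (g has_field_derivative g') (at z)" if "z \<in> S" for z
  proof -
    obtain r where r: "0 < r" "cball z r \<subseteq> S"
      using \<open>open S\<close> \<open>z \<in> S\<close> open_contains_cball by blast
    have "g holomorphic_on ball z r"
    proof (rule holomorphic_uniform_limit[OF _ uniform_limit_on_subset[OF assms(3) r(2)] assms(2)])
      show "\<forall>\<^sub>F n in F. continuous_on (cball z r) (f n) \<and> f n holomorphic_on ball z r"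
      proof (rule eventually_mono[OF assms(4)])
        fix i assume "f i holomorphic_on S"
        then show "continuous_on (cball z r) (f i) \<and> f i holomorphic_on ball z r"
          using r(2) ball_subset_cball[of z r]
          by (meson holomorphic_on_imp_continuous_on holomorphic_on_subset order_trans)
      qed
    qed
    then show ?thesis
      using r(1) by (meson centre_in_ball field_differentiable_def holomorphic_on_imp_differentiable_at open_ball)
  qed
  then show ?thesis by (meson DERIV_subset field_differentiable_def field_differentiable_at_within holomorphic_onI)
qed


context diagonal_weight
begin

subsection \<open>The modular group\<close>

lemma U_add: "U (t + u) = U t o\<^sub>L U u"
  by (rule op_eqI)
    (auto simp: U_basis BH_scaleC scaleC_scaleC cis_mult algebra_simps)

lemma U_0 [simp]: "U 0 = id_blinfun"
  by (rule op_eqI) (auto simp: U_basis)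

lemma U_U_minus [simp]: "U t (U (- t) x) = x" "U (- t) (U t x) = x"
  using U_add[of t "- t"] U_add[of "- t" t] by (metis U_0 add.left_inverse add.right_inverse
      blinfun_apply_blinfun_compose id_blinfun.rep_eq)+

lemma adj_U [simp]: "adj (U t) = U (- t)"
  by (rule entries_eqI)
    (auto simp: cinner_adj_right U_basis cinner_scaleC_left cinner_scaleC_right orthonormal cis_cnj)

lemma cinner_U: "cinner (U t x) y = cinner x (U (- t) y)"
  using cinner_adj_right[OF U_BH, of x t y] by simp

lemma norm_U [simp]: "norm (U t x) = norm x"
proof -
  have "complex_of_real ((norm (U t x))\<^sup>2) = of_real ((norm x)\<^sup>2)"
    by (simp only: cinner_self[symmetric] cinner_U U_U_minus)
  then have "(norm (U t x))\<^sup>2 = (norm x)\<^sup>2" by (simp only: of_real_eq_iff)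
  then show ?thesis by (simp add: power2_eq_iff_nonneg)
qed

text \<open>On finite combinations of eigenvectors the orbit is a finite sum of continuous phases.
  As \<open>U t\<close> is isometric, the approximation by such combinations is uniform in
  \<open>t\<close>.\<close>

lemma continuous_on_U: "continuous_on UNIV (\<lambda>t. U t x)"
proof (rule uniform_limit_theorem)
  show "\<forall>\<^sub>F I in finite_subsets_at_top UNIV. continuous_on UNIV (\<lambda>t. U t (proj I x))"
    unfolding proj_apply blinfun.sum_right BH_scaleC[OF U_BH] U_basis
    by (intro always_eventually allI continuous_on_sum
        bounded_linear.continuous_on[OF scaleC.bounded_linear_right]
        bounded_linear.continuous_on[OF scaleC.bounded_linear_left] continuous_intros)
  show "uniform_limit UNIV (\<lambda>I t. U t (proj I x)) (\<lambda>t. U t x) (finite_subsets_at_top UNIV)"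
  proof (rule uniform_limitI)
    fix \<epsilon> :: real assume "0 < \<epsilon>"
    show "\<forall>\<^sub>F I in finite_subsets_at_top UNIV. \<forall>t\<in>UNIV. dist (U t (proj I x)) (U t x) < \<epsilon>"
      using tendstoD[OF proj_tendsto \<open>0 < \<epsilon>\<close>]
      by (simp add: dist_norm blinfun.diff_right[symmetric])
  qed
qed simp

definition \<sigma> :: "real \<Rightarrow> 'h op \<Rightarrow> 'h op" where
  "\<sigma> t x = U t o\<^sub>L x o\<^sub>L U (- t)"

lemma \<sigma>_apply: "\<sigma> t x v = U t (x (U (- t) v))"
  by (simp add: \<sigma>_def)

lemma \<sigma>_BH [simp]: "x \<in> BH \<Longrightarrow> \<sigma> t x \<in> BH"
  by (auto simp: \<sigma>_def)

lemma \<sigma>_id: "\<sigma> t id_blinfun = id_blinfun"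
  by (rule blinfun_eqI) (simp add: \<sigma>_apply)

lemma \<sigma>_0: "\<sigma> 0 x = x"
  by (rule blinfun_eqI) (simp add: \<sigma>_def)

lemma \<sigma>_plus: "\<sigma> (t + u) x = \<sigma> t (\<sigma> u x)"
proof -
  have "- (t + u) = - u + - t" by simp
  then show ?thesis
    by (intro blinfun_eqI) (simp only: \<sigma>_apply U_add blinfun_apply_blinfun_compose)
qed

lemma \<sigma>_inverse [simp]: "\<sigma> t (\<sigma> (- t) x) = x" "\<sigma> (- t) (\<sigma> t x) = x"
  by (simp_all flip: \<sigma>_plus add: \<sigma>_0)

lemma \<sigma>_add: "\<sigma> t (x + y) = \<sigma> t x + \<sigma> t y"
  by (simp add: \<sigma>_def compose_algebra)

lemma \<sigma>_compose: "\<sigma> t (x o\<^sub>L y) = \<sigma> t x o\<^sub>L \<sigma> t y"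
  by (rule blinfun_eqI) (simp add: \<sigma>_apply)

lemma \<sigma>_scaleC: "\<sigma> t (c *\<^sub>C x) = c *\<^sub>C \<sigma> t x"
  by (rule blinfun_eqI) (simp add: \<sigma>_apply BH_scaleC)

lemma \<sigma>_adj: "x \<in> BH \<Longrightarrow> \<sigma> t (adj x) = adj (\<sigma> t x)"
  by (rule blinfun_eqI) (simp add: \<sigma>_def adj_compose)

lemma star_automorphism_\<sigma>: "star_automorphism BH (\<sigma> t)"
  unfolding star_automorphism_def algebra_automorphism_def
  by (auto simp: \<sigma>_id \<sigma>_add \<sigma>_compose \<sigma>_scaleC \<sigma>_adj
      intro!: bij_betwI[where g = "\<sigma> (- t)"])

text \<open>The phase is \<open>d i / d j\<close> raised to the power \<open>\<i> t\<close>. It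
  equals 1 on the diagonal, hence the invariance of \<open>W\<close>; its continuation in
  \<open>t\<close> produces the KMS function.\<close>

lemma entries_\<sigma>:
  "cinner (e i) (\<sigma> t x (e j)) = cis (t * (ln (d i) - ln (d j))) * cinner (e i) (x (e j))"
  if "x \<in> BH"
proof -
  have "cinner (e i) (\<sigma> t x (e j)) = cinner (U (- t) (e i)) (x (U (- t) (e j)))"
    by (simp add: \<sigma>_apply cinner_U)
  then show ?thesis
    by (simp add: U_basis BH_scaleC[OF that] cinner_scaleC_left cinner_scaleC_right cis_cnj
        cis_mult right_diff_distrib flip: mult.assoc)
qed

lemma W_\<sigma>: "x \<in> BH \<Longrightarrow> W (\<sigma> t x) = W x"
  unfolding W_def by (simp add: inner_eq_Re_cinner entries_\<sigma>)

lemma sq_integrable_\<sigma>: "x \<in> sq_integrable BH W \<Longrightarrow> \<sigma> t x \<in> sq_integrable BH W"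
  by (auto simp: sq_integrable_def W_\<sigma> simp flip: \<sigma>_adj \<sigma>_compose)

lemma continuous_on_\<sigma>:
  assumes "x \<in> BH"
  shows "continuous_on UNIV (\<lambda>t. cinner \<xi> (\<sigma> t x \<eta>))"
proof -
  have "continuous_on UNIV (\<lambda>t. cinner (U (- t) \<xi>) (x (U (- t) \<eta>)))"
    by (intro cinner.continuous_on bounded_linear.continuous_on[OF blinfun.bounded_linear_right]
        continuous_on_compose2[OF continuous_on_U] continuous_intros) auto
  then show ?thesis by (simp add: \<sigma>_apply cinner_U)
qed

lemma entries_summable:
  assumes "x \<in> sq_integrable BH W"
  shows "(\<lambda>(j, i). d j * (cmod (cinner (e i) (x (e j))))\<^sup>2) summable_on UNIV"
proof -
  have "(\<lambda>(j, i). d j * (cmod (cinner (e i) (x (e j))))\<^sup>2) summable_on (UNIV \<times> UNIV)"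
  proof (rule summable_on_SigmaI)
    show "((\<lambda>i. case (j, i) of (j, i) \<Rightarrow> d j * (cmod (cinner (e i) (x (e j))))\<^sup>2) has_sum
        d j * (norm (x (e j)))\<^sup>2) UNIV" for j
      using has_sum_cmult_right[OF has_sum_norm] by simp
  qed (use assms d_pos in \<open>auto simp: sq_integrable_iff less_imp_le\<close>)
  then show ?thesis by simp
qed

lemma summable_on_swap_UNIV:
  "f summable_on (UNIV :: ('a \<times> 'b) set) \<longleftrightarrow> (\<lambda>(x, y). f (y, x)) summable_on UNIV"
  using has_sum_swap[where f = f and A = UNIV and B = UNIV] by (simp add: summable_on_def)

text \<open>The left side is the modulus of the factor in the KMS series on the line
  \<open>Im z = r\<close>. The bound is the weighted inequality of arithmetic and geometric means,
  here by convexity of \<open>exp\<close>.\<close>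

lemma interpolation:
  assumes "0 \<le> r" "r \<le> 1"
  shows "d i * exp (- (r * (ln (d i) - ln (d j)))) \<le> d i + d j"
proof -
  have "d i * exp (- (r * (ln (d i) - ln (d j)))) =
      exp (ln (d i)) * exp (- (r * (ln (d i) - ln (d j))))"
    using d_pos[of i] by simp
  also have "\<dots> = exp ((1 - r) * ln (d i) + r * ln (d j))"
    by (simp only: exp_add[symmetric]) (simp add: algebra_simps)
  also have "\<dots> \<le> (1 - r) * exp (ln (d i)) + r * exp (ln (d j))"
    using convex_onD[OF exp_convex, of r "ln (d i)" "ln (d j)"] assms by (simp add: algebra_simps)
  also have "\<dots> \<le> d i + d j"
    using assms d_pos[of i] d_pos[of j]
    by (intro add_mono) (simp_all add: mult_left_le_one_le less_imp_le)
  finally show ?thesis .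
qed


text \<open>The function \<open>f z = (\<Sum>i j. d\<^sub>i powr (1 + \<i>z) * d\<^sub>j powr (- \<i>z) * x\<^sub>i\<^sub>j * y\<^sub>j\<^sub>i)\<close> interpolates the two traces.\<close>

lemma KMS_W:
  assumes "{x, y, adj x, adj y} \<subseteq> sq_integrable BH W"
  shows "\<exists>f. KMS_function BH W \<sigma> x y f"
proof -
  have x: "x \<in> BH" "x \<in> sq_integrable BH W" "adj x \<in> sq_integrable BH W"
    and y: "y \<in> BH" "y \<in> sq_integrable BH W" "adj y \<in> sq_integrable BH W"
    using assms by (auto simp: sq_integrable_def)
  define X where "X i j = cinner (e i) (x (e j))" for i j
  define Y where "Y i j = cinner (e i) (y (e j))" for i j
  define l where "l i j = ln (d i) - ln (d j)" for i j
  define g where "g p z = (case p of (i, j) \<Rightarrow>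
    of_real (d i) * exp (\<i> * z * of_real (l i j)) * (X i j * Y j i))" for p z
  define M where "M p = (case p of (i, j) \<Rightarrow> (d i + d j) * (cmod (X i j) * cmod (Y j i)))" for p
  have adj_entry: "cmod (cinner (e i) (adj a (e j))) = cmod (cinner (e j) (a (e i)))"
    if "a \<in> BH" for a i j
    by (subst cinner_adj_right[OF that], subst cinner_commute) simp
  have M: "M summable_on UNIV"
  proof (rule summable_on_comparison_test)
    \<comment> \<open>The integrability of \<open>x\<close>, \<open>adj x\<close>, \<open>y\<close>
      and \<open>adj y\<close> provides the four series in which the squared entries of
      \<open>X\<close> or \<open>Y\<close> are weighted by the eigenvalue of the row or of the
      column. Together they dominate \<open>M\<close>.\<close>
    have 1: "(\<lambda>(i, j). d j * (cmod (X i j))\<^sup>2) summable_on UNIV"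
      using entries_summable[OF x(2)] unfolding X_def by (subst summable_on_swap_UNIV) simp
    have 2: "(\<lambda>(i, j). d i * (cmod (X i j))\<^sup>2) summable_on UNIV"
      using entries_summable[OF x(3)] unfolding X_def adj_entry[OF x(1)] .
    have 3: "(\<lambda>(i, j). d i * (cmod (Y j i))\<^sup>2) summable_on UNIV"
      using entries_summable[OF y(2)] unfolding Y_def .
    have 4: "(\<lambda>(i, j). d j * (cmod (Y j i))\<^sup>2) summable_on UNIV"
      using entries_summable[OF y(3)] unfolding Y_def adj_entry[OF y(1)]
      by (subst summable_on_swap_UNIV) simp
    show "(\<lambda>p. ((case p of (i, j) \<Rightarrow> d j * (cmod (X i j))\<^sup>2) + (case p of (i, j) \<Rightarrow> d i * (cmod (X i j))\<^sup>2)) +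
        ((case p of (i, j) \<Rightarrow> d i * (cmod (Y j i))\<^sup>2) + (case p of (i, j) \<Rightarrow> d j * (cmod (Y j i))\<^sup>2)))
        summable_on UNIV"
      by (intro summable_on_add 1 2 3 4)
    fix p :: "'i \<times> 'i"
    obtain i j where p: "p = (i, j)" by fastforce
    have dd: "0 \<le> d i + d j" using d_pos[of i] d_pos[of j] by simp
    show "0 \<le> M p" using dd by (simp add: M_def p)
    have "cmod (X i j) * cmod (Y j i) \<le> (cmod (X i j))\<^sup>2 + (cmod (Y j i))\<^sup>2"
      using zero_le_power2[of "cmod (X i j) - cmod (Y j i)"]
        mult_nonneg_nonneg[OF norm_ge_zero norm_ge_zero, of "X i j" "Y j i"]
      unfolding power2_diff by linarith
    then have "(d i + d j) * (cmod (X i j) * cmod (Y j i)) \<le>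
        (d i + d j) * ((cmod (X i j))\<^sup>2 + (cmod (Y j i))\<^sup>2)"
      using dd by (rule mult_left_mono)
    then show "M p \<le> ((case p of (i, j) \<Rightarrow> d j * (cmod (X i j))\<^sup>2) + (case p of (i, j) \<Rightarrow> d i * (cmod (X i j))\<^sup>2)) +
        ((case p of (i, j) \<Rightarrow> d i * (cmod (Y j i))\<^sup>2) + (case p of (i, j) \<Rightarrow> d j * (cmod (Y j i))\<^sup>2))"
      by (simp add: M_def p algebra_simps)
  qed
  define S where "S = {z. 0 \<le> Im z \<and> Im z \<le> 1}"
  have g_le: "norm (g p z) \<le> M p" if "z \<in> S" for p z
  proof -
    obtain i j where p: "p = (i, j)" by fastforce
    have "norm (g p z) = (d i * exp (- (Im z * l i j))) * (cmod (X i j) * cmod (Y j i))"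
      using d_pos[of i] by (simp add: g_def p norm_mult mult.assoc)
    also have "\<dots> \<le> (d i + d j) * (cmod (X i j) * cmod (Y j i))"
      using interpolation[of "Im z" i j] that by (intro mult_right_mono) (auto simp: S_def l_def)
    finally show ?thesis by (simp add: M_def p)
  qed
  define f where "f z = (\<Sum>\<^sub>\<infinity>p. g p z)" for z
  have unif: "uniform_limit S (\<lambda>I z. \<Sum>p\<in>I. g p z) f (finite_subsets_at_top UNIV)"
    unfolding f_def by (rule uniform_limit_infsum[OF M]) (rule g_le)
  have sm: "((\<lambda>p. g p z) has_sum f z) UNIV" if "z \<in> S" for z
    unfolding f_def
    by (rule has_sum_infsum, rule abs_summable_summable, rule summable_on_comparison_test[OF M])
      (simp_all add: g_le[OF that])
  have hol: "(\<lambda>z. \<Sum>p\<in>I. g p z) holomorphic_on A" for I A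
    unfolding g_def case_prod_unfold by (intro holomorphic_intros)
  have "continuous_on S f"
    by (rule uniform_limit_theorem[OF _ unif])
      (auto intro!: always_eventually holomorphic_on_imp_continuous_on hol)
  moreover have "bounded (f ` S)"
  proof (rule boundedI)
    fix v assume "v \<in> f ` S"
    then obtain z where z: "z \<in> S" "v = f z" by blast
    show "norm v \<le> infsum M UNIV"
      unfolding z(2)
      by (rule norm_infsum_le[OF sm[OF z(1)] has_sum_infsum[OF M]]) (rule g_le[OF z(1)])
  qed
  moreover have "f holomorphic_on {z. 0 < Im z \<and> Im z < 1}"
  proof (rule holomorphic_on_uniform_limit)
    show "open {z. 0 < Im z \<and> Im z < 1}"
      by (intro open_Collect_conj open_Collect_less continuous_intros)
    show "uniform_limit {z. 0 < Im z \<and> Im z < 1} (\<lambda>I z. \<Sum>p\<in>I. g p z) f (finite_subsets_at_top UNIV)"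
      by (rule uniform_limit_on_subset[OF unif]) (auto simp: S_def)
  qed (auto intro!: always_eventually hol)
  moreover have "f (of_real t) = weight_ext BH W (\<sigma> t x o\<^sub>L y)" for t
  proof (rule has_sum_unique[OF _ has_sum_weight_ext])
    have "adj (\<sigma> t (adj x)) o\<^sub>L y \<in> weight_dom BH W"
      by (intro adj_compose_weight_dom sq_integrable_\<sigma> x y)
    then show "\<sigma> t x o\<^sub>L y \<in> weight_dom BH W"
      using x(1) by (simp flip: \<sigma>_adj)
    have "of_real t \<in> S" by (simp add: S_def)
    from sm[OF this] have "((\<lambda>p. g p (of_real t)) has_sum f (of_real t)) (UNIV \<times> UNIV)"
      by simp
    then show "((\<lambda>i. complex_of_real (d i) * cinner (e i) ((\<sigma> t x o\<^sub>L y) (e i))) has_sum f (of_real t)) UNIV"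
    proof (rule has_sum_SigmaD)
      fix i
      have "((\<lambda>j. cinner (adj (\<sigma> t x) (e i)) (e j) * cinner (e j) (y (e i))) has_sum
          cinner (adj (\<sigma> t x) (e i)) (y (e i))) UNIV"
        by (rule parseval)
      then have "((\<lambda>j. cinner (e i) (\<sigma> t x (e j)) * Y j i) has_sum
          cinner (e i) ((\<sigma> t x o\<^sub>L y) (e i))) UNIV"
        using x(1) by (simp add: cinner_adj_left Y_def)
      then have "((\<lambda>j. of_real (d i) * (cinner (e i) (\<sigma> t x (e j)) * Y j i)) has_sum
          of_real (d i) * cinner (e i) ((\<sigma> t x o\<^sub>L y) (e i))) UNIV"
        by (rule has_sum_cmult_right)
      moreover have "g (i, j) (of_real t) = of_real (d i) * (cinner (e i) (\<sigma> t x (e j)) * Y j i)" for j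
        by (simp add: g_def entries_\<sigma>[OF x(1)] X_def l_def cis_conv_exp mult_ac)
      ultimately show "((\<lambda>j. g (i, j) (of_real t)) has_sum
          of_real (d i) * cinner (e i) ((\<sigma> t x o\<^sub>L y) (e i))) UNIV"
        by simp
    qed
  qed
  moreover have "f (of_real t + \<i>) = weight_ext BH W (y o\<^sub>L \<sigma> t x)" for t
  proof (rule has_sum_unique[OF _ has_sum_weight_ext])
    have "adj (adj y) o\<^sub>L \<sigma> t x \<in> weight_dom BH W"
      by (intro adj_compose_weight_dom sq_integrable_\<sigma> x y)
    then show "y o\<^sub>L \<sigma> t x \<in> weight_dom BH W"
      using y(1) by simp
    have "of_real t + \<i> \<in> S" by (simp add: S_def)
    from sm[OF this] have "((\<lambda>p. g p (of_real t + \<i>)) has_sum f (of_real t + \<i>)) (UNIV \<times> UNIV)"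
      by simp
    \<comment> \<open>On the upper boundary line the factor \<open>d j / d i\<close> replaces
      \<open>d i\<close> by \<open>d j\<close>. The double series is therefore summed in the other
      order, with the trace index \<open>j\<close> outside.\<close>
    then have "((\<lambda>(j, i). g (i, j) (of_real t + \<i>)) has_sum f (of_real t + \<i>)) (UNIV \<times> UNIV)"
      by (subst (asm) has_sum_swap)
    then show "((\<lambda>j. complex_of_real (d j) * cinner (e j) ((y o\<^sub>L \<sigma> t x) (e j))) has_sum f (of_real t + \<i>)) UNIV"
    proof (rule has_sum_SigmaD)
      fix j
      have "((\<lambda>i. cinner (adj y (e j)) (e i) * cinner (e i) (\<sigma> t x (e j))) has_sum
          cinner (adj y (e j)) (\<sigma> t x (e j))) UNIV"
        by (rule parseval)
      then have "((\<lambda>i. Y j i * cinner (e i) (\<sigma> t x (e j))) has_sum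
          cinner (e j) ((y o\<^sub>L \<sigma> t x) (e j))) UNIV"
        using y(1) by (simp add: cinner_adj_left Y_def)
      then have "((\<lambda>i. of_real (d j) * (Y j i * cinner (e i) (\<sigma> t x (e j)))) has_sum
          of_real (d j) * cinner (e j) ((y o\<^sub>L \<sigma> t x) (e j))) UNIV"
        by (rule has_sum_cmult_right)
      moreover have "g (i, j) (of_real t + \<i>) = of_real (d j) * (Y j i * cinner (e i) (\<sigma> t x (e j)))" for i
      proof -
        have "\<i> * (of_real t + \<i>) * of_real (l i j) = \<i> * of_real (t * l i j) + of_real (- l i j)"
          by (simp add: algebra_simps)
        moreover have "exp (- l i j) = d j / d i"
          using d_pos[of i] d_pos[of j] by (simp add: l_def exp_diff)
        ultimately have "exp (\<i> * (of_real t + \<i>) * of_real (l i j)) = cis (t * l i j) * of_real (d j / d i)"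
          by (simp only: exp_add cis_conv_exp[symmetric] exp_of_real)
        then show ?thesis
          using d_pos[of i] by (simp add: g_def entries_\<sigma>[OF x(1)] X_def l_def[symmetric])
      qed
      ultimately show "((\<lambda>i. case (j, i) of (j, i) \<Rightarrow> g (i, j) (of_real t + \<i>)) has_sum
          of_real (d j) * cinner (e j) ((y o\<^sub>L \<sigma> t x) (e j))) UNIV"
        by simp
    qed
  qed
  ultimately have "KMS_function BH W \<sigma> x y f"
    unfolding KMS_function_def S_def by blast
  then show ?thesis by blast
qed

lemma modular_group_W: "modular_group BH W \<sigma>"
  unfolding modular_group_def
  using star_automorphism_\<sigma> \<sigma>_0 \<sigma>_plus continuous_on_\<sigma> W_\<sigma> KMS_W
  by (auto simp: pos_part_def)


subsection \<open>Homogeneous operators\<close>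

text \<open>Formally K T K^(-1) = w T, expressed through matrix entries so that no domain has to be
  discussed. Positivity of \<open>w\<close> gives meaning to its logarithm.\<close>

definition homogeneous :: "real \<Rightarrow> 'h op \<Rightarrow> bool" where
  "homogeneous w T \<longleftrightarrow> 0 < w \<and> T \<in> BH \<and> (\<forall>i j. cinner (e i) (T (e j)) \<noteq> 0 \<longrightarrow> d i = w * d j)"

lemma homogeneous_id: "homogeneous 1 id_blinfun"
  by (simp add: homogeneous_def orthonormal)

lemma homogeneous_add: "homogeneous w S \<Longrightarrow> homogeneous w T \<Longrightarrow> homogeneous w (S + T)"
  unfolding homogeneous_def by (auto simp: blinfun.add_left cinner_add_right) (metis add_0)

lemma homogeneous_scaleC: "homogeneous w T \<Longrightarrow> homogeneous w (c *\<^sub>C T)"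
  by (auto simp: homogeneous_def cinner_scaleC_right)

lemma homogeneous_zero: "0 < w \<Longrightarrow> homogeneous w 0"
  by (simp add: homogeneous_def cinner.zero_right)

text \<open>A nonzero entry of the product forces a nonzero term in its Parseval expansion; the
  intermediate index \<open>k\<close> of this term links the two eigenvalue relations.\<close>

lemma homogeneous_compose:
  assumes S: "homogeneous v S" and T: "homogeneous w T"
  shows "homogeneous (v * w) (S o\<^sub>L T)"
  unfolding homogeneous_def
proof (intro conjI allI impI)
  fix i j assume ne: "cinner (e i) ((S o\<^sub>L T) (e j)) \<noteq> 0"
  have S_BH: "S \<in> BH" using S by (simp add: homogeneous_def)
  have "((\<lambda>k. cinner (adj S (e i)) (e k) * cinner (e k) (T (e j))) has_sum
      cinner (adj S (e i)) (T (e j))) UNIV"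
    by (rule parseval)
  then have sum: "((\<lambda>k. cinner (e i) (S (e k)) * cinner (e k) (T (e j))) has_sum
      cinner (e i) ((S o\<^sub>L T) (e j))) UNIV"
    by (simp add: cinner_adj_left S_BH)
  obtain k where "cinner (e i) (S (e k)) * cinner (e k) (T (e j)) \<noteq> 0"
  proof (rule ccontr)
    assume "\<not> thesis"
    then have "cinner (e i) (S (e k)) * cinner (e k) (T (e j)) = 0" for k
      using that by blast
    then have "((\<lambda>_. 0) has_sum cinner (e i) ((S o\<^sub>L T) (e j))) (UNIV :: 'i set)"
      using sum by (simp only:)
    from has_sum_unique[OF this has_sum_0_simp] show False using ne by contradiction
  qed
  then have "d i = v * d k" "d k = w * d j"
    using S T by (simp_all add: homogeneous_def)
  then show "d i = v * w * d j" by simp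
qed (use S T in \<open>auto simp: homogeneous_def\<close>)

lemma homogeneous_adj:
  assumes "homogeneous w T"
  shows "homogeneous (inverse w) (adj T)"
  unfolding homogeneous_def
proof (intro conjI allI impI)
  fix i j assume "cinner (e i) (adj T (e j)) \<noteq> 0"
  then have "cinner (e j) (T (e i)) \<noteq> 0"
    using assms by (subst cinner_commute) (simp add: cinner_adj_right homogeneous_def)
  then show "d i = inverse w * d j"
    using assms by (auto simp: homogeneous_def)
qed (use assms in \<open>auto simp: homogeneous_def\<close>)

lemma \<sigma>_homogeneous:
  assumes "homogeneous w T"
  shows "\<sigma> t T = cis (t * ln w) *\<^sub>C T"
proof (rule entries_eqI)
  have T: "T \<in> BH" and w: "0 < w" using assms by (auto simp: homogeneous_def)
  show "\<sigma> t T \<in> BH" "cis (t * ln w) *\<^sub>C T \<in> BH" using T by auto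
  fix i j
  have "ln (d i) - ln (d j) = ln w" if "cinner (e i) (T (e j)) \<noteq> 0"
    using assms that w d_pos[of j] by (simp add: homogeneous_def ln_mult)
  then show "cinner (e i) (\<sigma> t T (e j)) = cinner (e i) ((cis (t * ln w) *\<^sub>C T) (e j))"
    by (cases "cinner (e i) (T (e j)) = 0") (simp_all add: entries_\<sigma>[OF T] cinner_scaleC_right)
qed

text \<open>The scalar is \<open>w\<close> to the power \<open>\<i> z\<close>. At
  \<open>z = \<i>\<close> it is \<open>inverse w\<close>, the factor by which K^(-1) T K differs
  from \<open>T\<close>.\<close>

lemma entire_extension_homogeneous:
  assumes "homogeneous w T"
  shows "entire_extension BH \<sigma> T (\<lambda>z. exp (\<i> * of_real (ln w) * z) *\<^sub>C T)"
  unfolding entire_extension_def \<sigma>_homogeneous[OF assms]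
proof (intro conjI allI op_entire_exp)
  show "range (\<lambda>z. exp (\<i> * of_real (ln w) * z) *\<^sub>C T) \<subseteq> BH"
    using assms by (auto simp: homogeneous_def)
  show "exp (\<i> * of_real (ln w) * of_real t) *\<^sub>C T = cis (t * ln w) *\<^sub>C T" for t
    by (simp add: cis_conv_exp mult_ac)
qed

lemma entire_extension_add:
  assumes "entire_extension BH \<sigma> a f" "entire_extension BH \<sigma> b g"
  shows "entire_extension BH \<sigma> (a + b) (\<lambda>z. f z + g z)"
  using assms by (auto simp: entire_extension_def op_entire_add \<sigma>_add image_subset_iff)

lemma fixed_point_homogeneous:
  assumes "homogeneous 1 T"
  shows "T \<in> fixed_point_algebra BH \<sigma>"
  using assms \<sigma>_homogeneous[OF assms] by (auto simp: fixed_point_algebra_def homogeneous_def)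

end


section \<open>Normal forms in the Podles algebra\<close>

locale podles =
  fixes q s :: real
  assumes q_pos: "0 < q" and q_less_1: "q < 1" and s_pos: "0 < s" and s_le_1: "s \<le> 1"
begin

abbreviation cl :: "expr \<Rightarrow> expr set" where
  "cl \<equiv> podles_class q s"

lemma cl_eq_iff: "cl x = cl y \<longleftrightarrow> podles_eq q s x y"
  unfolding podles_class_def
  using podles_eq.refl podles_eq.sym podles_eq.trans by blast

lemmas cl_eqI = cl_eq_iff[THEN iffD2]

definition rep :: "expr set \<Rightarrow> expr" where
  "rep X = (SOME x. x \<in> X)"

lemma rep_cl: "podles_eq q s (rep (cl x)) x"
proof -
  have "x \<in> cl x" by (simp add: podles_class_def podles_eq.refl)
  then have "rep (cl x) \<in> cl x" unfolding rep_def by (rule someI)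
  then show ?thesis by (auto simp: podles_class_def intro: podles_eq.sym)
qed

text \<open>Choosing representatives makes the operations on classes total, so that all laws except those
  for the units hold without restriction to classes.\<close>

definition padd :: "expr set \<Rightarrow> expr set \<Rightarrow> expr set" (infixl "\<oplus>" 65) where
  "X \<oplus> Y = cl (Add (rep X) (rep Y))"

definition pmul :: "expr set \<Rightarrow> expr set \<Rightarrow> expr set" (infixl "\<otimes>" 70) where
  "X \<otimes> Y = cl (Mul (rep X) (rep Y))"

definition pscale :: "complex \<Rightarrow> expr set \<Rightarrow> expr set" (infixr "\<odot>" 75) where
  "c \<odot> X = cl (Scale c (rep X))"

definition pstar :: "expr set \<Rightarrow> expr set" where
  "pstar X = cl (Star (rep X))"

lemma cl_rep [simp]:
  "cl (Add (rep (cl x)) y) = cl (Add x y)" "cl (Add y (rep (cl x))) = cl (Add y x)"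
  "cl (Mul (rep (cl x)) y) = cl (Mul x y)" "cl (Mul y (rep (cl x))) = cl (Mul y x)"
  "cl (Scale c (rep (cl x))) = cl (Scale c x)" "cl (Star (rep (cl x))) = cl (Star x)"
  by (intro cl_eqI podles_eq.cong_add podles_eq.cong_mul podles_eq.cong_scale podles_eq.cong_star
      rep_cl podles_eq.refl)+

lemma cl_push:
  "cl (Add x y) = cl x \<oplus> cl y" "cl (Mul x y) = cl x \<otimes> cl y" "cl (Scale c x) = c \<odot> cl x"
  "cl (Star x) = pstar (cl x)"
  by (simp_all add: padd_def pmul_def pscale_def pstar_def)

lemma padd_assoc: "(X \<oplus> Y) \<oplus> Z = X \<oplus> (Y \<oplus> Z)"
  and padd_commute: "X \<oplus> Y = Y \<oplus> X"
  and pmul_assoc: "(X \<otimes> Y) \<otimes> Z = X \<otimes> (Y \<otimes> Z)"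
  and pscale_pscale: "c \<odot> d \<odot> X = (c * d) \<odot> X"
  and pscale_padd: "c \<odot> (X \<oplus> Y) = c \<odot> X \<oplus> c \<odot> Y"
  and pscale_add: "(c + d) \<odot> X = c \<odot> X \<oplus> d \<odot> X"
  and pmul_padd_left: "(X \<oplus> Y) \<otimes> Z = X \<otimes> Z \<oplus> Y \<otimes> Z"
  and pmul_padd_right: "X \<otimes> (Y \<oplus> Z) = X \<otimes> Y \<oplus> X \<otimes> Z"
  and pmul_pscale_left: "(c \<odot> X) \<otimes> Y = c \<odot> (X \<otimes> Y)"
  and pmul_pscale_right: "X \<otimes> (c \<odot> Y) = c \<odot> (X \<otimes> Y)"
  and pstar_padd: "pstar (X \<oplus> Y) = pstar X \<oplus> pstar Y"
  and pstar_pmul: "pstar (X \<otimes> Y) = pstar Y \<otimes> pstar X"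
  and pstar_pscale: "pstar (c \<odot> X) = cnj c \<odot> pstar X"
  unfolding padd_def pmul_def pscale_def pstar_def cl_rep
  by (intro cl_eqI podles_eq.add_assoc podles_eq.add_commute podles_eq.mul_assoc
      podles_eq.scale_scale podles_eq.scale_add_right podles_eq.scale_add_left
      podles_eq.mul_add_left podles_eq.mul_add_right podles_eq.mul_scale_left
      podles_eq.mul_scale_right podles_eq.star_add podles_eq.star_mul podles_eq.star_scale)+

lemma padd_left_commute: "X \<oplus> (Y \<oplus> Z) = Y \<oplus> (X \<oplus> Z)"
  using padd_assoc padd_commute by metis

lemmas padd_ac = padd_assoc padd_commute padd_left_commute

lemma cl_units:
  "cl x \<oplus> cl Zero = cl x" "1 \<odot> cl x = cl x" "cl One \<otimes> cl x = cl x" "cl x \<otimes> cl One = cl x"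
  "cl x \<oplus> (-1) \<odot> cl x = cl Zero" "pstar (pstar (cl x)) = cl x"
  unfolding cl_push[symmetric]
  by (intro cl_eqI podles_eq.add_zero podles_eq.scale_one podles_eq.mul_one_left
      podles_eq.mul_one_right podles_eq.add_neg podles_eq.star_star)+

lemma pstar_A: "pstar (cl GenA) = cl GenA"
  unfolding cl_push[symmetric] by (intro cl_eqI podles_eq.A_selfadjoint)

text \<open>No axiom of the congruence concerns the scalar 0; the sum
  \<open>cl x \<oplus> 0 \<odot> cl x\<close> equals \<open>cl x\<close>, from which
  \<open>cl x\<close> is cancelled.\<close>

lemma pscale_0: "0 \<odot> cl x = cl Zero"
proof -
  have "cl x \<oplus> 0 \<odot> cl x = (1 + 0) \<odot> cl x"
    unfolding pscale_add cl_units ..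
  then have "cl x \<oplus> 0 \<odot> cl x = cl x" by (simp add: cl_units)
  then have "(cl x \<oplus> 0 \<odot> cl x) \<oplus> (-1) \<odot> cl x = cl Zero" by (simp add: cl_units)
  then have "cl (Scale 0 x) \<oplus> (cl x \<oplus> (-1) \<odot> cl x) = cl Zero" by (simp add: padd_ac cl_push)
  then show ?thesis unfolding cl_units by (simp add: cl_push)
qed

lemma pscale_Zero: "c \<odot> cl Zero = cl Zero"
proof -
  have "c \<odot> 0 \<odot> cl Zero = cl Zero" unfolding pscale_pscale by (simp add: pscale_0)
  then show ?thesis by (simp add: pscale_0)
qed

lemma pmul_Zero: "cl x \<otimes> cl Zero = cl Zero" "cl Zero \<otimes> cl x = cl Zero"
proof -
  have "cl x \<otimes> 0 \<odot> cl Zero = 0 \<odot> cl (Mul x Zero)" "(0 \<odot> cl Zero) \<otimes> cl x = 0 \<odot> cl (Mul Zero x)"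
    by (simp_all only: cl_push pmul_pscale_left pmul_pscale_right)
  then show "cl x \<otimes> cl Zero = cl Zero" "cl Zero \<otimes> cl x = cl Zero"
    by (simp_all only: pscale_0)
qed

lemma pstar_Zero: "pstar (cl Zero) = cl Zero"
proof -
  have "pstar (0 \<odot> cl Zero) = 0 \<odot> cl (Star Zero)" by (simp add: pstar_pscale cl_push)
  then show ?thesis by (simp only: pscale_0)
qed

text \<open>Taking the star of \<open>pstar (cl One) \<otimes> cl One\<close> in two ways gives
  \<open>cl One\<close> on one side and \<open>pstar (cl One)\<close> on the other.\<close>

lemma pstar_One: "pstar (cl One) = cl One"
proof -
  have "pstar (pstar (cl One) \<otimes> cl One) = pstar (cl One) \<otimes> pstar (pstar (cl One))"
    by (rule pstar_pmul)
  moreover have "pstar (cl One) \<otimes> cl One = pstar (cl One)"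
    by (simp only: cl_push(4)[symmetric] cl_units)
  ultimately show ?thesis by (simp add: cl_units)
qed

lemmas cl_zero = pscale_0 pscale_Zero pmul_Zero pstar_Zero pstar_One pstar_A

text \<open>The values of the operations are classes even for arbitrary arguments \<open>X\<close>
  and \<open>Y\<close>, so the unit laws hold for them in a form usable for rewriting.\<close>

lemma cl_units':
  "cl Zero \<oplus> cl x = cl x"
  "(X \<oplus> Y) \<oplus> cl Zero = X \<oplus> Y" "(X \<otimes> Y) \<oplus> cl Zero = X \<otimes> Y" "(c \<odot> X) \<oplus> cl Zero = c \<odot> X"
  "cl Zero \<oplus> (X \<oplus> Y) = X \<oplus> Y" "cl Zero \<oplus> (X \<otimes> Y) = X \<otimes> Y" "cl Zero \<oplus> (c \<odot> X) = c \<odot> X"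
  "1 \<odot> (X \<otimes> Y) = X \<otimes> Y" "X \<otimes> cl Zero = cl Zero" "cl Zero \<otimes> X = cl Zero"
  "0 \<odot> X = cl Zero" "cl One \<otimes> pstar X = pstar X" "pstar X \<otimes> cl One = pstar X"
proof -
  have *: "X \<oplus> Y = cl (Add (rep X) (rep Y))" "X \<otimes> Y = cl (Mul (rep X) (rep Y))"
    "c \<odot> X = cl (Scale c (rep X))" "pstar X = cl (Star (rep X))"
    by (simp_all add: padd_def pmul_def pscale_def pstar_def)
  show "cl Zero \<oplus> cl x = cl x" by (simp only: padd_commute[of "cl Zero"] cl_units)
  show "(X \<oplus> Y) \<oplus> cl Zero = X \<oplus> Y" "(X \<otimes> Y) \<oplus> cl Zero = X \<otimes> Y" "(c \<odot> X) \<oplus> cl Zero = c \<odot> X"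
    "cl Zero \<oplus> (X \<oplus> Y) = X \<oplus> Y" "cl Zero \<oplus> (X \<otimes> Y) = X \<otimes> Y" "cl Zero \<oplus> (c \<odot> X) = c \<odot> X"
    "1 \<odot> (X \<otimes> Y) = X \<otimes> Y" "cl One \<otimes> pstar X = pstar X" "pstar X \<otimes> cl One = pstar X"
    by (simp_all only: * padd_commute[of "cl Zero"] cl_units)
  show "X \<otimes> cl Zero = cl Zero" "cl Zero \<otimes> X = cl Zero" "0 \<odot> X = cl Zero"
    using pmul_Zero[of "rep X"] pscale_0[of "rep X"] by (simp_all add: pmul_def pscale_def)
qed

abbreviation "\<A> \<equiv> cl GenA"
abbreviation "\<B> \<equiv> cl GenB"
abbreviation "\<B>s \<equiv> pstar \<B>"

lemma B_A: "\<B> \<otimes> \<A> = of_real (q\<^sup>2) \<odot> (\<A> \<otimes> \<B>)"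
proof -
  have "\<A> \<otimes> \<B> = of_real (inverse (q\<^sup>2)) \<odot> (\<B> \<otimes> \<A>)"
    using cl_eqI[OF podles_eq.relation_AB] by (simp only: cl_push)
  then have "of_real (q\<^sup>2) \<odot> (\<A> \<otimes> \<B>) = 1 \<odot> (\<B> \<otimes> \<A>)"
    using q_pos by (simp only: pscale_pscale of_real_mult[symmetric]) simp
  then show ?thesis by (simp only: cl_units')
qed

lemma Bs_A: "\<B>s \<otimes> \<A> = of_real (inverse (q\<^sup>2)) \<odot> (\<A> \<otimes> \<B>s)"
proof -
  have "\<A> \<otimes> \<B> = of_real (inverse (q\<^sup>2)) \<odot> (\<B> \<otimes> \<A>)"
    using cl_eqI[OF podles_eq.relation_AB] by (simp only: cl_push)
  then have "pstar (\<A> \<otimes> \<B>) = pstar (of_real (inverse (q\<^sup>2)) \<odot> (\<B> \<otimes> \<A>))" by simp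
  then show ?thesis by (simp add: pstar_pmul pstar_pscale pstar_A)
qed


subsection \<open>Polynomials in the first generator\<close>

definition P :: "complex poly \<Rightarrow> expr" where
  "P p = fold_coeffs (\<lambda>a x. Add (Scale a One) (Mul GenA x)) p Zero"

abbreviation "\<P> p \<equiv> cl (P p)"

lemma P_0 [simp]: "P 0 = Zero"
  by (simp add: P_def)

lemma P_pCons: "\<P> (pCons a p) = a \<odot> cl One \<oplus> \<A> \<otimes> \<P> p"
proof (cases "p = 0 \<and> a = 0")
  case True
  then show ?thesis by (simp add: cl_zero cl_units)
next
  case False
  then have "P (pCons a p) = Add (Scale a One) (Mul GenA (P p))"
    by (cases "p = 0") (auto simp: P_def)
  then show ?thesis by (simp add: cl_push)
qed

lemma P_add: "\<P> (p + r) = \<P> p \<oplus> \<P> r"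
proof (induction p r rule: poly_induct2)
  case (pCons a p b r)
  then show ?case
    by (simp add: P_pCons pscale_add pmul_padd_right padd_ac)
qed (simp add: cl_units)

lemma P_smult: "\<P> (smult c p) = c \<odot> \<P> p"
proof (induction p)
  case (pCons a p)
  then show ?case
    by (simp add: P_pCons pscale_padd pscale_pscale pmul_pscale_right)
qed (simp add: cl_zero)

lemma P_mult: "\<P> (p * r) = \<P> p \<otimes> \<P> r"
proof (induction p)
  case (pCons a p)
  have "\<P> (pCons 0 (p * r)) = \<A> \<otimes> (\<P> p \<otimes> \<P> r)"
    by (simp only: P_pCons pCons.IH cl_units')
  then show ?case
    by (simp only: mult_pCons_left P_add P_smult P_pCons pmul_padd_left pmul_pscale_left cl_units pmul_assoc)
qed (simp add: cl_zero)

lemma P_const: "\<P> [:a:] = a \<odot> cl One"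
  by (simp only: P_pCons P_0 cl_units')

lemma P_one: "\<P> 1 = cl One"
  unfolding one_pCons P_const by (simp only: cl_units)

lemma P_X: "\<P> [:0, c:] = c \<odot> \<A>"
  by (simp only: P_pCons P_0 pmul_pscale_right cl_units cl_units')

text \<open>Moving \<open>G\<close> past \<open>\<A>\<close> costs the factor \<open>c\<close>, so
  moving it past a polynomial in \<open>\<A>\<close> rescales the argument by \<open>c\<close>. This
  serves for \<open>\<B>\<close> and \<open>\<B>s\<close>.\<close>

lemma P_shift:
  assumes "G \<otimes> \<A> = c \<odot> (\<A> \<otimes> G)" "G = cl g"
  shows "G \<otimes> \<P> p = \<P> (p \<circ>\<^sub>p [:0, c:]) \<otimes> G"
proof (induction p)
  case (pCons a p)
  have "G \<otimes> \<P> (pCons a p) = a \<odot> G \<oplus> (G \<otimes> \<A>) \<otimes> \<P> p"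
    by (simp only: P_pCons pmul_padd_right pmul_pscale_right assms(2) cl_units pmul_assoc)
  also have "\<dots> = a \<odot> G \<oplus> c \<odot> (\<A> \<otimes> (\<P> (p \<circ>\<^sub>p [:0, c:]) \<otimes> G))"
    by (simp only: assms(1) pmul_pscale_left pmul_assoc pCons.IH)
  also have "\<dots> = \<P> (pCons a p \<circ>\<^sub>p [:0, c:]) \<otimes> G"
    by (simp only: pcompose_pCons P_add P_mult P_const P_X pmul_padd_left pmul_pscale_left
        pmul_assoc assms(2) cl_units)
  finally show ?case .
qed (simp add: assms(2) cl_zero)


subsection \<open>Sums of homogeneous monomials\<close>

primrec gpow :: "expr \<Rightarrow> nat \<Rightarrow> expr" where
  "gpow g 0 = One"
| "gpow g (Suc n) = Mul g (gpow g n)"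

definition Bp :: "int \<Rightarrow> expr" where
  "Bp m = (if 0 \<le> m then gpow GenB (nat m) else gpow (Star GenB) (nat (- m)))"

definition nf_term :: "int \<times> complex poly \<Rightarrow> expr" where
  "nf_term x = Mul (P (snd x)) (Bp (fst x))"

lemma cl_nf_term: "cl (nf_term (m, p)) = \<P> p \<otimes> cl (Bp m)"
  by (simp add: nf_term_def cl_push)

definition nf :: "(int \<times> complex poly) list \<Rightarrow> expr" where
  "nf xs = foldr (\<lambda>x. Add (nf_term x)) xs Zero"

lemma nf_simps [simp]: "nf [] = Zero" "nf (x # xs) = Add (nf_term x) (nf xs)"
  by (simp_all add: nf_def)

lemma nf_append: "cl (nf (xs @ ys)) = cl (nf xs) \<oplus> cl (nf ys)"
  by (induction xs) (simp_all add: cl_push(1) padd_assoc cl_units')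

lemma nf_map:
  assumes "F (cl Zero) = cl Zero" "\<And>X Y. F (X \<oplus> Y) = F X \<oplus> F Y"
    and "\<And>m p. \<exists>y. F (cl (nf_term (m, p))) = cl (nf_term y)"
  shows "\<exists>ys. F (cl (nf xs)) = cl (nf ys)"
proof (induction xs)
  case Nil
  show ?case using assms(1) by (intro exI[of _ "[]"]) simp
next
  case (Cons x xs)
  obtain ys y where "F (cl (nf xs)) = cl (nf ys)" "F (cl (nf_term x)) = cl (nf_term y)"
    using Cons.IH assms(3)[of "fst x" "snd x"] by auto
  then show ?case
    by (intro exI[of _ "y # ys"]) (simp add: cl_push(1) assms(2))
qed

lemma Bp_step:
  "0 \<le> m \<Longrightarrow> \<B> \<otimes> cl (Bp m) = cl (Bp (m + 1))"
  "m \<le> 0 \<Longrightarrow> \<B>s \<otimes> cl (Bp m) = cl (Bp (m - 1))"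
proof -
  assume "0 \<le> m"
  then have "nat (m + 1) = Suc (nat m)" by simp
  then show "\<B> \<otimes> cl (Bp m) = cl (Bp (m + 1))" using \<open>0 \<le> m\<close> by (simp add: Bp_def cl_push)
next
  assume m: "m \<le> 0"
  have "nat (1 - m) = Suc (nat (- m))" using m by simp
  then show "\<B>s \<otimes> cl (Bp m) = cl (Bp (m - 1))" using m by (cases "m = 0") (simp_all add: Bp_def cl_push)
qed

definition rel_BsB :: "complex poly" where
  "rel_BsB = - ([:-1, 1:] * [:of_real (s\<^sup>2), 1:])"

definition rel_BBs :: "complex poly" where
  "rel_BBs = - ([:-1, of_real (q\<^sup>2):] * [:of_real (s\<^sup>2), of_real (q\<^sup>2):])"

lemma eq_neg_of_padd: "cl x \<oplus> cl y = cl Zero \<Longrightarrow> cl x = (-1) \<odot> cl y"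
proof -
  assume "cl x \<oplus> cl y = cl Zero"
  then have "(cl x \<oplus> cl y) \<oplus> (-1) \<odot> cl y = cl Zero \<oplus> cl (Scale (-1) y)" by (simp add: cl_push)
  also have "\<dots> = (-1) \<odot> cl y" by (simp only: cl_units' cl_push)
  finally show ?thesis by (simp only: padd_assoc cl_units)
qed

lemma P_linear: "\<P> [:a, c:] = c \<odot> \<A> \<oplus> a \<odot> cl One"
  by (simp only: P_pCons[of a] P_const pmul_pscale_right cl_units padd_commute)

lemma Bs_B: "\<B>s \<otimes> \<B> = \<P> rel_BsB"
proof -
  have "cl (Mul (Star GenB) GenB) \<oplus> cl (Mul (Add GenA (Scale (-1) One)) (Add GenA (Scale (of_real (s\<^sup>2)) One))) = cl Zero"
    using cl_eqI[OF podles_eq.relation_BsB] by (simp only: cl_push)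
  from eq_neg_of_padd[OF this] have "\<B>s \<otimes> \<B> = (-1) \<odot> (\<P> [:-1, 1:] \<otimes> \<P> [:of_real (s\<^sup>2), 1:])"
    by (simp only: cl_push P_linear cl_units)
  then show ?thesis
    unfolding rel_BsB_def by (simp only: P_mult[symmetric] P_smult[symmetric]) simp
qed

lemma B_Bs: "\<B> \<otimes> \<B>s = \<P> rel_BBs"
proof -
  have "cl (Mul GenB (Star GenB)) \<oplus> cl (Mul (Add (Scale (of_real (q\<^sup>2)) GenA) (Scale (-1) One))
        (Add (Scale (of_real (q\<^sup>2)) GenA) (Scale (of_real (s\<^sup>2)) One))) = cl Zero"
    using cl_eqI[OF podles_eq.relation_BBs] by (simp only: cl_push)
  from eq_neg_of_padd[OF this]
  have "\<B> \<otimes> \<B>s = (-1) \<odot> (\<P> [:-1, of_real (q\<^sup>2):] \<otimes> \<P> [:of_real (s\<^sup>2), of_real (q\<^sup>2):])"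
    by (simp only: cl_push P_linear)
  then show ?thesis
    unfolding rel_BBs_def by (simp only: P_mult[symmetric] P_smult[symmetric]) simp
qed

text \<open>For negative \<open>m\<close> the new factor meets an adjoint of itself, and the
  defining relation turns the pair into the polynomial \<open>rel_BBs\<close>; otherwise the
  exponent just grows.\<close>

lemma B_Bp: "\<exists>r. \<B> \<otimes> cl (Bp m) = \<P> r \<otimes> cl (Bp (m + 1))"
proof (cases "0 \<le> m")
  case True
  then show ?thesis by (intro exI[of _ 1]) (simp only: Bp_step P_one cl_units)
next
  case False
  then have "cl (Bp m) = \<B>s \<otimes> cl (Bp (m + 1))" using Bp_step(2)[of "m + 1"] by simp
  then show ?thesis by (intro exI[of _ rel_BBs]) (simp only: pmul_assoc[symmetric] B_Bs)
qed

lemma Bs_Bp: "\<exists>r. \<B>s \<otimes> cl (Bp m) = \<P> r \<otimes> cl (Bp (m - 1))"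
proof (cases "m \<le> 0")
  case True
  then show ?thesis by (intro exI[of _ 1]) (simp only: Bp_step P_one cl_units)
next
  case False
  then have "cl (Bp m) = \<B> \<otimes> cl (Bp (m - 1))" using Bp_step(1)[of "m - 1"] by simp
  then show ?thesis by (intro exI[of _ rel_BsB]) (simp only: pmul_assoc[symmetric] Bs_B)
qed

lemma gen_nf_term:
  "\<exists>y. \<A> \<otimes> cl (nf_term (m, p)) = cl (nf_term y)"
  "\<exists>y. \<B> \<otimes> cl (nf_term (m, p)) = cl (nf_term y)"
  "\<exists>y. \<B>s \<otimes> cl (nf_term (m, p)) = cl (nf_term y)"
proof -
  show "\<exists>y. \<A> \<otimes> cl (nf_term (m, p)) = cl (nf_term y)"
    by (rule exI[of _ "(m, [:0, 1:] * p)"])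
      (simp only: cl_nf_term P_mult P_X cl_units pmul_assoc)
  obtain r where r: "\<B> \<otimes> cl (Bp m) = \<P> r \<otimes> cl (Bp (m + 1))" using B_Bp by blast
  show "\<exists>y. \<B> \<otimes> cl (nf_term (m, p)) = cl (nf_term y)"
    by (rule exI[of _ "(m + 1, (p \<circ>\<^sub>p [:0, of_real (q\<^sup>2):]) * r)"])
      (simp only: cl_nf_term P_mult pmul_assoc r[symmetric], simp only: pmul_assoc[symmetric] P_shift[OF B_A HOL.refl])
  obtain r where r: "\<B>s \<otimes> cl (Bp m) = \<P> r \<otimes> cl (Bp (m - 1))" using Bs_Bp by blast
  have Bs: "\<B>s = cl (Star GenB)" by (simp add: cl_push)
  show "\<exists>y. \<B>s \<otimes> cl (nf_term (m, p)) = cl (nf_term y)"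
    by (rule exI[of _ "(m - 1, (p \<circ>\<^sub>p [:0, of_real (inverse (q\<^sup>2)):]) * r)"])
      (simp only: cl_nf_term P_mult pmul_assoc r[symmetric], simp only: pmul_assoc[symmetric] P_shift[OF Bs_A Bs])
qed

text \<open>Left multiplication by each generator preserves normal forms, hence so does every
  expression. Including \<open>pstar\<close> in the induction makes the case \<open>Star\<close> a
  mere exchange of the two claims, and no rule for the product or the star of normal forms is
  required.\<close>

lemma mul_nf:
  "\<exists>ys. cl x \<otimes> cl (nf xs) = cl (nf ys)" (is "?L x xs")
  "\<exists>ys. pstar (cl x) \<otimes> cl (nf xs) = cl (nf ys)" (is "?R x xs")
proof -
  have gen: "\<exists>ys. cl g \<otimes> cl (nf xs) = cl (nf ys)"
    if "\<And>m p. \<exists>y. cl g \<otimes> cl (nf_term (m, p)) = cl (nf_term y)" for g xs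
    by (rule nf_map[where F = "\<lambda>X. cl g \<otimes> X"]) (simp_all only: cl_zero pmul_padd_right that)
  have scale: "\<exists>ys. c \<odot> cl (nf xs) = cl (nf ys)" for c xs
  proof (rule nf_map[where F = "\<lambda>X. c \<odot> X"])
    show "\<exists>y. c \<odot> cl (nf_term (m, p)) = cl (nf_term y)" for m p
      by (rule exI[of _ "(m, smult c p)"]) (simp add: cl_nf_term P_smult pmul_pscale_left)
  qed (simp_all add: cl_zero pscale_padd)
  have "(\<forall>xs. ?L x xs) \<and> (\<forall>xs. ?R x xs)"
  proof (induction x)
    case GenA
    show ?case using gen[of GenA, OF gen_nf_term(1)] by (simp add: pstar_A)
  next
    case GenB
    show ?case using gen[of GenB, OF gen_nf_term(2)] gen[of "Star GenB"] gen_nf_term(3) by (simp add: cl_push(4))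
  next
    case One
    show ?case by (auto simp: cl_units pstar_One)
  next
    case Zero
    show ?case by (auto simp: cl_zero intro!: exI[of _ "[]"])
  next
    case (Add x y)
    then show ?case by (simp only: cl_push pstar_padd pmul_padd_left) (metis nf_append)
  next
    case (Mul x y)
    then show ?case by (simp only: cl_push pstar_pmul pmul_assoc) metis
  next
    case (Scale c x)
    then show ?case by (simp only: cl_push pstar_pscale pmul_pscale_left) (metis scale)
  next
    case (Star x)
    then show ?case by (simp only: cl_push cl_units) metis
  qed
  then show "?L x xs" "?R x xs" by blast+
qed

theorem ex_nf: "\<exists>xs. cl x = cl (nf xs)"
proof -
  have "cl (nf [(0, 1)]) = cl One"
    by (simp only: nf_simps cl_push(1) cl_nf_term P_one cl_units) (simp add: Bp_def)
  then show ?thesis using mul_nf(1)[of x "[(0, 1)]"] by (simp add: cl_units)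
qed

text \<open>The list of a normal form may repeat exponents, so the terms of exponent
  \<open>m\<close> have to be collected.\<close>

definition nf_coeff :: "(int \<times> complex poly) list \<Rightarrow> int \<Rightarrow> complex poly" where
  "nf_coeff xs m = (\<Sum>x\<leftarrow>xs. if fst x = m then snd x else 0)"

lemma nf_extract:
  "cl (nf xs) = cl (nf_term (m, nf_coeff xs m)) \<oplus> cl (nf (filter (\<lambda>x. fst x \<noteq> m) xs))"
proof (induction xs)
  case Nil
  have "cl (nf_term (m, nf_coeff [] m)) = cl Zero"
    by (simp only: cl_nf_term nf_coeff_def) (simp add: cl_zero)
  then show ?case by (simp add: cl_units)
next
  case (Cons x xs)
  obtain m' p where x: "x = (m', p)" by fastforce
  show ?case
  proof (cases "m' = m")
    case True
    have "cl (nf_term (m, nf_coeff (x # xs) m)) = cl (nf_term x) \<oplus> cl (nf_term (m, nf_coeff xs m))"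
      using True by (simp add: x nf_coeff_def cl_nf_term P_add pmul_padd_left)
    then show ?thesis using True by (simp add: x cl_push(1) Cons.IH padd_assoc)
  next
    case False
    then have "nf_coeff (x # xs) m = nf_coeff xs m" by (simp add: x nf_coeff_def)
    then show ?thesis using False by (simp add: x cl_push(1) Cons.IH padd_ac)
  qed
qed

text \<open>All terms with the exponent of the head combine into one vanishing term. Removing them
  shortens the list and leaves the other coefficients unchanged.\<close>

lemma nf_eq_Zero: "(\<And>m. nf_coeff xs m = 0) \<Longrightarrow> cl (nf xs) = cl Zero"
proof (induction "length xs" arbitrary: xs rule: less_induct)
  case less
  show ?case
  proof (cases xs)
    case (Cons x ys)
    let ?zs = "filter (\<lambda>y. fst y \<noteq> fst x) xs"
    have coeff: "nf_coeff ?zs m = (if m = fst x then 0 else nf_coeff xs m)" for m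
      unfolding nf_coeff_def by (induction xs) auto
    have "length ?zs < length xs" unfolding Cons by (simp add: le_imp_less_Suc)
    then have "cl (nf ?zs) = cl Zero" by (rule less.hyps) (simp add: coeff less.prems)
    moreover have "cl (nf_term (fst x, nf_coeff xs (fst x))) = cl Zero"
      by (simp only: less.prems cl_nf_term P_0 cl_zero)
    ultimately show ?thesis by (simp only: nf_extract[of xs "fst x"] cl_units)
  qed simp
qed

end


section \<open>Weighted shifts on square-summable sequences\<close>

lemma cinner_ket: "cinner (ket n) x = coord x n"
proof -
  have "(\<lambda>k. cnj (coord (ket n) k) * coord x k) sums (cnj (coord (ket n) n) * coord x n)"
    using sums_single[of n "\<lambda>k. cnj (coord (ket n) k) * coord x k"]
    by (rule sums_cong[THEN iffD1, rotated]) simp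
  then show ?thesis by (simp add: cinner_ell2_def ell2_cinner_def sums_iff)
qed

lemma cinner_ket_right: "cinner x (ket n) = cnj (coord x n)"
  by (subst cinner_commute) (simp add: cinner_ket)

lemma ell2_parseval: "((\<lambda>n. cnj (coord x n) * coord y n) has_sum cinner x y) UNIV"
proof (rule norm_summable_imp_has_sum)
  show "summable (\<lambda>n. norm (cnj (coord x n) * coord y n))"
  proof (rule summable_comparison_test')
    show "summable (\<lambda>n. (cmod (coord x n))\<^sup>2 + (cmod (coord y n))\<^sup>2)"
      using square_summable_coord by (intro summable_add) (auto simp: square_summable_def)
    fix n
    have "cmod (coord x n) * cmod (coord y n) \<le> (cmod (coord x n))\<^sup>2 + (cmod (coord y n))\<^sup>2"
      using zero_le_power2[of "cmod (coord x n) - cmod (coord y n)"]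
        mult_nonneg_nonneg[OF norm_ge_zero norm_ge_zero, of "coord x n" "coord y n"]
      unfolding power2_diff by linarith
    then show "norm (norm (cnj (coord x n) * coord y n)) \<le> (cmod (coord x n))\<^sup>2 + (cmod (coord y n))\<^sup>2"
      by (simp add: norm_mult abs_mult)
  qed
  show "(\<lambda>n. cnj (coord x n) * coord y n) sums cinner x y"
    unfolding cinner_ell2_def ell2_cinner_def by (rule summable_sums[OF summable_cinner_coord])
qed

text \<open>One family for the diagonal operators (\<open>j = 0\<close>) and the lowering operators
  (\<open>j = 1\<close>). The weight is indexed by the target coordinate.\<close>

definition wshift :: "nat \<Rightarrow> (nat \<Rightarrow> complex) \<Rightarrow> ell2 op" where
  "wshift j c = Blinfun (\<lambda>x. Abs_ell2 (\<lambda>n. c n * coord x (n + j)))"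

lemma coord_wshift:
  assumes "bounded (range c)"
  shows "coord (wshift j c x) n = c n * coord x (n + j)"
proof -
  obtain M where M: "\<And>n. cmod (c n) \<le> M" using assms by (auto simp: bounded_iff)
  then have "0 \<le> M" using norm_ge_zero order_trans by blast
  have sum_le: "(\<Sum>n<k. (cmod (c n * coord x (n + j)))\<^sup>2) \<le> (M * norm x)\<^sup>2" for x k
  proof -
    have "(\<Sum>n<k. (cmod (c n * coord x (n + j)))\<^sup>2) \<le> (\<Sum>n<k. M\<^sup>2 * (cmod (coord x (n + j)))\<^sup>2)"
      unfolding norm_mult power_mult_distrib
      by (intro sum_mono mult_right_mono power_mono M) auto
    also have "\<dots> = M\<^sup>2 * (\<Sum>n=0 + j..<k + j. (cmod (coord x n))\<^sup>2)"
      by (simp only: sum.shift_bounds_nat_ivl sum_distrib_left atLeast0LessThan)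
    also have "\<dots> \<le> M\<^sup>2 * (\<Sum>n<k + j. (cmod (coord x n))\<^sup>2)"
      by (intro mult_left_mono sum_mono2) auto
    also have "\<dots> \<le> M\<^sup>2 * (norm x)\<^sup>2"
      by (intro mult_left_mono sum_coord_le_norm) simp
    finally show ?thesis by (simp add: power_mult_distrib)
  qed
  have "square_summable (\<lambda>n. c n * coord x (n + j))" for x
    unfolding square_summable_def
    by (rule summableI_nonneg_bounded[OF _ sum_le]) simp
  moreover define T where "T x = Abs_ell2 (\<lambda>n. c n * coord x (n + j))" for x
  ultimately have coord: "coord (T x) = (\<lambda>n. c n * coord x (n + j))" for x
    by (simp add: Abs_ell2_inverse)
  have "bounded_linear T"
  proof (rule bounded_linear_intro)
    show "norm (T x) \<le> norm x * M" for x
    proof -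
      have "(norm (T x))\<^sup>2 \<le> (M * norm x)\<^sup>2"
        unfolding norm_ell2_power2 coord
      proof (rule suminf_le_const[OF _ sum_le])
        show "summable (\<lambda>n. (cmod (c n * coord x (n + j)))\<^sup>2)"
          by (rule summableI_nonneg_bounded[OF _ sum_le]) simp
      qed
      then show ?thesis using \<open>0 \<le> M\<close> by (simp add: power2_le_iff_abs_le mult.commute)
    qed
  qed (auto intro!: ell2_eqI simp: coord algebra_simps)
  then show ?thesis by (simp add: wshift_def bounded_linear_Blinfun_apply coord flip: T_def)
qed

lemma wshift_BH: "bounded (range c) \<Longrightarrow> wshift j c \<in> BH"
  by (auto simp: BH_def coord_wshift intro!: ell2_eqI)

lemma coord_adj_wshift:
  assumes "bounded (range c)"
  shows "coord (adj (wshift 1 c) x) n = (if n = 0 then 0 else cnj (c (n - 1)) * coord x (n - 1))"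
proof -
  have "wshift 1 c (ket n) = (if n = 0 then 0 else c (n - 1) *\<^sub>C ket (n - 1))"
    by (rule ell2_eqI) (auto simp: coord_wshift[OF assms])
  then have "cinner (wshift 1 c (ket n)) x = (if n = 0 then 0 else cnj (c (n - 1)) * coord x (n - 1))"
    by (simp add: cinner.zero_left cinner_scaleC_left cinner_ket)
  then show ?thesis by (simp flip: cinner_ket add: cinner_adj_right wshift_BH[OF assms])
qed

text \<open>The values on the kets are the coordinates of \<open>adj S (ket n)\<close> up to
  conjugation, and these vectors determine all coordinates of \<open>S x\<close>. No density of
  finite sequences is involved.\<close>

lemma op_on_basis_eq:
  assumes "T \<in> BH" "\<And>k. blinfun_apply T (ket k) = v k"
  shows "op_on_basis v = T"
  unfolding op_on_basis_def
proof (rule the_equality)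
  fix S :: "ell2 op" assume S: "S \<in> BH \<and> (\<forall>k. S (ket k) = v k)"
  have "adj S (ket n) = adj T (ket n)" for n
    using S assms by (intro ell2_eqI) (simp flip: cinner_ket add: cinner_adj_right)
  then have "coord (S x) n = coord (T x) n" for x n
    using S assms(1) by (simp flip: cinner_ket cinner_adj_left)
  then show "S = T" by (intro blinfun_eqI ell2_eqI)
qed (use assms in blast)


section \<open>Operators on the direct sum\<close>

lemma direct_sum_op_BH: "S \<in> BH \<Longrightarrow> T \<in> BH \<Longrightarrow> direct_sum_op S T \<in> BH"
  by (simp add: BH_def scaleC_prod_def)

lemma adj_direct_sum_op:
  assumes "S \<in> BH" "T \<in> BH"
  shows "adj (direct_sum_op S T) = direct_sum_op (adj S) (adj T)"
  using assms by (intro adj_unique direct_sum_op_BH) (auto simp: cinner_prod_def cinner_adj_left)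

lemma F_op_BH [simp]: "F_op \<in> BH"
  by (simp add: BH_def scaleC_prod_def)

lemma gamma_op_BH [simp]: "gamma_op \<in> BH"
  by (simp add: BH_def scaleC_prod_def scaleC.minus_right)

lemma adj_F_op: "adj F_op = F_op"
  by (rule adj_unique) (simp_all add: cinner_prod_def)

lemma adj_gamma_op: "adj gamma_op = gamma_op"
  by (rule adj_unique) (simp_all add: cinner_prod_def cinner.minus_left cinner.minus_right)

definition basis :: "nat + nat \<Rightarrow> hsum" where
  "basis = case_sum ket_plus ket_minus"

lemma basis_simps [simp]: "basis (Inl n) = (ket n, 0)" "basis (Inr n) = (0, ket n)"
  by (simp_all add: basis_def ket_plus_def ket_minus_def)

lemma cinner_basis:
  "cinner (basis i) x = (case i of Inl n \<Rightarrow> coord (fst x) n | Inr n \<Rightarrow> coord (snd x) n)"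
  by (cases i) (simp_all add: cinner_prod_def cinner_ket cinner.zero_left)

lemma UNIV_sum: "UNIV = range Inl \<union> range Inr"
  using UNIV_Plus_UNIV[symmetric] unfolding Plus_def .

lemma has_sum_sum_type:
  fixes f :: "'a + 'b \<Rightarrow> 'c::topological_comm_monoid_add"
  assumes "((\<lambda>n. f (Inl n)) has_sum S) UNIV" "((\<lambda>n. f (Inr n)) has_sum T) UNIV"
  shows "(f has_sum S + T) UNIV"
proof -
  have "(f has_sum S) (range Inl)" "(f has_sum T) (range Inr)"
    using assms by (simp_all add: has_sum_reindex comp_def)
  then show ?thesis unfolding UNIV_sum by (rule has_sum_Un_disjoint) auto
qed

lemma direct_sum_parseval: "((\<lambda>i. cinner x (basis i) * cinner (basis i) y) has_sum cinner x y) UNIV"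
proof -
  have "cinner x y = cinner (fst x) (fst y) + cinner (snd x) (snd y)"
    by (simp add: cinner_prod_def)
  moreover have "((\<lambda>i. cinner x (basis i) * cinner (basis i) y) has_sum
      cinner (fst x) (fst y) + cinner (snd x) (snd y)) UNIV"
  proof (rule has_sum_sum_type)
    show "((\<lambda>n. cinner x (basis (Inl n)) * cinner (basis (Inl n)) y) has_sum cinner (fst x) (fst y)) UNIV"
      using ell2_parseval[of "fst x" "fst y"]
      by (simp add: cinner_prod_def cinner_ket cinner_ket_right cinner.zero_left cinner.zero_right)
    show "((\<lambda>n. cinner x (basis (Inr n)) * cinner (basis (Inr n)) y) has_sum cinner (snd x) (snd y)) UNIV"
      using ell2_parseval[of "snd x" "snd y"]
      by (simp add: cinner_prod_def cinner_ket cinner_ket_right cinner.zero_left cinner.zero_right)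
  qed
  ultimately show ?thesis by simp
qed

lemma K_coeff_eq:
  assumes "0 < q"
  shows "K_coeff q 1 n = inverse (q ^ (2 * n))" "K_coeff q (- 1) n = q ^ (2 * n)"
    "(K_coeff q (1/2) n)\<^sup>2 = K_coeff q 1 n"
proof -
  have "q powr (- 2 * real n) = inverse (q ^ (2 * n))"
    using assms powr_realpow[of q "2 * n"] by (simp add: powr_minus)
  then show "K_coeff q 1 n = inverse (q ^ (2 * n))" "K_coeff q (- 1) n = q ^ (2 * n)"
    using assms by (simp_all add: K_coeff_def powr_minus)
  show "(K_coeff q (1/2) n)\<^sup>2 = K_coeff q 1 n"
    using assms by (simp add: K_coeff_def power2_eq_square flip: powr_add)
qed

context podles
begin

definition kd :: "nat + nat \<Rightarrow> real" where
  "kd = case_sum (K_coeff q 1) (K_coeff q 1)"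

definition Kit :: "real \<Rightarrow> hsum op" where
  "Kit t = (let u = wshift 0 (\<lambda>n. cis (t * ln (K_coeff q 1 n))) in direct_sum_op u u)"

text \<open>The bounded inverse of \<open>K\<close>. Its range is the domain of \<open>K\<close>, so
  vectors in that domain can be parametrized by \<open>Kinv y\<close>.\<close>

definition Kinv :: "hsum op" where
  "Kinv = (let k = wshift 0 (\<lambda>n. of_real (K_coeff q (- 1) n)) in direct_sum_op k k)"

lemma q_power_le_1: "q ^ n \<le> 1"
  using q_pos q_less_1 by (simp add: power_le_one)

lemma bounded_cis: "bounded (range (\<lambda>n. cis (f n)))"
  by (auto simp: bounded_iff intro!: exI[of _ 1])

lemma bounded_K_inverse: "bounded (range (\<lambda>n. complex_of_real (K_coeff q (- 1) n)))"
  unfolding K_coeff_eq[OF q_pos] bounded_iff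
  using q_power_le_1 q_pos by (auto intro!: exI[of _ 1] simp: norm_power)

sublocale diagonal_weight basis kd Kit
proof
  show "cinner (basis i) (basis j) = (if i = j then 1 else 0)" for i j
    by (cases i; cases j) (auto simp: cinner_prod_def cinner_ket cinner.zero_left)
  show "((\<lambda>i. cinner x (basis i) * cinner (basis i) y) has_sum cinner x y) UNIV" for x y
    by (rule direct_sum_parseval)
  show "0 < kd i" for i
    using q_pos by (cases i) (simp_all add: kd_def K_coeff_eq)
  show "Kit t \<in> BH" for t
    by (simp add: Kit_def Let_def direct_sum_op_BH wshift_BH bounded_cis)
  show "Kit t (basis i) = cis (t * ln (kd i)) *\<^sub>C basis i" for t i
    by (cases i) (auto simp: Kit_def Let_def kd_def scaleC_prod_def coord_wshift[OF bounded_cis]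
        scaleC.zero_right blinfun.zero_right intro!: ell2_eqI)
qed

lemma Phi_eq_W: "Phi q = W"
proof
  fix S :: "hsum op"
  have diag: "diag_op c (ket k) = c k *\<^sub>R ket k" "diag_op c 0 = 0" for c k
  proof -
    have "(\<lambda>n. complex_of_real (c n) * coord (ket k) n) = coord (c k *\<^sub>R ket k)"
      by (auto simp: fun_eq_iff)
    then show "diag_op c (ket k) = c k *\<^sub>R ket k"
      by (simp only: diag_op_def coord_inverse)
    have "(\<lambda>n. complex_of_real (c n) * coord 0 n) = coord 0"
      by (auto simp: fun_eq_iff)
    then show "diag_op c 0 = 0"
      by (simp only: diag_op_def coord_inverse)
  qed
  have form: "K_form q S (basis i) = ennreal (kd i * inner (basis i) (S (basis i)))" for i
  proof -
    let ?h = "case_sum (K_coeff q (1/2)) (K_coeff q (1/2)) i"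
    have "Kpow q (1/2) (basis i) = ?h *\<^sub>R basis i"
      by (cases i) (simp_all add: Kpow_def diag)
    then have "K_form q S (basis i) = ennreal (?h\<^sup>2 * inner (basis i) (S (basis i)))"
      by (simp add: K_form_def blinfun.scaleR_right inner_eq_Re_cinner[symmetric] power2_eq_square mult.assoc)
    also have "?h\<^sup>2 = kd i"
      by (cases i) (simp_all only: kd_def sum.case K_coeff_eq(3)[OF q_pos])
    finally show ?thesis .
  qed
  have suminf: "(\<Sum>\<^sub>\<infinity>n. f n) = (\<Sum>n. f n)" for f :: "nat \<Rightarrow> ennreal"
    using has_sum_imp_sums[OF has_sum_infsum[OF nonneg_summable_on_complete[of UNIV f]]]
    by (simp add: sums_iff)
  have "(K_form q S \<circ> basis has_sum (\<Sum>\<^sub>\<infinity>n. K_form q S (ket_plus n)) + (\<Sum>\<^sub>\<infinity>n. K_form q S (ket_minus n))) UNIV"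
    by (rule has_sum_sum_type)
      (simp_all add: basis_def has_sum_infsum nonneg_summable_on_complete)
  then have "W S = (\<Sum>\<^sub>\<infinity>n. K_form q S (ket_plus n)) + (\<Sum>\<^sub>\<infinity>n. K_form q S (ket_minus n))"
    by (simp add: W_def comp_def form infsumI)
  then show "Phi q S = W S" by (simp add: Phi_def suminf)
qed


subsection \<open>Conjugation by the modular operator\<close>

lemma coord_Kinv:
  "coord (fst (Kinv x)) n = of_real (q ^ (2 * n)) * coord (fst x) n"
  "coord (snd (Kinv x)) n = of_real (q ^ (2 * n)) * coord (snd x) n"
  unfolding Kinv_def Let_def direct_sum_op_apply fst_conv snd_conv coord_wshift[OF bounded_K_inverse]
  by (simp_all add: K_coeff_eq[OF q_pos])

lemma Kinv_BH [simp]: "Kinv \<in> BH"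
  by (simp add: Kinv_def Let_def direct_sum_op_BH wshift_BH bounded_K_inverse)

lemma Kinv_basis: "Kinv (basis i) = of_real (inverse (kd i)) *\<^sub>C basis i"
  using q_pos by (cases i) (auto intro!: prod_eqI ell2_eqI
    simp: coord_Kinv scaleC_prod_def kd_def K_coeff_eq)

lemma Kinv_eqD: "Kinv x = Kinv y \<Longrightarrow> x = y"
proof (intro prod_eqI ell2_eqI)
  fix n assume "Kinv x = Kinv y"
  then have "coord (fst (Kinv x)) n = coord (fst (Kinv y)) n"
    "coord (snd (Kinv x)) n = coord (snd (Kinv y)) n" by simp_all
  then show "coord (fst x) n = coord (fst y) n" "coord (snd x) n = coord (snd y) n"
    using q_pos by (simp_all add: coord_Kinv)
qed

lemma K_dom_iff: "x \<in> Kpow_dom q 1 \<longleftrightarrow> (\<exists>y. x = Kinv y)"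
  and Kpow_Kinv: "Kpow q 1 (Kinv y) = y"
proof -
  have cancel: "complex_of_real (K_coeff q 1 n) * (of_real (q ^ (2 * n)) * z) = z" for n z
    using q_pos by (simp add: K_coeff_eq)
  show K: "Kpow q 1 (Kinv y) = y" for y
    unfolding Kpow_def diag_op_def coord_Kinv cancel by (simp add: coord_inverse)
  show "x \<in> Kpow_dom q 1 \<longleftrightarrow> (\<exists>y. x = Kinv y)"
  proof
    assume x: "x \<in> Kpow_dom q 1"
    have "coord (Abs_ell2 (\<lambda>k. of_real (K_coeff q 1 k) * coord z k)) n = of_real (K_coeff q 1 n) * coord z n"
      if "z \<in> diag_dom (K_coeff q 1)" for z n
      using that by (simp add: diag_dom_def Abs_ell2_inverse)
    then have "x = Kinv (Kpow q 1 x)"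
      using x q_pos by (auto intro!: prod_eqI ell2_eqI
          simp: coord_Kinv Kpow_def Kpow_dom_def diag_op_def K_coeff_eq(1))
    then show "\<exists>y. x = Kinv y" ..
  next
    assume "\<exists>y. x = Kinv y"
    then obtain y where "x = Kinv y" ..
    then show "x \<in> Kpow_dom q 1"
      unfolding Kpow_dom_def diag_dom_def mem_Times_iff mem_Collect_eq
      by (simp only: coord_Kinv cancel square_summable_coord)
  qed
qed

lemma Kpow_minus: "Kpow_dom q (- 1) = UNIV" "Kpow q (- 1) x = Kinv x"
proof -
  have sq: "square_summable (\<lambda>k. of_real (K_coeff q (- 1) k) * coord z k)" for z
    using square_summable_coord[of "wshift 0 (\<lambda>n. of_real (K_coeff q (- 1) n)) z"]
    unfolding coord_wshift[OF bounded_K_inverse, THEN ext] add_0_right .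
  then show "Kpow_dom q (- 1) = UNIV" by (auto simp: Kpow_dom_def diag_dom_def)
  have "coord (Abs_ell2 (\<lambda>k. of_real (K_coeff q (- 1) k) * coord z k)) n =
      of_real (K_coeff q (- 1) n) * coord z n" for z n
    using sq by (simp add: Abs_ell2_inverse)
  then show "Kpow q (- 1) x = Kinv x"
    by (intro prod_eqI ell2_eqI)
      (simp_all only: Kpow_def diag_op_def coord_Kinv fst_conv snd_conv K_coeff_eq(2)[OF q_pos])
qed

lemma op_eq_iff: "S = T \<longleftrightarrow> (\<forall>x. blinfun_apply S x = T x)"
  by (auto intro: blinfun_eqI)

text \<open>Substituting \<open>x = Kinv y\<close> removes the unbounded operator. For the
  intertwining relation that remains, compatibility with sums and products is pure algebra.\<close>

lemma K_conjugate_iff: "K_conjugate q T R \<longleftrightarrow> R \<in> BH \<and> R o\<^sub>L Kinv = Kinv o\<^sub>L T"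
proof -
  have "(\<forall>x\<in>Kpow_dom q 1. R x = Kinv (T (Kpow q 1 x))) \<longleftrightarrow> (\<forall>y. R (Kinv y) = Kinv (T y))"
    by (metis K_dom_iff Kpow_Kinv)
  then show ?thesis
    by (auto simp: K_conjugate_def Kpow_minus op_eq_iff)
qed

text \<open>The basis vectors lie in the range of \<open>Kinv\<close>, hence two solutions agree on
  them. This justifies the description in \<open>modular_aut\<close>.\<close>

lemma K_conjugate_unique:
  assumes "K_conjugate q T R" "K_conjugate q T R'"
  shows "R = R'"
proof (rule op_eqI)
  show BH: "R \<in> BH" "R' \<in> BH" using assms by (auto simp: K_conjugate_iff)
  have "R o\<^sub>L Kinv = R' o\<^sub>L Kinv" using assms by (simp add: K_conjugate_iff)
  then have eq: "R (Kinv x) = R' (Kinv x)" for x by (metis blinfun_apply_blinfun_compose)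
  fix i
  have "basis i = Kinv (of_real (kd i) *\<^sub>C basis i)"
    using d_pos[of i] by (simp add: BH_scaleC[OF Kinv_BH] Kinv_basis scaleC_scaleC
        flip: of_real_inverse of_real_mult)
  then show "R (basis i) = R' (basis i)" using eq by metis
qed

lemma modular_aut_eq: "K_conjugate q T R \<Longrightarrow> modular_aut q T = R"
  unfolding modular_aut_def using K_conjugate_unique by blast

lemma K_conjugate_inj: "K_conjugate q T R \<Longrightarrow> K_conjugate q T' R \<Longrightarrow> T = T'"
proof (rule blinfun_eqI)
  fix x assume "K_conjugate q T R" "K_conjugate q T' R"
  then have "Kinv o\<^sub>L T = Kinv o\<^sub>L T'" by (simp add: K_conjugate_iff)
  then have "Kinv (T x) = Kinv (T' x)" by (metis blinfun_apply_blinfun_compose)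
  then show "T x = T' x" by (rule Kinv_eqD)
qed

lemma K_conjugate_add: "K_conjugate q S Q \<Longrightarrow> K_conjugate q T R \<Longrightarrow> K_conjugate q (S + T) (Q + R)"
  by (simp add: K_conjugate_iff compose_algebra)

lemma K_conjugate_scaleC: "K_conjugate q T R \<Longrightarrow> K_conjugate q (c *\<^sub>C T) (c *\<^sub>C R)"
  by (simp add: K_conjugate_iff scaleC_compose_left scaleC_compose_right)

lemma K_conjugate_compose:
  assumes "K_conjugate q S Q" "K_conjugate q T R"
  shows "K_conjugate q (S o\<^sub>L T) (Q o\<^sub>L R)"
proof -
  have "Q (Kinv x) = Kinv (S x)" "R (Kinv x) = Kinv (T x)" for x
    using assms by (simp_all add: K_conjugate_iff op_eq_iff del: split_paired_All)
  then show ?thesis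
    using assms by (simp add: K_conjugate_iff op_eq_iff del: split_paired_All)
qed

lemma K_conjugate_id: "K_conjugate q id_blinfun id_blinfun"
  by (simp add: K_conjugate_iff op_eq_iff)

lemma K_conjugate_homogeneous:
  assumes "homogeneous w T"
  shows "K_conjugate q T (of_real (inverse w) *\<^sub>C T)"
  unfolding K_conjugate_iff
proof (intro conjI entries_eqI)
  have T: "T \<in> BH" and w: "0 < w" using assms by (auto simp: homogeneous_def)
  show "of_real (inverse w) *\<^sub>C T \<in> BH" "of_real (inverse w) *\<^sub>C T o\<^sub>L Kinv \<in> BH" "Kinv o\<^sub>L T \<in> BH"
    using T by auto
  have adj: "adj Kinv (basis i) = of_real (inverse (kd i)) *\<^sub>C basis i" for i
    by (rule basis_eqI) (simp add: cinner_adj_right Kinv_basis cinner_scaleC_left cinner_scaleC_right orthonormal)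
  fix i j
  have "cinner (basis i) (Kinv (T (basis j))) = cinner (adj Kinv (basis i)) (T (basis j))"
    by (simp add: cinner_adj_left)
  also have "\<dots> = of_real (inverse (kd i)) * cinner (basis i) (T (basis j))"
    by (simp add: adj cinner_scaleC_left)
  also have "\<dots> = of_real (inverse w * inverse (kd j)) * cinner (basis i) (T (basis j))"
    using assms by (cases "cinner (basis i) (T (basis j)) = 0") (auto simp: homogeneous_def)
  finally show "cinner (basis i) ((of_real (inverse w) *\<^sub>C T o\<^sub>L Kinv) (basis j)) =
      cinner (basis i) ((Kinv o\<^sub>L T) (basis j))"
    by (simp add: Kinv_basis BH_scaleC[OF T] cinner_scaleC_right)
qed

end


declare split_paired_All [simp del] split_paired_Ex [simp del]

lemma op_compose_assoc: "(R o\<^sub>L S) o\<^sub>L T = R o\<^sub>L (S o\<^sub>L T)"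
  by (rule blinfun_eqI) simp

lemma op_compose_id [simp]: "id_blinfun o\<^sub>L T = T" "T o\<^sub>L id_blinfun = T"
  by (rule blinfun_eqI, simp)+

lemma op_on_basis_diag:
  assumes "bounded (range (\<lambda>n. complex_of_real (c n)))"
  shows "op_on_basis (\<lambda>k. c k *\<^sub>R ket k) = wshift 0 (\<lambda>n. of_real (c n))"
  using assms by (intro op_on_basis_eq wshift_BH ell2_eqI) (auto simp: coord_wshift[OF assms])

text \<open>The given weight is indexed by the source and that of \<open>wshift\<close> by the
  target, whence \<open>Suc n\<close>. At \<open>k = 0\<close>, where \<open>k - 1\<close> is again
  0, the assumption \<open>c 0 = 0\<close> is needed.\<close>

lemma op_on_basis_down:
  assumes "bounded (range (\<lambda>n. complex_of_real (c (Suc n))))" "c 0 = 0"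
  shows "op_on_basis (\<lambda>k. c k *\<^sub>R ket (k - 1)) = wshift 1 (\<lambda>n. of_real (c (Suc n)))"
proof (intro op_on_basis_eq wshift_BH assms(1) ell2_eqI)
  fix k n
  show "coord (wshift 1 (\<lambda>n. of_real (c (Suc n))) (ket k)) n = coord (c k *\<^sub>R ket (k - 1)) n"
    using assms(2) by (cases k) (auto simp: coord_wshift[OF assms(1)])
qed

section \<open>The generators in coordinates and soundness of the evaluation\<close>

context podles
begin

abbreviation ev :: "expr \<Rightarrow> hsum op" where
  "ev \<equiv> podles_eval q s"

definition b_plus :: "nat \<Rightarrow> real" where
  "b_plus k = sqrt (1 - q ^ (2 * k)) * sqrt (s\<^sup>2 + q ^ (2 * k))"

definition b_minus :: "nat \<Rightarrow> real" where
  "b_minus k = s * sqrt (1 - q ^ (2 * k)) * sqrt (1 + s\<^sup>2 * q ^ (2 * k))"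

lemma s_square_le_1: "s\<^sup>2 \<le> 1"
  using s_pos s_le_1 by (simp add: power_le_one)

lemma q_power_pos: "0 < q ^ n"
  using q_pos by simp

lemma b_plus_square: "b_plus k * b_plus k = (1 - q ^ (2 * k)) * (s\<^sup>2 + q ^ (2 * k))"
  using q_power_le_1[of "2 * k"] q_power_pos[of "2 * k"]
  by (simp add: b_plus_def power2_eq_square[symmetric] power_mult_distrib)

lemma b_minus_square: "b_minus k * b_minus k = s\<^sup>2 * (1 - q ^ (2 * k)) * (1 + s\<^sup>2 * q ^ (2 * k))"
  using q_power_le_1[of "2 * k"] q_power_pos[of "2 * k"]
  by (simp add: b_minus_def power2_eq_square[symmetric] power_mult_distrib)

lemma b_plus_pos: "0 < b_plus (Suc k)"
proof -
  have "q ^ (2 * Suc k) < 1" using q_pos q_less_1 by (intro power_Suc_less_one power_strict_decreasing[of 0 _ q, simplified]) auto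
  then show ?thesis
    using q_power_pos[of "2 * Suc k"] unfolding b_plus_def
    by (intro mult_pos_pos) (auto simp: add_nonneg_pos)
qed

lemma b_bounded:
  "bounded (range (\<lambda>n. complex_of_real (b_plus (f n))))"
  "bounded (range (\<lambda>n. complex_of_real (b_minus (f n))))"
proof -
  have p: "\<bar>b_plus k\<bar> \<le> 2" for k
  proof -
    have "(b_plus k)\<^sup>2 \<le> 1 * 2"
      unfolding power2_eq_square[of "b_plus k"] b_plus_square
      using q_power_le_1[of "2 * k"] q_power_pos[of "2 * k"] s_square_le_1
      by (intro mult_mono) auto
    also have "\<dots> \<le> 2\<^sup>2" by simp
    finally show ?thesis using power2_le_iff_abs_le[of 2 "b_plus k"] by simp
  qed
  have m: "\<bar>b_minus k\<bar> \<le> 2" for k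
  proof -
    have "s\<^sup>2 * q ^ (2 * k) \<le> 1"
      using q_power_le_1[of "2 * k"] q_power_pos[of "2 * k"] s_square_le_1
      by (intro mult_le_one) auto
    then have "(b_minus k)\<^sup>2 \<le> (1 * 1) * 2"
      unfolding power2_eq_square[of "b_minus k"] b_minus_square
      using q_power_le_1[of "2 * k"] q_power_pos[of "2 * k"] s_square_le_1
      by (intro mult_mono) auto
    also have "\<dots> \<le> 2\<^sup>2" by simp
    finally show ?thesis using power2_le_iff_abs_le[of 2 "b_minus k"] by simp
  qed
  show "bounded (range (\<lambda>n. complex_of_real (b_plus (f n))))"
    "bounded (range (\<lambda>n. complex_of_real (b_minus (f n))))"
    using p m by (auto simp: bounded_iff intro!: exI[of _ 2])
qed

lemma a_bounded:
  "bounded (range (\<lambda>n. complex_of_real (q ^ (2 * n))))"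
  "bounded (range (\<lambda>n. complex_of_real (- (s\<^sup>2 * q ^ (2 * n)))))"
proof -
  show "bounded (range (\<lambda>n. complex_of_real (q ^ (2 * n))))"
    using bounded_K_inverse by (simp only: K_coeff_eq[OF q_pos])
  from bounded_scaling[OF this, of "- (s\<^sup>2)"]
  show "bounded (range (\<lambda>n. complex_of_real (- (s\<^sup>2 * q ^ (2 * n)))))"
    by (simp add: image_image scaleR_conv_of_real)
qed

lemma ev_A: "ev GenA = direct_sum_op (wshift 0 (\<lambda>n. of_real (q ^ (2 * n))))
    (wshift 0 (\<lambda>n. of_real (- (s\<^sup>2 * q ^ (2 * n)))))"
  unfolding podles_eval.simps plus_A_def minus_A_def
  by (simp only: op_on_basis_diag[OF a_bounded(1)] op_on_basis_diag[OF a_bounded(2)])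

lemma ev_B: "ev GenB = direct_sum_op (wshift 1 (\<lambda>n. of_real (b_plus (Suc n))))
    (wshift 1 (\<lambda>n. of_real (b_minus (Suc n))))"
proof -
  have "b_plus 0 = 0" "b_minus 0 = 0" by (simp_all add: b_plus_def b_minus_def)
  from op_on_basis_down[of b_plus, OF b_bounded(1) this(1)]
    op_on_basis_down[of b_minus, OF b_bounded(2) this(2)]
  show ?thesis
    by (simp only: podles_eval.simps plus_B_def minus_B_def b_plus_def[abs_def] b_minus_def[abs_def])
qed

lemma ev_A_BH: "ev GenA \<in> BH" and ev_B_BH: "ev GenB \<in> BH"
  unfolding ev_A ev_B by (intro direct_sum_op_BH wshift_BH a_bounded b_bounded)+

lemma coord_ev_A:
  "coord (fst (ev GenA x)) n = of_real (q ^ (2 * n)) * coord (fst x) n"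
  "coord (snd (ev GenA x)) n = of_real (- (s\<^sup>2 * q ^ (2 * n))) * coord (snd x) n"
  unfolding ev_A direct_sum_op_apply fst_conv snd_conv coord_wshift[OF a_bounded(1)]
    coord_wshift[OF a_bounded(2)] by simp_all

lemma coord_ev_B:
  "coord (fst (ev GenB x)) n = of_real (b_plus (Suc n)) * coord (fst x) (Suc n)"
  "coord (snd (ev GenB x)) n = of_real (b_minus (Suc n)) * coord (snd x) (Suc n)"
  unfolding ev_B direct_sum_op_apply fst_conv snd_conv coord_wshift[OF b_bounded(1)]
    coord_wshift[OF b_bounded(2)] by simp_all

lemma adj_ev_B: "adj (ev GenB) = direct_sum_op (adj (wshift 1 (\<lambda>n. of_real (b_plus (Suc n)))))
    (adj (wshift 1 (\<lambda>n. of_real (b_minus (Suc n)))))"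
  unfolding ev_B by (intro adj_direct_sum_op wshift_BH b_bounded)

lemma coord_adj_ev_B:
  "coord (fst (adj (ev GenB) x)) n = (if n = 0 then 0 else of_real (b_plus n) * coord (fst x) (n - 1))"
  "coord (snd (adj (ev GenB) x)) n = (if n = 0 then 0 else of_real (b_minus n) * coord (snd x) (n - 1))"
  unfolding adj_ev_B direct_sum_op_apply fst_conv snd_conv coord_adj_wshift[OF b_bounded(1)]
    coord_adj_wshift[OF b_bounded(2)] by simp_all

declare podles_eval.simps(1,2) [simp del]

lemma ev_BH [simp]: "ev t \<in> BH"
  by (induction t) (simp_all add: ev_A_BH ev_B_BH)

lemma cinner_basis_right:
  "cinner x (basis i) = (case i of Inl n \<Rightarrow> cnj (coord (fst x) n) | Inr n \<Rightarrow> cnj (coord (snd x) n))"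
  by (subst cinner_commute) (simp add: cinner_basis split: sum.split)

lemma adj_ev_A: "adj (ev GenA) = ev GenA"
proof (rule entries_eqI)
  fix i j
  have "cinner (basis i) (adj (ev GenA) (basis j)) = cinner (ev GenA (basis i)) (basis j)"
    by (rule cinner_adj_right[OF ev_BH])
  then show "cinner (basis i) (adj (ev GenA) (basis j)) = cinner (basis i) (ev GenA (basis j))"
    unfolding cinner_basis cinner_basis_right by (cases i; cases j) (auto simp: coord_ev_A)
qed simp_all

lemma b_square_mult:
  "of_real (b_plus k) * (of_real (b_plus k) * z) =
    of_real ((1 - q ^ (2 * k)) * (s\<^sup>2 + q ^ (2 * k))) * (z::complex)"
  "of_real (b_minus k) * (of_real (b_minus k) * z) =
    of_real (s\<^sup>2 * (1 - q ^ (2 * k)) * (1 + s\<^sup>2 * q ^ (2 * k))) * z"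
  by (simp_all only: mult.assoc[symmetric] of_real_mult[symmetric] b_plus_square b_minus_square)

text \<open>The square roots occur only in pairs with equal index. Once \<open>b_square_mult\<close>
  has removed them, the first two relations are polynomial identities in each coordinate.\<close>

lemma ev_relations:
  "(adj (ev GenB) o\<^sub>L ev GenB) +
    ((ev GenA + (-1) *\<^sub>C id_blinfun) o\<^sub>L (ev GenA + of_real (s\<^sup>2) *\<^sub>C id_blinfun)) = 0"
  "(ev GenB o\<^sub>L adj (ev GenB)) +
    ((of_real (q\<^sup>2) *\<^sub>C ev GenA + (-1) *\<^sub>C id_blinfun) o\<^sub>L
      (of_real (q\<^sup>2) *\<^sub>C ev GenA + of_real (s\<^sup>2) *\<^sub>C id_blinfun)) = 0"
  "ev GenA o\<^sub>L ev GenB = of_real (inverse (q\<^sup>2)) *\<^sub>C (ev GenB o\<^sub>L ev GenA)"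
proof -
  show "(adj (ev GenB) o\<^sub>L ev GenB) +
    ((ev GenA + (-1) *\<^sub>C id_blinfun) o\<^sub>L (ev GenA + of_real (s\<^sup>2) *\<^sub>C id_blinfun)) = 0"
    by (intro blinfun_eqI prod_eqI ell2_eqI)
      (simp_all add: blinfun.add_left scaleC_prod_def coord_ev_A coord_ev_B coord_adj_ev_B
        b_square_mult, auto simp: algebra_simps power2_eq_square)
  show "(ev GenB o\<^sub>L adj (ev GenB)) +
    ((of_real (q\<^sup>2) *\<^sub>C ev GenA + (-1) *\<^sub>C id_blinfun) o\<^sub>L
      (of_real (q\<^sup>2) *\<^sub>C ev GenA + of_real (s\<^sup>2) *\<^sub>C id_blinfun)) = 0"
    by (intro blinfun_eqI prod_eqI ell2_eqI)
      (simp_all add: blinfun.add_left scaleC_prod_def coord_ev_A coord_ev_B coord_adj_ev_B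
        b_square_mult, auto simp: algebra_simps power2_eq_square)
  show "ev GenA o\<^sub>L ev GenB = of_real (inverse (q\<^sup>2)) *\<^sub>C (ev GenB o\<^sub>L ev GenA)"
  proof (intro blinfun_eqI prod_eqI ell2_eqI)
    \<comment> \<open>In B A the eigenvalue of A is taken at the index \<open>Suc n\<close>, in A B
      at \<open>n\<close>; the factor of the relation compensates this shift.\<close>
    have "inverse (q\<^sup>2) * q ^ (2 * Suc n) = q ^ (2 * n)" for n
      using q_pos by (simp add: power2_eq_square field_simps)
    then have c: "complex_of_real (inverse (q\<^sup>2)) * of_real (q ^ (2 * Suc n)) = of_real (q ^ (2 * n))" for n
      by (simp only: of_real_mult[symmetric])
    have c': "of_real (inverse (q\<^sup>2)) * (b * (r * of_real (q ^ (2 * Suc n)) * z)) = of_real (q ^ (2 * n)) * (b * (r * z))"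
      for b r z :: complex and n
    proof -
      have "of_real (inverse (q\<^sup>2)) * (b * (r * of_real (q ^ (2 * Suc n)) * z)) =
          (of_real (inverse (q\<^sup>2)) * of_real (q ^ (2 * Suc n))) * (b * (r * z))"
        by (simp only: mult_ac)
      then show ?thesis by (simp only: c)
    qed
    fix x n
    show "coord (fst ((ev GenA o\<^sub>L ev GenB) x)) n =
        coord (fst ((of_real (inverse (q\<^sup>2)) *\<^sub>C (ev GenB o\<^sub>L ev GenA)) x)) n"
      using c'[of "of_real (b_plus (Suc n))" 1 n]
      by (simp only: blinfun_apply_blinfun_compose scaleC_blinfun_apply scaleC_prod_def fst_conv
          coord_simps coord_ev_A coord_ev_B mult_1_left)
    show "coord (snd ((ev GenA o\<^sub>L ev GenB) x)) n =
        coord (snd ((of_real (inverse (q\<^sup>2)) *\<^sub>C (ev GenB o\<^sub>L ev GenA)) x)) n"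
      by (simp only: blinfun_apply_blinfun_compose scaleC_blinfun_apply scaleC_prod_def snd_conv
          coord_simps coord_ev_A coord_ev_B mult_minus_left[symmetric] of_real_mult c')
        (simp only: mult_ac)
  qed
qed

theorem podles_eval_sound: "podles_eq q s x y \<Longrightarrow> ev x = ev y"
proof (induction rule: podles_eq.induct)
  case A_selfadjoint
  show ?case using adj_ev_A by simp
next
  case relation_BsB
  show ?case using ev_relations(1) by simp
next
  case relation_BBs
  show ?case using ev_relations(2) by simp
next
  case relation_AB
  show ?case using ev_relations(3) by simp
next
  case (add_neg x)
  have "(- 1) *\<^sub>C ev x = - ev x" by (simp add: scaleC_op.minus_left)
  then show ?case by simp
qed (simp_all add: compose_algebra scaleC_op.add_left scaleC_op.add_right op_scaleC_scaleC
  scaleC_compose_left scaleC_compose_right adj_add adj_compose adj_scaleC op_compose_assoc add_ac)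

lemma podles_rep_class: "podles_rep q s (cl t) = ev t"
proof -
  have "ev ` cl t = {ev t}"
    using podles_eval_sound podles_eq.refl by (fastforce simp: podles_class_def)
  then show ?thesis by (simp add: podles_rep_def)
qed

lemma podles_image_eq: "podles_image q s = range ev"
  by (simp add: podles_image_def podles_algebra_def image_image podles_rep_class)


subsection \<open>Faithfulness\<close>

lemma coord_ev_P: "coord (fst (ev (P p) x)) n = poly p (of_real (q ^ (2 * n))) * coord (fst x) n"
proof (induction p)
  case (pCons a p)
  have "ev (P (pCons a p)) = a *\<^sub>C id_blinfun + (ev GenA o\<^sub>L ev (P p))"
    using podles_eval_sound[OF cl_eq_iff[THEN iffD1], of "P (pCons a p)" "Add (Scale a One) (Mul GenA (P p))"]
    by (simp add: P_pCons cl_push)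
  then show ?case
    by (simp add: blinfun.add_left scaleC_prod_def coord_ev_A pCons.IH algebra_simps)
qed simp

text \<open>The weights are left unspecified because faithfulness uses only that none of them
  vanishes, which rests on \<open>b_plus_pos\<close>.\<close>

lemma coord_ev_gpow_B:
  "\<exists>\<beta>. (\<forall>n. \<beta> n \<noteq> 0) \<and> (\<forall>x n. coord (fst (ev (gpow GenB m) x)) n = \<beta> n * coord (fst x) (n + m))"
proof (induction m)
  case 0
  show ?case by (intro exI[of _ "\<lambda>_. 1"]) simp
next
  case (Suc m)
  then obtain \<beta> where \<beta>: "\<And>n. \<beta> n \<noteq> 0"
    "\<And>x n. coord (fst (ev (gpow GenB m) x)) n = \<beta> n * coord (fst x) (n + m)" by blast
  show ?case
    using \<beta> b_plus_pos[THEN less_imp_neq]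
    by (intro exI[of _ "\<lambda>n. of_real (b_plus (Suc n)) * \<beta> (Suc n)"]) (auto simp: coord_ev_B)
qed

lemma coord_ev_gpow_Bs:
  "\<exists>\<beta>. (\<forall>n. \<beta> n \<noteq> 0) \<and> (\<forall>x n. coord (fst (ev (gpow (Star GenB) m) x)) n =
    (if n < m then 0 else \<beta> n * coord (fst x) (n - m)))"
proof (induction m)
  case 0
  show ?case by (intro exI[of _ "\<lambda>_. 1"]) simp
next
  case (Suc m)
  then obtain \<beta> where \<beta>: "\<And>n. \<beta> n \<noteq> 0"
    "\<And>x n. coord (fst (ev (gpow (Star GenB) m) x)) n = (if n < m then 0 else \<beta> n * coord (fst x) (n - m))"
    by blast
  have "b_plus n \<noteq> 0" if "n \<noteq> 0" for n
    using b_plus_pos[of "n - 1"] that by simp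
  then show ?case
    using \<beta> by (intro exI[of _ "\<lambda>n. if n = 0 then 1 else of_real (b_plus n) * \<beta> (n - 1)"])
      (auto simp: coord_adj_ev_B)
qed

lemma coord_ev_Bp:
  "\<exists>\<beta>. (\<forall>n. \<beta> n \<noteq> 0) \<and> (\<forall>x n. coord (fst (ev (Bp m) x)) n =
    (if int n + m < 0 then 0 else \<beta> n * coord (fst x) (nat (int n + m))))"
proof (cases "0 \<le> m")
  case True
  then have "nat (int n + m) = n + nat m" "\<not> int n + m < 0" for n by auto
  then show ?thesis using coord_ev_gpow_B[of "nat m"] True by (simp add: Bp_def)
next
  case False
  then have "nat (int n + m) = n - nat (- m)" "int n + m < 0 \<longleftrightarrow> n < nat (- m)" for n by auto
  then show ?thesis using coord_ev_gpow_Bs[of "nat (- m)"] False by (simp only: Bp_def if_False)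
qed

lemma nf_coeff_eq_0:
  assumes "ev (nf xs) = 0"
  shows "nf_coeff xs m = 0"
proof -
  have "\<exists>\<beta>. \<forall>m. (\<forall>n. \<beta> m n \<noteq> 0) \<and> (\<forall>x n. coord (fst (ev (Bp m) x)) n =
    (if int n + m < 0 then 0 else \<beta> m n * coord (fst x) (nat (int n + m))))"
    by (intro choice allI coord_ev_Bp)
  then obtain \<beta> where \<beta>: "\<And>m n. \<beta> m n \<noteq> 0" "\<And>m x n. coord (fst (ev (Bp m) x)) n =
    (if int n + m < 0 then 0 else \<beta> m n * coord (fst x) (nat (int n + m)))"
    by blast
  have root: "poly (nf_coeff xs m) (of_real (q ^ (2 * n))) = 0" if n: "0 \<le> int n + m" for n
  proof -
    \<comment> \<open>A term of exponent \<open>fst y\<close> computes coordinate \<open>n\<close>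
      from coordinate \<open>n + fst y\<close>. Testing with the basis vector of index
      \<open>n + m\<close> therefore isolates the exponent \<open>m\<close>.\<close>
    have tm: "coord (fst (ev (nf_term y) (basis (Inl (nat (int n + m)))))) n =
        poly (if fst y = m then snd y else 0) (of_real (q ^ (2 * n))) * \<beta> m n" for y
    proof (cases "fst y = m")
      case True
      then show ?thesis using n by (simp add: nf_term_def coord_ev_P \<beta>(2))
    next
      case False
      then have "int n + fst y < 0 \<or> nat (int n + fst y) \<noteq> nat (int n + m)" using n by auto
      then show ?thesis using False by (auto simp: nf_term_def coord_ev_P \<beta>(2))
    qed
    have "coord (fst (ev (nf xs) (basis (Inl (nat (int n + m)))))) n =
        poly (nf_coeff xs m) (of_real (q ^ (2 * n))) * \<beta> m n"
    proof (induction xs)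
      case (Cons y xs)
      then show ?case
        unfolding nf_simps podles_eval.simps blinfun.add_left fst_add coord_simps tm
        by (simp add: nf_coeff_def algebra_simps)
    qed (simp add: nf_coeff_def)
    then show ?thesis using assms \<beta>(1) by simp
  qed
  have inj: "inj (\<lambda>n. complex_of_real (q ^ (2 * n)))"
  proof (rule injI)
    fix k n assume "complex_of_real (q ^ (2 * k)) = complex_of_real (q ^ (2 * n))"
    then have "q ^ (2 * k) = q ^ (2 * n)" by (simp only: of_real_eq_iff)
    then show "k = n" using q_pos q_less_1 power_inject_exp'[of q] by simp
  qed
  have "infinite ((\<lambda>n. complex_of_real (q ^ (2 * n))) ` {nat (- m)..})"
    using inj infinite_Ici by (simp add: finite_image_iff inj_on_subset)
  moreover have "(\<lambda>n. complex_of_real (q ^ (2 * n))) ` {nat (- m)..} \<subseteq> {z. poly (nf_coeff xs m) z = 0}"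
  proof (intro subsetI CollectI, elim imageE)
    fix z n assume "z = complex_of_real (q ^ (2 * n))" "n \<in> {nat (- m)..}"
    then show "poly (nf_coeff xs m) z = 0" using root[of n] by simp
  qed
  ultimately show ?thesis using poly_roots_finite finite_subset by blast
qed

theorem ev_faithful:
  assumes "ev x = ev y"
  shows "cl x = cl y"
proof -
  obtain xs where xs: "cl (Add x (Scale (-1) y)) = cl (nf xs)" using ex_nf by blast
  have "ev (nf xs) = ev (Add x (Scale (-1) y))"
    using podles_eval_sound xs cl_eq_iff by metis
  also have "\<dots> = 0" using assms by (simp add: scaleC_op.minus_left)
  finally have "cl (nf xs) = cl Zero" by (intro nf_eq_Zero nf_coeff_eq_0)
  then have "cl x \<oplus> cl (Scale (-1) y) = cl Zero" using xs by (simp add: cl_push)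
  from eq_neg_of_padd[OF this] have "cl x = 1 \<odot> cl y"
    by (simp add: cl_push pscale_pscale)
  then show ?thesis by (simp only: cl_units)
qed

lemma inj_on_podles_rep: "inj_on (podles_rep q s) (podles_algebra q s)"
  unfolding podles_algebra_def
proof (rule inj_onI, elim rangeE)
  fix X Y x y
  assume "podles_rep q s X = podles_rep q s Y" and XY: "X = cl x" "Y = cl y"
  then have "ev x = ev y" by (simp add: podles_rep_class)
  then show "X = Y" unfolding XY by (rule ev_faithful)
qed

end


text \<open>Codes for countably many expressions: a scalar is replaced by its position in an
  enumeration of a countable dense set of complex numbers.\<close>

datatype rational_expr = RGenA | RGenB | ROne | RZero | RAdd rational_expr rational_expr
  | RMul rational_expr rational_expr | RScale nat rational_expr | RStar rational_expr

instance rational_expr :: countable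
  by countable_datatype

primrec decode :: "(nat \<Rightarrow> complex) \<Rightarrow> rational_expr \<Rightarrow> expr" where
  "decode c RGenA = GenA"
| "decode c RGenB = GenB"
| "decode c ROne = One"
| "decode c RZero = Zero"
| "decode c (RAdd x y) = Add (decode c x) (decode c y)"
| "decode c (RMul x y) = Mul (decode c x) (decode c y)"
| "decode c (RScale n x) = Scale (c n) (decode c x)"
| "decode c (RStar x) = Star (decode c x)"

lemma closure_binary:
  fixes f :: "'a::topological_space \<Rightarrow> 'b::topological_space \<Rightarrow> 'c::topological_space"
  assumes "continuous_on UNIV (\<lambda>p. f (fst p) (snd p))"
    and "\<And>x y. x \<in> S \<Longrightarrow> y \<in> T \<Longrightarrow> f x y \<in> C"
    and "x \<in> closure S" "y \<in> closure T"
  shows "f x y \<in> closure C"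
proof -
  have "(\<lambda>p. f (fst p) (snd p)) ` closure (S \<times> T) \<subseteq> closure C"
    using assms(2) closure_subset[of C]
    by (intro image_closure_subset continuous_on_subset[OF assms(1)]) fastforce+
  then show ?thesis using assms(3,4) by (force simp: closure_Times)
qed

context podles
begin

subsection \<open>The modular automorphism of the Podles algebra\<close>

text \<open>Lowering the index by \<open>j\<close> multiplies the eigenvalue q^(-2k) of
  \<open>K\<close> by q^(2j), whatever the weights are.\<close>

lemma homogeneous_direct_sum_wshift:
  assumes "bounded (range c)" "bounded (range c')"
  shows "homogeneous (q ^ (2 * j)) (direct_sum_op (wshift j c) (wshift j c'))"
  unfolding homogeneous_def
proof (intro conjI allI impI)
  have kd: "inverse (q ^ (2 * n)) = q ^ (2 * j) * inverse (q ^ (2 * n + 2 * j))" for n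
    using q_pos by (simp add: power_add field_simps)
  fix i k assume "cinner (basis i) (direct_sum_op (wshift j c) (wshift j c') (basis k)) \<noteq> 0"
  then show "kd i = q ^ (2 * j) * kd k"
    unfolding cinner_basis
    by (cases i; cases k) (auto simp: coord_wshift assms kd_def K_coeff_eq[OF q_pos] kd[symmetric]
        blinfun.zero_right split: if_splits)
qed (use assms q_pos in \<open>simp_all add: direct_sum_op_BH wshift_BH\<close>)

lemma homogeneous_ev_A: "homogeneous 1 (ev GenA)"
  using homogeneous_direct_sum_wshift[OF a_bounded, of 0] by (simp add: ev_A)

lemma homogeneous_ev_B: "homogeneous (q\<^sup>2) (ev GenB)"
  using homogeneous_direct_sum_wshift[OF b_bounded, of 1] by (simp add: ev_B)

lemma homogeneous_ev_Bs: "homogeneous (inverse (q\<^sup>2)) (adj (ev GenB))"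
  by (rule homogeneous_adj[OF homogeneous_ev_B])

lemma homogeneous_F: "homogeneous 1 F_op" and homogeneous_gamma: "homogeneous 1 gamma_op"
proof -
  have "kd i = kd j" if "cinner (basis i) (F_op (basis j)) \<noteq> 0" for i j
    using that unfolding cinner_basis by (cases i; cases j) (auto simp: kd_def split: if_splits)
  then show "homogeneous 1 F_op" by (simp add: homogeneous_def)
  have "kd i = kd j" if "cinner (basis i) (gamma_op (basis j)) \<noteq> 0" for i j
    using that unfolding cinner_basis by (cases i; cases j) (auto simp: kd_def split: if_splits)
  then show "homogeneous 1 gamma_op" by (simp add: homogeneous_def)
qed

lemma homogeneous_ev_P: "homogeneous 1 (ev (P p))"
proof (induction p)
  case (pCons a p)
  have "ev (P (pCons a p)) = a *\<^sub>C id_blinfun + (ev GenA o\<^sub>L ev (P p))"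
    using podles_eval_sound[OF cl_eq_iff[THEN iffD1], of "P (pCons a p)" "Add (Scale a One) (Mul GenA (P p))"]
    by (simp add: P_pCons cl_push)
  then show ?case
    using homogeneous_compose[OF homogeneous_ev_A pCons.IH]
    by (simp add: homogeneous_add homogeneous_scaleC homogeneous_id)
qed (simp add: homogeneous_zero)

lemma homogeneous_ev_gpow: "homogeneous w (ev g) \<Longrightarrow> homogeneous (w ^ n) (ev (gpow g n))"
  by (induction n) (simp_all add: homogeneous_id homogeneous_compose)

lemma homogeneous_ev_nf_term: "\<exists>w. homogeneous w (ev (nf_term x))"
proof -
  have "\<exists>w. homogeneous w (ev (Bp (fst x)))"
    using homogeneous_ev_gpow[OF homogeneous_ev_B] homogeneous_ev_gpow[of _ "Star GenB"]
      homogeneous_ev_Bs by (auto simp: Bp_def)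
  then obtain w where "homogeneous w (ev (Bp (fst x)))" ..
  from homogeneous_compose[OF homogeneous_ev_P this] show ?thesis by (auto simp: nf_term_def)
qed

text \<open>The second use of normal forms, besides faithfulness: additive properties of the algebra
  need to be checked only on eigenvectors of the modular group.\<close>

lemma ev_induct [case_names homogeneous add]:
  assumes "\<And>w t. homogeneous w (ev t) \<Longrightarrow> Q (ev t)"
    and "\<And>x y. Q (ev x) \<Longrightarrow> Q (ev y) \<Longrightarrow> Q (ev x + ev y)"
  shows "Q (ev t)"
proof -
  obtain xs where "cl t = cl (nf xs)" using ex_nf by blast
  then have "ev t = ev (nf xs)" by (intro podles_eval_sound) (simp add: cl_eq_iff)
  moreover have "Q (ev (nf xs))"
  proof (induction xs)
    case Nil
    show ?case using assms(1)[of 1 Zero] by (simp add: homogeneous_zero)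
  next
    case (Cons x xs)
    have "Q (ev (nf_term x))" using homogeneous_ev_nf_term assms(1) by blast
    then show ?case using assms(2) Cons.IH by simp
  qed
  ultimately show ?thesis by simp
qed

lemma range_ev_closed:
  "a \<in> range ev \<Longrightarrow> b \<in> range ev \<Longrightarrow> a + b \<in> range ev"
  "a \<in> range ev \<Longrightarrow> b \<in> range ev \<Longrightarrow> a o\<^sub>L b \<in> range ev"
  "a \<in> range ev \<Longrightarrow> c *\<^sub>C a \<in> range ev"
  "a \<in> range ev \<Longrightarrow> adj a \<in> range ev"
  "id_blinfun \<in> range ev"
proof -
  show "a \<in> range ev \<Longrightarrow> b \<in> range ev \<Longrightarrow> a + b \<in> range ev"
    "a \<in> range ev \<Longrightarrow> b \<in> range ev \<Longrightarrow> a o\<^sub>L b \<in> range ev"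
    "a \<in> range ev \<Longrightarrow> c *\<^sub>C a \<in> range ev"
    "a \<in> range ev \<Longrightarrow> adj a \<in> range ev"
    by (elim rangeE, simp only: podles_eval.simps(5-8)[symmetric] rangeI)+
  show "id_blinfun \<in> range ev" by (rule range_eqI[of _ _ One]) simp
qed

text \<open>The claims are proved for one and the same function: its real values give the invariance
  of the algebra under the modular group, its value at \<open>\<i>\<close> the automorphism
  \<open>modular_aut\<close>.\<close>

lemma ex_modular_extension:
  "\<exists>f. entire_extension BH \<sigma> (ev t) f \<and> range f \<subseteq> range ev \<and> K_conjugate q (ev t) (f \<i>)"
proof (induction rule: ev_induct)
  case (homogeneous w t)
  let ?f = "\<lambda>z. exp (\<i> * of_real (ln w) * z) *\<^sub>C ev t"
  have w: "0 < w" using homogeneous by (simp add: homogeneous_def)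
  have "\<i> * complex_of_real (ln w) * \<i> = of_real (- ln w)" by (simp add: algebra_simps)
  then have "exp (\<i> * complex_of_real (ln w) * \<i>) = of_real (inverse w)"
    using w by (simp only: exp_of_real) (simp add: exp_minus)
  then have "K_conjugate q (ev t) (?f \<i>)"
    using K_conjugate_homogeneous[OF homogeneous] by simp
  moreover have "range ?f \<subseteq> range ev" using range_ev_closed(3) by blast
  ultimately show ?case using entire_extension_homogeneous[OF homogeneous] by blast
next
  case (add x y)
  then obtain f g where "entire_extension BH \<sigma> (ev x) f" "range f \<subseteq> range ev" "K_conjugate q (ev x) (f \<i>)"
    "entire_extension BH \<sigma> (ev y) g" "range g \<subseteq> range ev" "K_conjugate q (ev y) (g \<i>)" by blast
  moreover from this have "range (\<lambda>z. f z + g z) \<subseteq> range ev"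
    using range_ev_closed(1) by blast
  ultimately show ?case
    by (intro exI[of _ "\<lambda>z. f z + g z"]) (simp add: entire_extension_add K_conjugate_add)
qed

lemma K_conjugate_modular_aut:
  "a \<in> range ev \<Longrightarrow> K_conjugate q a (modular_aut q a) \<and> modular_aut q a \<in> range ev"
  using ex_modular_extension modular_aut_eq by (metis rangeE rangeI subsetD)

text \<open>An element of degree \<open>w\<close> is the image of its own multiple by
  \<open>w\<close>.\<close>

lemma modular_aut_surj: "\<exists>b\<in>range ev. K_conjugate q b (ev t)"
proof (induction rule: ev_induct)
  case (homogeneous w t)
  then have w: "0 < w" by (simp add: homogeneous_def)
  have "K_conjugate q (of_real w *\<^sub>C ev t) (of_real w *\<^sub>C of_real (inverse w) *\<^sub>C ev t)"
    by (intro K_conjugate_scaleC K_conjugate_homogeneous homogeneous)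
  then have "K_conjugate q (of_real w *\<^sub>C ev t) (ev t)"
    using w by (simp add: op_scaleC_scaleC)
  then show ?case using range_ev_closed(3) by blast
next
  case (add x y)
  then show ?case using K_conjugate_add range_ev_closed(1) by blast
qed

lemma algebra_automorphism_modular_aut: "algebra_automorphism (range ev) (modular_aut q)"
  unfolding algebra_automorphism_def
proof (intro conjI ballI allI)
  note KC = K_conjugate_modular_aut[THEN conjunct1] and mem = K_conjugate_modular_aut[THEN conjunct2]
  show "bij_betw (modular_aut q) (range ev) (range ev)"
    unfolding bij_betw_def
  proof (intro conjI inj_onI antisym subsetI)
    fix a b assume a: "a \<in> range ev" and b: "b \<in> range ev" and "modular_aut q a = modular_aut q b"
    then show "a = b" using KC[OF a] KC[OF b] by (intro K_conjugate_inj) simp_all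
  next
    fix b assume "b \<in> modular_aut q ` range ev"
    then show "b \<in> range ev" using mem by blast
  next
    fix b assume "b \<in> range ev"
    then obtain a where "a \<in> range ev" "K_conjugate q a b" using modular_aut_surj by blast
    then show "b \<in> modular_aut q ` range ev" using modular_aut_eq by blast
  qed
  show "modular_aut q id_blinfun = id_blinfun"
    by (rule modular_aut_eq[OF K_conjugate_id])
  fix a b assume "a \<in> range ev" "b \<in> range ev"
  note ab = this[THEN KC]
  show "modular_aut q (a + b) = modular_aut q a + modular_aut q b"
    by (rule modular_aut_eq[OF K_conjugate_add[OF ab]])
  show "modular_aut q (a o\<^sub>L b) = modular_aut q a o\<^sub>L modular_aut q b"
    by (rule modular_aut_eq[OF K_conjugate_compose[OF ab]])
next
  fix c a assume "a \<in> range ev"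
  then show "modular_aut q (c *\<^sub>C a) = c *\<^sub>C modular_aut q a"
    by (intro modular_aut_eq K_conjugate_scaleC K_conjugate_modular_aut[THEN conjunct1])
qed

lemma modular_aut_homogeneous:
  "homogeneous w T \<Longrightarrow> modular_aut q T = of_real (inverse w) *\<^sub>C T"
  by (intro modular_aut_eq K_conjugate_homogeneous)

lemma \<sigma>_range_ev: "\<sigma> t ` range ev = range ev"
proof -
  have mem: "\<sigma> t a \<in> range ev" if a: "a \<in> range ev" for a t
  proof -
    obtain x where "a = ev x" using a by blast
    then obtain f where "entire_extension BH \<sigma> a f" "range f \<subseteq> range ev"
      using ex_modular_extension[of x] by blast
    then show ?thesis by (metis entire_extension_def rangeI subsetD)
  qed
  show ?thesis
  proof (intro antisym subsetI)
    fix a assume "a \<in> range ev"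
    then show "a \<in> \<sigma> t ` range ev"
      using mem[of a "- t"] by (intro image_eqI[of _ _ "\<sigma> (- t) a"]) simp_all
  qed (use mem in blast)
qed


subsection \<open>Separability\<close>

text \<open>The countable set consists of the evaluations of coded expressions. It is stable under
  the operations, each of which is continuous in norm, so induction on the expression puts every
  element into its closure.\<close>

lemma norm_separable_range_ev: "norm_separable (range ev)"
proof -
  obtain D :: "complex set" where D: "countable D" "\<And>X. open X \<Longrightarrow> X \<noteq> {} \<Longrightarrow> \<exists>d\<in>D. d \<in> X"
    by (rule countable_dense_setE) blast
  then have "D \<noteq> {}" using D(2)[of UNIV] by blast
  have closure_D: "closure D = UNIV"
  proof (rule ccontr)
    assume "closure D \<noteq> UNIV"
    then have "- closure D \<noteq> {}" by blast
    then obtain d where "d \<in> D" "d \<in> - closure D"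
      using D(2)[of "- closure D"] open_Compl[OF closed_closure] by blast
    then show False using closure_subset by blast
  qed
  define c where "c = from_nat_into D"
  have c: "range c = D" unfolding c_def by (rule range_from_nat_into[OF \<open>D \<noteq> {}\<close> D(1)])
  define C where "C = range (\<lambda>x. ev (decode c x))"
  have C: "ev (decode c x) \<in> C" for x by (simp add: C_def)
  have "ev t \<in> closure C" for t
  proof (induction t)
    case GenA
    show ?case using C[of RGenA] closure_subset by auto
  next
    case GenB
    show ?case using C[of RGenB] closure_subset by auto
  next
    case One
    show ?case using C[of ROne] closure_subset by auto
  next
    case Zero
    show ?case using C[of RZero] closure_subset by auto
  next
    case (Add x y)
    have "continuous_on UNIV (\<lambda>p. fst p + snd p :: hsum op)" by (intro continuous_intros)
    moreover have "a + b \<in> C" if "a \<in> C" "b \<in> C" for a b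
    proof -
      obtain x y where "a = ev (decode c x)" "b = ev (decode c y)" using \<open>a \<in> C\<close> \<open>b \<in> C\<close> by (auto simp: C_def)
      then show ?thesis using C[of "RAdd x y"] by simp
    qed
    ultimately have "ev x + ev y \<in> closure C" using Add by (rule closure_binary)
    then show ?case by simp
  next
    case (Mul x y)
    have "continuous_on UNIV (\<lambda>p. fst p o\<^sub>L snd p :: hsum op)"
      by (intro bounded_bilinear.continuous_on[OF bounded_bilinear_blinfun_compose] continuous_intros)
    moreover have "a o\<^sub>L b \<in> C" if "a \<in> C" "b \<in> C" for a b
    proof -
      obtain x y where "a = ev (decode c x)" "b = ev (decode c y)" using \<open>a \<in> C\<close> \<open>b \<in> C\<close> by (auto simp: C_def)
      then show ?thesis using C[of "RMul x y"] by simp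
    qed
    ultimately have "ev x o\<^sub>L ev y \<in> closure C" using Mul by (rule closure_binary)
    then show ?case by simp
  next
    case (Scale r x)
    have "continuous_on UNIV (\<lambda>p. fst p *\<^sub>C snd p :: hsum op)"
      by (intro scaleC_op.continuous_on continuous_intros)
    moreover have "a *\<^sub>C b \<in> C" if "a \<in> D" "b \<in> C" for a b
    proof -
      obtain n x where "a = c n" "b = ev (decode c x)"
        using \<open>a \<in> D\<close> \<open>b \<in> C\<close> unfolding C_def c[symmetric] by auto
      then show ?thesis using C[of "RScale n x"] by simp
    qed
    moreover have "r \<in> closure D" by (simp add: closure_D)
    ultimately have "r *\<^sub>C ev x \<in> closure C" using Scale by (rule closure_binary)
    then show ?case by simp
  next
    case (Star x)
    show ?case
      \<comment> \<open>The adjoint does not increase the norm, so an approximation of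
        \<open>ev x\<close> is turned into one of its adjoint with the same error.\<close>
      unfolding closure_approachable
    proof (intro allI impI)
      fix e :: real assume "0 < e"
      then obtain y where y: "dist (ev (decode c y)) (ev x) < e"
        using Star unfolding closure_approachable C_def by blast
      have "norm (adj (ev (decode c y) - ev x)) \<le> norm (ev (decode c y) - ev x)"
        by (rule norm_adj_le) auto
      then have "dist (ev (decode c (RStar y))) (ev (Star x)) < e"
        using y by (simp add: dist_norm adj_diff)
      then show "\<exists>a\<in>C. dist a (ev (Star x)) < e" using C by blast
    qed
  qed
  moreover have "countable C" unfolding C_def by simp
  moreover have "C \<subseteq> range ev" unfolding C_def by blast
  ultimately show ?thesis unfolding norm_separable_def by blast
qed


subsection \<open>Summability\<close>

text \<open>The commutator is off-diagonal with entries \<open>T - S\<close> and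
  \<open>S - T\<close>; only the difference of the two summands has to decay.\<close>

lemma commutator_direct_sum:
  assumes "T - S = G o\<^sub>L wshift 0 (\<lambda>n. of_real (K_coeff q (- 1) n))" and "G \<in> BH"
  shows "\<exists>E\<in>BH. commutator F_op (direct_sum_op S T) = E o\<^sub>L Kinv"
proof (rule bexI)
  have "T x - S x = G (wshift 0 (\<lambda>n. of_real (K_coeff q (- 1) n)) x)" for x
    using arg_cong[OF assms(1), of "\<lambda>R. R x"] by (simp add: blinfun.diff_left)
  then have G: "G (wshift 0 (\<lambda>n. of_real (K_coeff q (- 1) n)) x) = T x - S x" for x ..
  show "commutator F_op (direct_sum_op S T) = (direct_sum_op G (- G) o\<^sub>L F_op) o\<^sub>L Kinv"
    by (rule blinfun_eqI) (simp add: commutator_def Kinv_def Let_def blinfun.diff_left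
        blinfun.minus_left G)
  show "direct_sum_op G (- G) o\<^sub>L F_op \<in> BH"
    using assms(2) by (simp add: direct_sum_op_BH)
qed

text \<open>With \<open>s\<close> drawn under the root, x - y is rationalized: the squares differ by
  \<open>(1 - s\<^sup>2 * s\<^sup>2) * u\<close>, of modulus at most \<open>u\<close>, and
  \<open>x + y\<close> is at least \<open>s\<close>.\<close>

lemma b_difference: "\<bar>b_minus k - b_plus k\<bar> * s \<le> q ^ (2 * k)"
proof -
  define u where "u = q ^ (2 * k)"
  have u: "0 < u" "u \<le> 1" using q_power_pos q_power_le_1 by (auto simp: u_def)
  define x where "x = sqrt (s\<^sup>2 + s\<^sup>2 * s\<^sup>2 * u)"
  define y where "y = sqrt (s\<^sup>2 + u)"
  have xy: "s \<le> y" "0 \<le> x" using s_pos u unfolding x_def y_def by (auto intro: real_le_rsqrt)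
  have "x = sqrt (s\<^sup>2 * (1 + s\<^sup>2 * u))" by (simp add: x_def algebra_simps)
  also have "\<dots> = s * sqrt (1 + s\<^sup>2 * u)" using s_pos by (simp add: real_sqrt_mult)
  finally have "x = s * sqrt (1 + s\<^sup>2 * u)" .
  then have diff: "b_minus k - b_plus k = sqrt (1 - u) * (x - y)"
    unfolding b_minus_def b_plus_def u_def[symmetric] y_def[symmetric]
    by (simp add: algebra_simps)
  have "\<bar>x - y\<bar> * s \<le> \<bar>x - y\<bar> * (x + y)"
    using xy by (intro mult_left_mono) auto
  also have "\<dots> = \<bar>(x - y) * (x + y)\<bar>" using xy s_pos by (simp add: abs_mult)
  also have "(x - y) * (x + y) = x\<^sup>2 - y\<^sup>2" by (simp add: power2_eq_square algebra_simps)
  also have "\<dots> = - ((1 - s\<^sup>2 * s\<^sup>2) * u)"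
    using u by (simp add: x_def y_def algebra_simps)
  also have "\<bar>\<dots>\<bar> \<le> 1 * u"
  proof -
    have "s\<^sup>2 * s\<^sup>2 \<le> 1" using s_square_le_1 by (intro mult_le_one) auto
    then show ?thesis using u by (simp add: abs_mult)
  qed
  finally have "\<bar>x - y\<bar> * s \<le> u" by simp
  moreover have "0 \<le> \<bar>x - y\<bar> * s" "0 \<le> sqrt (1 - u)" "sqrt (1 - u) \<le> 1" using u s_pos by auto
  ultimately have "sqrt (1 - u) * (\<bar>x - y\<bar> * s) \<le> 1 * u" by (intro mult_mono) auto
  then show ?thesis using u by (simp add: diff abs_mult u_def mult.assoc)
qed

text \<open>\<open>Kinv\<close> acts at the source index: this is \<open>n + 1\<close> for
  \<open>B\<close>, which requires \<open>k = 2\<close>, and \<open>n\<close> for its adjoint, which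
  requires \<open>k = 0\<close>.\<close>

lemma b_quotient_bounded:
  assumes "k = 0 \<or> k = 2"
  shows "bounded (range (\<lambda>n. complex_of_real ((b_minus (Suc n) - b_plus (Suc n)) / q ^ (2 * n + k))))"
proof -
  have "\<bar>(b_minus (Suc n) - b_plus (Suc n)) / q ^ (2 * n + k)\<bar> \<le> 1 / s" for n
  proof -
    have "q ^ (2 * Suc n) \<le> q ^ (2 * n + k)"
      using assms q_pos q_less_1 by (intro power_decreasing) auto
    then have "\<bar>b_minus (Suc n) - b_plus (Suc n)\<bar> * s \<le> q ^ (2 * n + k)"
      using b_difference[of "Suc n"] by linarith
    then show ?thesis
      using s_pos q_power_pos[of "2 * n + k"] by (simp add: field_simps abs_divide)
  qed
  then show ?thesis
    unfolding bounded_iff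
    by (intro exI[of _ "1 / s"] ballI) (elim rangeE, simp only: norm_of_real)
qed

text \<open>Boundedness of the commutator times \<open>K\<close>. In this form the decay can be
  carried through products; square integrability is derived from it afterwards.\<close>

definition Kdecay :: "hsum op \<Rightarrow> bool" where
  "Kdecay a \<longleftrightarrow> (\<exists>E\<in>BH. commutator F_op a = E o\<^sub>L Kinv)"

lemma Kdecay_A: "Kdecay (ev GenA)"
  unfolding Kdecay_def ev_A
proof (rule commutator_direct_sum)
  show "wshift 0 (\<lambda>n. complex_of_real (- (s\<^sup>2 * q ^ (2 * n)))) - wshift 0 (\<lambda>n. of_real (q ^ (2 * n))) =
      (- of_real (s\<^sup>2) - 1) *\<^sub>C id_blinfun o\<^sub>L wshift 0 (\<lambda>n. of_real (K_coeff q (- 1) n))"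
    unfolding K_coeff_eq[OF q_pos]
  proof (intro blinfun_eqI ell2_eqI)
    fix x n
    show "coord ((wshift 0 (\<lambda>n. complex_of_real (- (s\<^sup>2 * q ^ (2 * n)))) - wshift 0 (\<lambda>n. of_real (q ^ (2 * n)))) x) n =
      coord (((- of_real (s\<^sup>2) - 1) *\<^sub>C id_blinfun o\<^sub>L wshift 0 (\<lambda>n. of_real (q ^ (2 * n)))) x) n"
      unfolding blinfun.diff_left coord_simps blinfun_apply_blinfun_compose scaleC_blinfun_apply
        id_blinfun.rep_eq coord_wshift[OF a_bounded(1)] coord_wshift[OF a_bounded(2)]
      by (simp add: algebra_simps)
  qed
qed auto

lemma b_difference_eq:
  "wshift 1 (\<lambda>n. complex_of_real (b_minus (Suc n))) - wshift 1 (\<lambda>n. of_real (b_plus (Suc n))) =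
    wshift 1 (\<lambda>n. of_real ((b_minus (Suc n) - b_plus (Suc n)) / q ^ (2 * n + 2))) o\<^sub>L
      wshift 0 (\<lambda>n. of_real (K_coeff q (- 1) n))"
proof (intro blinfun_eqI ell2_eqI)
  fix x n
  have "b_minus (Suc n) - b_plus (Suc n) =
      (b_minus (Suc n) - b_plus (Suc n)) / q ^ (2 * n + 2) * q ^ (2 * (n + 1))"
    using q_pos by simp
  then have "complex_of_real (b_minus (Suc n)) - of_real (b_plus (Suc n)) =
      of_real ((b_minus (Suc n) - b_plus (Suc n)) / q ^ (2 * n + 2)) * of_real (q ^ (2 * (n + 1)))"
    by (simp only: of_real_diff[symmetric] of_real_mult[symmetric])
  then show "coord ((wshift 1 (\<lambda>n. complex_of_real (b_minus (Suc n))) - wshift 1 (\<lambda>n. of_real (b_plus (Suc n)))) x) n =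
    coord ((wshift 1 (\<lambda>n. of_real ((b_minus (Suc n) - b_plus (Suc n)) / q ^ (2 * n + 2))) o\<^sub>L
      wshift 0 (\<lambda>n. of_real (K_coeff q (- 1) n))) x) n"
    unfolding K_coeff_eq[OF q_pos] blinfun.diff_left coord_simps blinfun_apply_blinfun_compose
      coord_wshift[OF a_bounded(1)] coord_wshift[OF b_bounded(1)] coord_wshift[OF b_bounded(2)]
      coord_wshift[OF b_quotient_bounded[OF disjI2[OF HOL.refl]]]
    by (simp only: left_diff_distrib[symmetric] mult.assoc add_0_right)
qed

lemma Kdecay_B: "Kdecay (ev GenB)"
  unfolding Kdecay_def ev_B
  by (rule commutator_direct_sum[OF b_difference_eq])
    (intro wshift_BH b_quotient_bounded[OF disjI2[OF HOL.refl]])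

lemma adj_b_difference_eq:
  "adj (wshift 1 (\<lambda>n. complex_of_real (b_minus (Suc n)))) - adj (wshift 1 (\<lambda>n. of_real (b_plus (Suc n)))) =
    adj (wshift 1 (\<lambda>n. of_real ((b_minus (Suc n) - b_plus (Suc n)) / q ^ (2 * n + 0)))) o\<^sub>L
      wshift 0 (\<lambda>n. of_real (K_coeff q (- 1) n))"
proof (intro blinfun_eqI ell2_eqI)
  fix x n
  show "coord ((adj (wshift 1 (\<lambda>n. complex_of_real (b_minus (Suc n)))) - adj (wshift 1 (\<lambda>n. of_real (b_plus (Suc n))))) x) n =
    coord ((adj (wshift 1 (\<lambda>n. of_real ((b_minus (Suc n) - b_plus (Suc n)) / q ^ (2 * n + 0)))) o\<^sub>L
      wshift 0 (\<lambda>n. of_real (K_coeff q (- 1) n))) x) n"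
  proof (cases n)
    case 0
    then show ?thesis
      unfolding blinfun.diff_left coord_simps blinfun_apply_blinfun_compose
        coord_adj_wshift[OF b_bounded(1)] coord_adj_wshift[OF b_bounded(2)]
        coord_adj_wshift[OF b_quotient_bounded[OF disjI1[OF HOL.refl]]] by simp
  next
    case (Suc m)
    have "b_minus (Suc m) - b_plus (Suc m) =
        (b_minus (Suc m) - b_plus (Suc m)) / q ^ (2 * m + 0) * q ^ (2 * m)"
      using q_pos by simp
    then have "complex_of_real (b_minus (Suc m)) - of_real (b_plus (Suc m)) =
        of_real ((b_minus (Suc m) - b_plus (Suc m)) / q ^ (2 * m + 0)) * of_real (q ^ (2 * m))"
      by (simp only: of_real_diff[symmetric] of_real_mult[symmetric])
    then show ?thesis
      unfolding K_coeff_eq[OF q_pos] blinfun.diff_left coord_simps blinfun_apply_blinfun_compose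
        coord_adj_wshift[OF b_bounded(1)] coord_adj_wshift[OF b_bounded(2)]
        coord_adj_wshift[OF b_quotient_bounded[OF disjI1[OF HOL.refl]]]
        coord_wshift[OF a_bounded(1)] Suc diff_Suc_1 complex_cnj_complex_of_real
      by (simp only: left_diff_distrib[symmetric] mult.assoc[symmetric] nat.distinct if_False add_0_right)
  qed
qed

lemma Kdecay_Bs: "Kdecay (adj (ev GenB))"
  unfolding Kdecay_def adj_ev_B
  by (rule commutator_direct_sum[OF adj_b_difference_eq])
    (intro adj_BH wshift_BH b_quotient_bounded disjI1 HOL.refl)

lemma Kdecay_add:
  assumes "Kdecay a" "Kdecay b"
  shows "Kdecay (a + b)"
proof -
  obtain E E' where "E \<in> BH" "E' \<in> BH" "commutator F_op a = E o\<^sub>L Kinv" "commutator F_op b = E' o\<^sub>L Kinv"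
    using assms by (auto simp: Kdecay_def)
  moreover have "commutator F_op (a + b) = commutator F_op a + commutator F_op b"
    by (simp add: commutator_def compose_algebra)
  ultimately show ?thesis
    unfolding Kdecay_def by (intro bexI[of _ "E + E'"]) (simp_all add: compose_algebra)
qed

lemma Kdecay_scaleC:
  assumes "Kdecay a"
  shows "Kdecay (c *\<^sub>C a)"
proof -
  obtain E where "E \<in> BH" "commutator F_op a = E o\<^sub>L Kinv" using assms by (auto simp: Kdecay_def)
  moreover have "commutator F_op (c *\<^sub>C a) = c *\<^sub>C commutator F_op a"
    by (simp add: commutator_def scaleC_compose_left scaleC_compose_right scaleC_op.diff_right)
  ultimately show ?thesis
    unfolding Kdecay_def by (intro bexI[of _ "c *\<^sub>C E"]) (simp_all add: scaleC_compose_left)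
qed

text \<open>By the Leibniz rule; \<open>Kinv\<close> is moved past \<open>b\<close> by means of the modular automorphism.\<close>

lemma Kdecay_compose:
  assumes "a \<in> BH" "Kdecay a" "Kdecay b" "K_conjugate q b b'"
  shows "Kdecay (a o\<^sub>L b)"
proof -
  obtain E E' where E: "E \<in> BH" "E' \<in> BH" "commutator F_op a = E o\<^sub>L Kinv" "commutator F_op b = E' o\<^sub>L Kinv"
    using assms by (auto simp: Kdecay_def)
  have b': "b' \<in> BH" "b' o\<^sub>L Kinv = Kinv o\<^sub>L b" using assms(4) by (auto simp: K_conjugate_iff)
  have "commutator F_op (a o\<^sub>L b) = (commutator F_op a o\<^sub>L b) + (a o\<^sub>L commutator F_op b)"
    by (simp add: commutator_def compose_algebra op_compose_assoc)
  also have "\<dots> = ((E o\<^sub>L b') + (a o\<^sub>L E')) o\<^sub>L Kinv"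
    by (simp add: E compose_algebra op_compose_assoc b'(2))
  finally show ?thesis
    unfolding Kdecay_def using assms(1) E b'(1) by (intro bexI[of _ "(E o\<^sub>L b') + (a o\<^sub>L E')"]) auto
qed

lemma Kdecay_central: "commutator F_op a = 0 \<Longrightarrow> Kdecay a"
  unfolding Kdecay_def by (intro bexI[of _ 0]) (auto intro: blinfun_eqI)

text \<open>The adjoint is carried along for the case \<open>Star\<close>. In a product the
  right-hand factor must admit a conjugate by \<open>K\<close>: this is \<open>ev y\<close> for the
  product itself and \<open>adj (ev x)\<close> for its adjoint, both in the algebra.\<close>

lemma Kdecay_ev: "Kdecay (ev t) \<and> Kdecay (adj (ev t))"
proof (induction t)
  case (Mul x y)
  have "adj (ev x) \<in> range ev" by (rule range_ev_closed) simp
  then have K: "K_conjugate q (ev y) (modular_aut q (ev y))"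
    "K_conjugate q (adj (ev x)) (modular_aut q (adj (ev x)))"
    by (simp_all add: K_conjugate_modular_aut)
  have "Kdecay (ev x o\<^sub>L ev y)"
    using Mul by (intro Kdecay_compose[OF _ _ _ K(1)]) simp_all
  moreover have "Kdecay (adj (ev y) o\<^sub>L adj (ev x))"
    using Mul by (intro Kdecay_compose[OF _ _ _ K(2)]) simp_all
  ultimately show ?case by (simp add: adj_compose)
qed (simp_all add: Kdecay_A Kdecay_B Kdecay_Bs adj_ev_A Kdecay_add Kdecay_scaleC adj_add adj_scaleC,
    simp_all add: Kdecay_central commutator_def op_eq_iff)

text \<open>The squared column norm is at most \<open>(norm E)\<^sup>2\<close> divided by the square
  of the eigenvalue. One factor is consumed by the weight, and the inverse eigenvalues q^(2n) that
  remain are summable over both summands.\<close>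

lemma Kdecay_sq_integrable:
  assumes "a \<in> BH" "Kdecay a"
  shows "commutator F_op a \<in> sq_integrable BH W"
proof -
  obtain E where E: "E \<in> BH" "commutator F_op a = E o\<^sub>L Kinv" using assms by (auto simp: Kdecay_def)
  have "(\<lambda>n. (norm E)\<^sup>2 * q ^ (2 * n)) summable_on UNIV"
  proof (rule norm_summable_imp_summable_on)
    have "summable (\<lambda>n. (q\<^sup>2) ^ n)"
      using q_pos q_less_1 by (intro summable_geometric) (simp add: abs_square_less_1)
    then show "summable (\<lambda>n. norm ((norm E)\<^sup>2 * q ^ (2 * n)))"
      using q_pos by (simp add: power_mult abs_mult summable_mult)
  qed
  then obtain S where "((\<lambda>n. (norm E)\<^sup>2 * q ^ (2 * n)) has_sum S) UNIV"
    by (auto simp: summable_on_def)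
  then have "((\<lambda>i. (norm E)\<^sup>2 * inverse (kd i)) has_sum S + S) UNIV"
    by (intro has_sum_sum_type) (simp_all add: kd_def K_coeff_eq[OF q_pos])
  then have "(\<lambda>i. (norm E)\<^sup>2 * inverse (kd i)) summable_on UNIV"
    by (auto simp: summable_on_def)
  then have "(\<lambda>i. kd i * (norm ((E o\<^sub>L Kinv) (basis i)))\<^sup>2) summable_on UNIV"
  proof (rule summable_on_comparison_test)
    fix i
    have d: "0 < kd i" by (rule d_pos)
    have n1: "norm (basis i) = 1"
      using orthonormal[of i i] norm_ge_zero[of "basis i"]
      by (auto simp: cinner_self power2_eq_1_iff simp flip: of_real_power)
    have "norm ((E o\<^sub>L Kinv) (basis i)) \<le> norm E * norm (Kinv (basis i))"
      by (simp add: norm_blinfun)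
    also have "\<dots> = norm E * inverse (kd i)"
      using d n1 by (simp add: Kinv_basis norm_scaleC norm_inverse)
    finally have "(norm ((E o\<^sub>L Kinv) (basis i)))\<^sup>2 \<le> (norm E * inverse (kd i))\<^sup>2"
      by (intro power_mono norm_ge_zero)
    then have "kd i * (norm ((E o\<^sub>L Kinv) (basis i)))\<^sup>2 \<le> kd i * (norm E * inverse (kd i))\<^sup>2"
      using d by (intro mult_left_mono) auto
    also have "\<dots> = (norm E)\<^sup>2 * inverse (kd i)"
      using d by (simp add: power2_eq_square)
    finally show "kd i * (norm ((E o\<^sub>L Kinv) (basis i)))\<^sup>2 \<le> (norm E)\<^sup>2 * inverse (kd i)" .
    show "0 \<le> kd i * (norm ((E o\<^sub>L Kinv) (basis i)))\<^sup>2" using d by simp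
  qed
  then show ?thesis using E by (simp add: sq_integrable_iff)
qed

text \<open>The commutator with \<open>F\<close> turns adjoints into adjoints up to a sign. Hence
  the square is, up to sign, the adjoint of the commutator with \<open>adj (ev t)\<close> times the
  commutator with \<open>ev t\<close>, a product of the kind obtained by polarization.\<close>

lemma commutator_square_weight_dom: "op_power (commutator F_op (ev t)) 2 \<in> weight_dom BH W"
proof -
  have "adj (commutator F_op (ev t)) = (-1) *\<^sub>C commutator F_op (adj (ev t))"
    by (simp add: commutator_def adj_diff adj_compose adj_F_op scaleC_op.minus_left)
  then have "adj ((-1) *\<^sub>C commutator F_op (adj (ev t))) = commutator F_op (ev t)"
    using adj_adj[of "commutator F_op (ev t)"] by (simp add: commutator_def)
  moreover have "adj ((-1) *\<^sub>C commutator F_op (adj (ev t))) = (-1) *\<^sub>C adj (commutator F_op (adj (ev t)))"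
    by (simp add: adj_scaleC commutator_def)
  moreover have "adj (commutator F_op (adj (ev t))) o\<^sub>L commutator F_op (ev t) \<in> weight_dom BH W"
    using Kdecay_ev by (intro adj_compose_weight_dom Kdecay_sq_integrable) auto
  ultimately have "commutator F_op (ev t) o\<^sub>L commutator F_op (ev t) \<in> weight_dom BH W"
    using weight_dom_scaleC[of _ BH W "-1"] by (metis scaleC_compose_left)
  then show ?thesis by (simp add: op_power_def numeral_2_eq_2)
qed

section \<open>The grading and the assembly of the module\<close>

text \<open>Direct sums of operators commute with the grading. The adjoint is included in the
  induction for the sake of \<open>Star\<close>.\<close>

lemma gamma_commute: "gamma_op o\<^sub>L ev t = ev t o\<^sub>L gamma_op"
proof -
  have "gamma_op o\<^sub>L direct_sum_op S T = direct_sum_op S T o\<^sub>L gamma_op" for S T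
    by (rule blinfun_eqI) (simp add: blinfun.minus_right)
  note direct_sum = this
  have compose: "gamma_op o\<^sub>L (S o\<^sub>L T) = (S o\<^sub>L T) o\<^sub>L gamma_op"
    if S: "gamma_op o\<^sub>L S = S o\<^sub>L gamma_op" and T: "gamma_op o\<^sub>L T = T o\<^sub>L gamma_op" for S T :: "hsum op"
  proof -
    have "gamma_op o\<^sub>L (S o\<^sub>L T) = S o\<^sub>L (gamma_op o\<^sub>L T)"
      by (simp only: op_compose_assoc[symmetric] S)
    then show ?thesis by (simp only: T op_compose_assoc)
  qed
  have zero: "gamma_op o\<^sub>L 0 = 0" "0 o\<^sub>L gamma_op = 0"
    by (rule blinfun_eqI, simp)+
  have "gamma_op o\<^sub>L ev t = ev t o\<^sub>L gamma_op \<and> gamma_op o\<^sub>L adj (ev t) = adj (ev t) o\<^sub>L gamma_op"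
  proof (induction t)
    case GenA
    show ?case unfolding adj_ev_A unfolding ev_A using direct_sum by blast
  next
    case GenB
    show ?case unfolding adj_ev_B unfolding ev_B using direct_sum by blast
  next
    case (Mul x y)
    then show ?case
      by (simp only: podles_eval.simps adj_compose[OF ev_BH ev_BH] compose)
  qed (simp_all add: adj_add adj_scaleC compose_algebra scaleC_compose_left scaleC_compose_right zero)
  then show ?thesis ..
qed

lemma modular_Fredholm_module_podles:
  "modular_Fredholm_module 2 BH (Phi q) \<sigma> (podles_image q s) F_op"
  unfolding modular_Fredholm_module_def podles_image_eq Phi_eq_W
proof (intro conjI ballI allI)
  show "unital_star_subalgebra (range ev) BH"
    unfolding unital_star_subalgebra_def by (auto intro: range_ev_closed)
  show "analytic_vector BH \<sigma> a" if a: "a \<in> range ev" for a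
  proof -
    obtain x where "a = ev x" using a by blast
    moreover obtain f where "entire_extension BH \<sigma> (ev x) f"
      using ex_modular_extension[of x] by blast
    ultimately show ?thesis by (auto simp only: analytic_vector_def ev_BH)
  qed
  show "op_power (commutator F_op a) 2 \<in> weight_dom BH W" if "a \<in> range ev" for a
    using that commutator_square_weight_dom by blast
  show "F_op o\<^sub>L F_op = id_blinfun" by (rule blinfun_eqI) simp
qed (rule von_neumann_algebra_BH fns_weight_W modular_group_W norm_separable_range_ev \<sigma>_range_ev
    fixed_point_homogeneous[OF homogeneous_F] adj_F_op)+

lemma even_grading_podles: "even_grading BH \<sigma> (podles_image q s) F_op gamma_op"
  unfolding even_grading_def podles_image_eq
  using gamma_commute
  by (auto simp: fixed_point_homogeneous[OF homogeneous_gamma] adj_gamma_op blinfun.add_left zero_prod_def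
      intro!: blinfun_eqI)

end

theorem lemma2:
  fixes q s :: real
  assumes "0 < q" "q < 1" "0 < s" "s \<le> 1"
  shows "(\<forall>t. podles_rep q s (podles_class q s t) = podles_eval q s t) \<and>
    inj_on (podles_rep q s) (podles_algebra q s) \<and>
    (\<exists>\<sigma>. modular_Fredholm_module 2 BH (Phi q) \<sigma> (podles_image q s) F_op \<and>
         even_grading BH \<sigma> (podles_image q s) F_op gamma_op \<and>
         (\<forall>a\<in>podles_image q s. \<exists>f. entire_extension BH \<sigma> a f \<and> f \<i> = modular_aut q a)) \<and>
    (\<forall>a\<in>podles_image q s. K_conjugate q a (modular_aut q a)) \<and>
    algebra_automorphism (podles_image q s) (modular_aut q) \<and>
    (let A = podles_rep q s (podles_class q s GenA);
         B = podles_rep q s (podles_class q s GenB);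
         Bs = podles_rep q s (podles_class q s (Star GenB))
     in modular_aut q A = A \<and>
        modular_aut q B = of_real (inverse (q\<^sup>2)) *\<^sub>C B \<and>
        modular_aut q Bs = of_real (q\<^sup>2) *\<^sub>C Bs)"
proof -
  interpret podles q s
    by standard (use assms in auto)
  have extension: "\<exists>f. entire_extension BH \<sigma> a f \<and> f \<i> = modular_aut q a"
    if "a \<in> podles_image q s" for a
    using that ex_modular_extension modular_aut_eq unfolding podles_image_eq by (metis rangeE)
  have "modular_aut q (ev GenA) = ev GenA"
    "modular_aut q (ev GenB) = of_real (inverse (q\<^sup>2)) *\<^sub>C ev GenB"
    "modular_aut q (ev (Star GenB)) = of_real (q\<^sup>2) *\<^sub>C ev (Star GenB)"
    using modular_aut_homogeneous[OF homogeneous_ev_A] modular_aut_homogeneous[OF homogeneous_ev_B]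
      modular_aut_homogeneous[OF homogeneous_ev_Bs] by simp_all
  then show ?thesis
    using podles_rep_class inj_on_podles_rep modular_Fredholm_module_podles even_grading_podles
      extension K_conjugate_modular_aut algebra_automorphism_modular_aut
    unfolding Let_def podles_image_eq by (simp only:) blast
qed

end
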